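(* Let $G$ be a non-Hausdorff ample groupoid and $\mathbb{K}$ a field of characteristic $p$. Then the Steinberg algebra $\mathbb{K}G$ is simple if and only if $G$ is minimal, effective and does not satisfy condition $(\mathcal{S}_p)$.
   Context: Groupoids. A groupoid $G$ is a small category all of whose morphisms are invertible, identified with its set of morphisms; $G^{(0)}\subseteq G$ is its set of units and $r,s\colon G\to G^{(0)}$ are range and source. Topological groupoids (continuous range, source, multiplication, inversion) are always assumed locally compact with $G^{(0)}$ Hausdorff in the subspace topology; $G$ itself need not be Hausdorff, and compact subsets need not be closed. $G$ is étale if $r$ is a local homeomorphism, and ample if in addition $G^{(0)}$ is totally disconnected. An open bisection is an open subset $U\subseteq G$ on which $r$ and $s$ are injective. $G$ is minimal if for every $x\in G^{(0)}$ the orbit $\{r(g): g\in G, s(g)=x\}$ is dense in $G^{(0)}$. $G$ is effective if the interior of $\mathrm{Iso}(G)=\{g\in G:r(g)=s(g)\}$ equals $G^{(0)}$. Steinberg algebra. $\mathbb{K}G$ is the $\mathbb{K}$-span of the functions $c_U\colon G\to\mathbb{K}$ ($c\in\mathbb{K}$, $U\subseteq G$ compact open bisection), where $c_U$ equals $c$ on $U$ and $0$ elsewhere, with convolution product $(f_1*f_2)(g)=\sum_{g_1g_2=g}f_1(g_1)f_2(g_2)$. Condition $(\mathcal{S}_t)$, for $t\in\{0,2,3,\dots\}$: put $R_0=\mathbb{Q}$ and $R_t=\mathbb{Z}/t\mathbb{Z}$ for $t>1$. There exist a positive integer $n$ and open bisections $U_1,\dots,U_n\subseteq G$ such that (1)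 $s(U_i)=s(U_j)$ for all $1\le i,j\le n$; (2) $U_i\setminus\bigcup_{j\neq i}U_j$ is non-empty and has empty interior for all $1\le i\le n$; (3) $\mathrm{span}_{R_t}\{b_I: I\subseteq\{1,\dots,n\},\ \#I>1,\ (\bigcap_{i\in I}U_i)\setminus(\bigcup_{j\notin I}U_j)\neq\emptyset\}\neq R_t^n$, where $b_I=\sum_{i\in I}b_i$ and $b_i$ is the $i$-th standard basis vector of $R_t^n$. *)

theory Defs
  imports
    "HOL-Analysis.Analysis"
    "HOL-Library.Function_Algebras"
    "HOL-Number_Theory.Residues"
    "HOL-Algebra.Algebraic_Closure_Type"
begin

section \<open>Topological groupoids\<close>

text \<open>A groupoid is identified with its set of morphisms, which is the underlying set of its topology.
  The total function \<^term>\<open>gmul\<close> is meaningful only on composable pairs.\<close>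

record 'g top_groupoid =
  gtop :: "'g topology"
  rng :: "'g \<Rightarrow> 'g"
  src :: "'g \<Rightarrow> 'g"
  gmul :: "'g \<Rightarrow> 'g \<Rightarrow> 'g"
  ginv :: "'g \<Rightarrow> 'g"

definition arrows :: "'g top_groupoid \<Rightarrow> 'g set" where
  "arrows G = topspace (gtop G)"

definition units :: "'g top_groupoid \<Rightarrow> 'g set" where
  "units G = rng G ` arrows G"

definition unit_space :: "'g top_groupoid \<Rightarrow> 'g topology" where
  "unit_space G = subtopology (gtop G) (units G)"

definition composable :: "'g top_groupoid \<Rightarrow> ('g \<times> 'g) set" where
  "composable G = {(g, h). g \<in> arrows G \<and> h \<in> arrows G \<and> src G g = rng G h}"

locale groupoid =
  fixes G :: "'g top_groupoid"
  assumes rng_closed: "g \<in> arrows G \<Longrightarrow> rng G g \<in> arrows G"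
    and src_closed: "g \<in> arrows G \<Longrightarrow> src G g \<in> arrows G"
    and rng_rng: "g \<in> arrows G \<Longrightarrow> rng G (rng G g) = rng G g"
    and src_rng: "g \<in> arrows G \<Longrightarrow> src G (rng G g) = rng G g"
    and rng_src: "g \<in> arrows G \<Longrightarrow> rng G (src G g) = src G g"
    and src_src: "g \<in> arrows G \<Longrightarrow> src G (src G g) = src G g"
    and gmul_closed: "(g, h) \<in> composable G \<Longrightarrow> gmul G g h \<in> arrows G"
    and rng_gmul: "(g, h) \<in> composable G \<Longrightarrow> rng G (gmul G g h) = rng G g"
    and src_gmul: "(g, h) \<in> composable G \<Longrightarrow> src G (gmul G g h) = src G h"
    and gmul_assoc: "(g, h) \<in> composable G \<Longrightarrow> (h, k) \<in> composable G \<Longrightarrow>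
      gmul G (gmul G g h) k = gmul G g (gmul G h k)"
    and rng_gmul_left: "g \<in> arrows G \<Longrightarrow> gmul G (rng G g) g = g"
    and gmul_src_right: "g \<in> arrows G \<Longrightarrow> gmul G g (src G g) = g"
    and ginv_closed: "g \<in> arrows G \<Longrightarrow> ginv G g \<in> arrows G"
    and rng_ginv: "g \<in> arrows G \<Longrightarrow> rng G (ginv G g) = src G g"
    and src_ginv: "g \<in> arrows G \<Longrightarrow> src G (ginv G g) = rng G g"
    and gmul_ginv_right: "g \<in> arrows G \<Longrightarrow> gmul G g (ginv G g) = rng G g"
    and gmul_ginv_left: "g \<in> arrows G \<Longrightarrow> gmul G (ginv G g) g = src G g"

text \<open>Only the unit space is required to be Hausdorff.\<close>

locale topological_groupoid = groupoid +
  assumes continuous_rng: "continuous_map (gtop G) (unit_space G) (rng G)"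
    and continuous_src: "continuous_map (gtop G) (unit_space G) (src G)"
    and continuous_gmul:
      "continuous_map (subtopology (prod_topology (gtop G) (gtop G)) (composable G)) (gtop G)
         (\<lambda>(g, h). gmul G g h)"
    and continuous_ginv: "continuous_map (gtop G) (gtop G) (ginv G)"
    and locally_compact: "locally_compact_space (gtop G)"
    and Hausdorff_units: "Hausdorff_space (unit_space G)"

definition local_homeomorphism :: "'a topology \<Rightarrow> 'b topology \<Rightarrow> ('a \<Rightarrow> 'b) \<Rightarrow> bool" where
  "local_homeomorphism T T' f \<longleftrightarrow>
     (\<forall>x \<in> topspace T. \<exists>U. openin T U \<and> x \<in> U \<and> openin T' (f ` U) \<and>
        homeomorphic_map (subtopology T U) (subtopology T' (f ` U)) f)"

definition totally_disconnected :: "'a topology \<Rightarrow> bool" where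
  "totally_disconnected T \<longleftrightarrow> (\<forall>S. connectedin T S \<longrightarrow> (\<forall>x \<in> S. \<forall>y \<in> S. x = y))"

locale etale_groupoid = topological_groupoid +
  assumes etale: "local_homeomorphism (gtop G) (unit_space G) (rng G)"

locale ample_groupoid = etale_groupoid +
  assumes ample: "totally_disconnected (unit_space G)"

definition open_bisection :: "'g top_groupoid \<Rightarrow> 'g set \<Rightarrow> bool" where
  "open_bisection G U \<longleftrightarrow> openin (gtop G) U \<and> inj_on (rng G) U \<and> inj_on (src G) U"

definition compact_open_bisection :: "'g top_groupoid \<Rightarrow> 'g set \<Rightarrow> bool" where
  "compact_open_bisection G U \<longleftrightarrow> open_bisection G U \<and> compactin (gtop G) U"

definition orbit :: "'g top_groupoid \<Rightarrow> 'g \<Rightarrow> 'g set" where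
  "orbit G x = {rng G g | g. g \<in> arrows G \<and> src G g = x}"

definition minimal :: "'g top_groupoid \<Rightarrow> bool" where
  "minimal G \<longleftrightarrow> (\<forall>x \<in> units G. unit_space G closure_of orbit G x = units G)"

definition isotropy :: "'g top_groupoid \<Rightarrow> 'g set" where
  "isotropy G = {g \<in> arrows G. rng G g = src G g}"

definition effective :: "'g top_groupoid \<Rightarrow> bool" where
  "effective G \<longleftrightarrow> gtop G interior_of isotropy G = units G"


section \<open>The Steinberg algebra\<close>

interpretation fun_space: vector_space "\<lambda>(c :: 'k :: field) (f :: 'g \<Rightarrow> 'k) g. c * f g"
  by unfold_locales (auto simp: fun_eq_iff algebra_simps)

definition char_fun :: "'k :: field \<Rightarrow> 'g set \<Rightarrow> 'g \<Rightarrow> 'k" where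
  "char_fun c U = (\<lambda>g. if g \<in> U then c else 0)"

definition steinberg_algebra :: "'g top_groupoid \<Rightarrow> ('g \<Rightarrow> 'k :: field) set" where
  "steinberg_algebra G = fun_space.span {char_fun c U | c U. compact_open_bisection G U}"

text \<open>Functions on \<^term>\<open>arrows G\<close> are represented by functions on the whole type that vanish off
  \<^term>\<open>arrows G\<close>. The convolution sum is restricted to its non-zero terms, of which there are
  finitely many when both arguments lie in the Steinberg algebra of an etale groupoid.\<close>

definition convolution ::
  "'g top_groupoid \<Rightarrow> ('g \<Rightarrow> 'k :: field) \<Rightarrow> ('g \<Rightarrow> 'k) \<Rightarrow> 'g \<Rightarrow> 'k" where
  "convolution G f1 f2 = (\<lambda>g.
     \<Sum>(g1, g2) | (g1, g2) \<in> composable G \<and> gmul G g1 g2 = g \<and> f1 g1 * f2 g2 \<noteq> 0. f1 g1 * f2 g2)"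

definition steinberg_ideal :: "'g top_groupoid \<Rightarrow> ('g \<Rightarrow> 'k :: field) set \<Rightarrow> bool" where
  "steinberg_ideal G J \<longleftrightarrow> J \<subseteq> steinberg_algebra G \<and> fun_space.subspace J \<and>
     (\<forall>a \<in> steinberg_algebra G. \<forall>f \<in> J. convolution G a f \<in> J \<and> convolution G f a \<in> J)"

text \<open>The algebra need not be unital, so simplicity includes that the product is not identically zero.
  The type argument selects the field of coefficients.\<close>

definition steinberg_simple :: "'k :: field itself \<Rightarrow> 'g top_groupoid \<Rightarrow> bool" where
  "steinberg_simple K G \<longleftrightarrow>
     (\<exists>f \<in> steinberg_algebra G. \<exists>h \<in> steinberg_algebra G. convolution G f h \<noteq> (0 :: 'g \<Rightarrow> 'k)) \<and>
     (\<forall>J :: ('g \<Rightarrow> 'k) set. steinberg_ideal G J \<longrightarrow> J = {0} \<or> J = steinberg_algebra G)"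


section \<open>The singularity condition\<close>

text \<open>The free module of rank \<open>n\<close> with coordinates indexed by \<open>1, \<dots>, n\<close>. The record type of modules
  extends that of rings, so it has two multiplicative fields that play no role.\<close>

definition free_module :: "'r ring \<Rightarrow> nat \<Rightarrow> ('r, nat \<Rightarrow> 'r) module" where
  "free_module R n =
     \<lparr>carrier = {1..n} \<rightarrow>\<^sub>E carrier R, monoid.mult = undefined, one = undefined,
      zero = (\<lambda>i\<in>{1..n}. \<zero>\<^bsub>R\<^esub>), add = (\<lambda>v w. \<lambda>i\<in>{1..n}. v i \<oplus>\<^bsub>R\<^esub> w i),
      smult = (\<lambda>a v. \<lambda>i\<in>{1..n}. a \<otimes>\<^bsub>R\<^esub> v i)\<rparr>"

lemma free_module_module:
  assumes "cring R"
  shows "Module.module R (free_module R n)"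
proof -
  interpret cring R by fact
  show ?thesis
  proof (rule moduleI)
    show "abelian_group (free_module R n)"
    proof (rule abelian_groupI)
      fix x assume x: "x \<in> carrier (free_module R n)"
      show "\<exists>y\<in>carrier (free_module R n). y \<oplus>\<^bsub>free_module R n\<^esub> x = \<zero>\<^bsub>free_module R n\<^esub>"
        using x by (intro bexI[of _ "\<lambda>i\<in>{1..n}. \<ominus>\<^bsub>R\<^esub> x i"])
          (auto simp: free_module_def PiE_iff l_neg fun_eq_iff restrict_def extensional_def)
    qed (auto simp: free_module_def PiE_iff extensional_def restrict_def fun_eq_iff a_ac)
  qed (auto simp: free_module_def PiE_iff extensional_def restrict_def fun_eq_iff m_assoc
      l_distr r_distr assms)
qed

definition std_basis :: "'r ring \<Rightarrow> nat \<Rightarrow> nat \<Rightarrow> nat \<Rightarrow> 'r" where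
  "std_basis R n i = (\<lambda>j\<in>{1..n}. if j = i then \<one>\<^bsub>R\<^esub> else \<zero>\<^bsub>R\<^esub>)"

definition basis_sum :: "'r ring \<Rightarrow> nat \<Rightarrow> nat set \<Rightarrow> nat \<Rightarrow> 'r" where
  "basis_sum R n I = finsum (free_module R n) (std_basis R n) I"

lemma basis_sum_eq:
  assumes "cring R" and "I \<subseteq> {1..n}"
  shows "basis_sum R n I = (\<lambda>j\<in>{1..n}. if j \<in> I then \<one>\<^bsub>R\<^esub> else \<zero>\<^bsub>R\<^esub>)"
proof -
  interpret R: cring R by fact
  interpret M: Module.module R "free_module R n" by (rule free_module_module) fact
  have "finite I" using assms(2) finite_subset by blast
  then show ?thesis using assms(2)
  proof (induction I)
    case empty
    have "basis_sum R n {} = \<zero>\<^bsub>free_module R n\<^esub>"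
      by (simp add: basis_sum_def)
    then show ?case by (simp add: free_module_def)
  next
    case (insert i I)
    have *: "std_basis R n j \<in> carrier (free_module R n)" for j
      by (auto simp: std_basis_def free_module_def)
    have "basis_sum R n (insert i I) =
        std_basis R n i \<oplus>\<^bsub>free_module R n\<^esub> basis_sum R n I"
      unfolding basis_sum_def using insert * by (intro M.finsum_insert) auto
    then show ?case using insert
      by (auto simp: std_basis_def free_module_def fun_eq_iff restrict_def)
  qed
qed

definition module_span :: "'r ring \<Rightarrow> ('r, 'v) module \<Rightarrow> 'v set \<Rightarrow> 'v set" where
  "module_span R M S =
     {finsum M (\<lambda>v. a v \<odot>\<^bsub>M\<^esub> v) A | A a. finite A \<and> A \<subseteq> S \<and> a \<in> A \<rightarrow> carrier R}"

text \<open>The index sets \<open>I\<close> for which some point lies in \<open>U\<^sub>i\<close> exactly when \<open>i \<in> I\<close>.\<close>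

definition incidence_sets :: "nat \<Rightarrow> (nat \<Rightarrow> 'g set) \<Rightarrow> nat set set" where
  "incidence_sets n U =
     {I. I \<subseteq> {1..n} \<and> card I > 1 \<and> (\<Inter>i\<in>I. U i) - (\<Union>j\<in>{1..n} - I. U j) \<noteq> {}}"

definition condition_S_over :: "'r ring \<Rightarrow> 'g top_groupoid \<Rightarrow> bool" where
  "condition_S_over R G \<longleftrightarrow>
     (\<exists>n > 0. \<exists>U :: nat \<Rightarrow> 'g set.
        (\<forall>i \<in> {1..n}. open_bisection G (U i)) \<and>
        (\<forall>i \<in> {1..n}. \<forall>j \<in> {1..n}. src G ` U i = src G ` U j) \<and>
        (\<forall>i \<in> {1..n}. U i - (\<Union>j\<in>{1..n} - {i}. U j) \<noteq> {} \<and>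
           gtop G interior_of (U i - (\<Union>j\<in>{1..n} - {i}. U j)) = {}) \<and>
        module_span R (free_module R n) (basis_sum R n ` incidence_sets n U)
          \<noteq> carrier (free_module R n))"

text \<open>The coefficient ring is the rationals for \<open>t = 0\<close>; only \<open>t \<noteq> 1\<close> is meaningful.\<close>

definition condition_S :: "nat \<Rightarrow> 'g top_groupoid \<Rightarrow> bool" where
  "condition_S t G \<longleftrightarrow>
     (if t = 0 then condition_S_over (ring_of_type_algebra :: rat ring) G
      else condition_S_over (residue_ring (int t)) G)"

end

theory Submission
  imports Defs
begin

text \<open>A nonzero function vanishing on a dense open set generates a proper ideal, and conversely a
  nonzero ideal of a minimal effective groupoid is everything as soon as it contains a function that is
  constant and nonzero on some open set: translating that set to the units and shrinking it by effectiveness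
  gives the indicator of a compact open set of units, which minimality spreads over the unit space. Every
  element of the algebra is constant on some open subset of any given open set, so simplicity comes down to
  the absence of nonzero functions with support of empty interior.

  If \<open>f\<close> is such a function, choose a fibre \<open>s\<^bsup>-1\<^esup>(x)\<close> on which it has the least positive
  number \<open>n\<close> of nonzero values. Near that fibre \<open>f\<close> is \<open>\<Sum>\<^sub>i a\<^sub>i 1\<^bsub>U\<^sub>i\<^esub>\<close> with one bisection through each of the
  \<open>n\<close> points, and minimality of \<open>n\<close> makes \<open>f\<close> vanish wherever two of the \<open>U\<^sub>i\<close> meet, so \<open>a\<close>
  annihilates the relevant \<open>b\<^sub>I\<close>. Conversely such an annihilator \<open>a\<close> defines a function of this kind, and
  annihilators over the field exist exactly when the \<open>b\<^sub>I\<close> fail to span over the prime field.\<close>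

section \<open>Ample groupoids\<close>

text \<open>Since \<open>G\<close> need not be Hausdorff, a compact open bisection need not be
  closed, and intersections or differences of such sets need not be compact. Elements of the algebra
  need not be locally constant, and cutting one down to a smaller set may lead out of the algebra.
  The safe cuts are along compact open sets of units, which are clopen in the Hausdorff unit space.
  This is how a nonzero element can have a support without interior, the one obstruction that
  minimality and effectiveness leave. These two properties are necessary for separate reasons: the
  functions vanishing over a given orbit form an ideal, and so do the functions acting as zero on
  the free vector space over the unit space. The descent to the prime field works because the
  vectors b_I have entries 0 and 1, and the rank of such a matrix does not change under field
  extension. Clause (2) of the condition has two uses: an arrow lying in only one U_i makes the
  function built from an annihilator nonzero, and the empty interior of the set of such arrows makes
  that function vanish densely.\<close>

lemma compact_open_nbhd_if_totally_disconnected: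
  assumes H: "Hausdorff_space T" and lcs: "locally_compact_space T"
    and td: "totally_disconnected T" and U: "openin T U" "x \<in> U"
  obtains V where "openin T V" "compactin T V" "x \<in> V" "V \<subseteq> U"
proof -
  have "neighbourhood_base_of (compactin T) T"
    using H lcs locally_compact_space_neighbourhood_base by blast
  then obtain O' K where OK: "openin T O'" "compactin T K" "x \<in> O'" "O' \<subseteq> K" "K \<subseteq> U"
    using U unfolding neighbourhood_base_of by meson
  define Y where "Y = subtopology T K"
  have topY: "topspace Y = K"
    using compactin_subset_topspace[OF OK(2)] by (auto simp: Y_def)
  have cY: "compact_space Y"
    using OK(2) by (simp add: Y_def compactin_subspace)
  have hY: "Hausdorff_space Y"
    using H by (simp add: Y_def Hausdorff_space_subtopology)
  define C where "C = quasi_component_of_set Y x"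
  have xK: "x \<in> topspace Y" using OK topY by auto
  have C: "C \<in> quasi_components_of Y"
    using xK by (simp add: C_def quasi_component_in_quasi_components_of)
  \<comment> \<open>Quasi-components are what clopen splittings separate, and components are what
    total disconnectedness controls. They coincide in the compact Hausdorff space \<open>Y\<close>,
    so \<open>x\<close> can be split off from the compact set \<open>K - O'\<close>.\<close>
  then have "C \<in> connected_components_of Y"
    using cY hY by (metis compact_imp_locally_compact_space compact_quasi_eq_connected_components_of
        closedin_compact_space closedin_quasi_components_of quasi_eq_connected_components_of)
  then have "connectedin T C"
    using connectedin_connected_components_of Y_def connectedin_subtopology by blast
  moreover have xC: "x \<in> C"
    using xK by (simp add: C_def)
  ultimately have "C = {x}"
    using td unfolding totally_disconnected_def by blast
  have "openin Y O'"
    using OK by (auto simp: Y_def openin_subtopology_alt)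
  then have "compactin Y (K - O')"
    using cY closedin_compact_space topY openin_closedin_eq closedin_diff closedin_topspace by metis
  then have "separated_between Y C (K - O')"
    using separated_between_quasi_component_compact[OF C] \<open>C = {x}\<close> OK by (auto simp: disjnt_def)
  then obtain A B where AB: "openin Y A" "openin Y B" "A \<union> B = K" "disjnt A B" "C \<subseteq> A" "K - O' \<subseteq> B"
    unfolding separated_between_def topY by blast
  have AO: "A \<subseteq> O'" using AB by (auto simp: disjnt_def)
  obtain W where W: "openin T W" "A = W \<inter> K"
    using AB(1) by (auto simp: Y_def openin_subtopology)
  \<comment> \<open>\<open>A\<close> is only known to be open relative to \<open>K\<close>; lying
    inside the open set \<open>O'\<close> makes it open in the whole space.\<close>
  have "A = W \<inter> O'" using W AO OK by auto
  then have "openin T A" using W OK by auto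
  moreover have "A = topspace Y - B" using AB topY by (auto simp: disjnt_def)
  then have "compactin T A"
    using AB cY closedin_compact_space Y_def compactin_subtopology by (metis closedin_diff closedin_topspace)
  moreover have "x \<in> A" "A \<subseteq> U" using AB(5) xC AO OK by auto
  ultimately show thesis by (intro that)
qed

section \<open>Algebra of arrows and of sets of arrows\<close>

context groupoid
begin

lemma units_iff: "x \<in> units G \<longleftrightarrow> x \<in> arrows G \<and> rng G x = x"
  unfolding units_def using rng_closed rng_rng by force

lemma units_iff_src: "x \<in> units G \<longleftrightarrow> x \<in> arrows G \<and> src G x = x"
  using units_iff rng_src src_rng by metis

lemma rng_unit: "x \<in> units G \<Longrightarrow> rng G x = x"
  and src_unit: "x \<in> units G \<Longrightarrow> src G x = x"
  and unit_arrow: "x \<in> units G \<Longrightarrow> x \<in> arrows G"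
  using units_iff units_iff_src by auto

lemma rng_in_units: "g \<in> arrows G \<Longrightarrow> rng G g \<in> units G"
  by (auto simp: units_def)

lemma src_in_units: "g \<in> arrows G \<Longrightarrow> src G g \<in> units G"
  by (simp add: units_iff src_closed rng_src)

lemma gmul_in: "g \<in> arrows G \<Longrightarrow> h \<in> arrows G \<Longrightarrow> src G g = rng G h \<Longrightarrow> gmul G g h \<in> arrows G"
  and rng_mul: "g \<in> arrows G \<Longrightarrow> h \<in> arrows G \<Longrightarrow> src G g = rng G h \<Longrightarrow> rng G (gmul G g h) = rng G g"
  and src_mul: "g \<in> arrows G \<Longrightarrow> h \<in> arrows G \<Longrightarrow> src G g = rng G h \<Longrightarrow> src G (gmul G g h) = src G h"
  by (auto simp: composable_def intro!: gmul_closed rng_gmul src_gmul)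

lemmas groupoid_simps = gmul_in rng_mul src_mul rng_closed src_closed rng_rng src_rng rng_src
  src_src ginv_closed rng_ginv src_ginv

lemma mul_assoc: "g \<in> arrows G \<Longrightarrow> h \<in> arrows G \<Longrightarrow> k \<in> arrows G \<Longrightarrow> src G g = rng G h \<Longrightarrow>
    src G h = rng G k \<Longrightarrow> gmul G (gmul G g h) k = gmul G g (gmul G h k)"
  by (rule gmul_assoc) (auto simp: composable_def)

lemma inv_mul_cancel:
  assumes "g \<in> arrows G" "h \<in> arrows G" "src G g = rng G h"
  shows "gmul G (ginv G g) (gmul G g h) = h"
  by (metis assms mul_assoc ginv_closed src_ginv gmul_ginv_left rng_gmul_left)

lemma mul_inv_cancel:
  assumes "g \<in> arrows G" "h \<in> arrows G" "rng G g = rng G h"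
  shows "gmul G g (gmul G (ginv G g) h) = h"
  by (metis assms mul_assoc ginv_closed src_ginv rng_ginv gmul_ginv_right rng_gmul_left)

lemma mul_cancel_inv:
  assumes "g \<in> arrows G" "h \<in> arrows G" "src G g = rng G h"
  shows "gmul G (gmul G g h) (ginv G h) = g"
  by (metis assms mul_assoc ginv_closed rng_ginv gmul_ginv_right gmul_src_right)

lemma inv_cancel_mul:
  assumes "g \<in> arrows G" "h \<in> arrows G" "src G g = src G h"
  shows "gmul G (gmul G g (ginv G h)) h = g"
  by (metis assms mul_assoc ginv_closed rng_ginv src_ginv gmul_ginv_left gmul_src_right)

lemma inv_inv:
  assumes g: "g \<in> arrows G"
  shows "ginv G (ginv G g) = g"
proof -
  have "gmul G (ginv G (ginv G g)) (src G g) = g"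
    using inv_mul_cancel[of "ginv G g" g] g by (simp add: ginv_closed src_ginv gmul_ginv_left)
  moreover have "src G (ginv G (ginv G g)) = src G g"
    using g by (simp add: ginv_closed src_ginv rng_ginv)
  ultimately show ?thesis
    using gmul_src_right[of "ginv G (ginv G g)"] g by (simp add: ginv_closed)
qed

lemma inj_on_src_inv_image:
  assumes "U \<subseteq> arrows G" "inj_on (rng G) U"
  shows "inj_on (src G) (ginv G ` U)"
proof (rule inj_onI, elim imageE)
  fix a b u v assume *: "a = ginv G u" "u \<in> U" "b = ginv G v" "v \<in> U" "src G a = src G b"
  then have "rng G u = rng G v" using assms(1) src_ginv by (metis subsetD)
  then show "a = b" using * assms(2) by (simp add: inj_on_eq_iff)
qed

lemma inj_on_rng_inv_image:
  assumes "U \<subseteq> arrows G" "inj_on (src G) U"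
  shows "inj_on (rng G) (ginv G ` U)"
proof (rule inj_onI, elim imageE)
  fix a b u v assume *: "a = ginv G u" "u \<in> U" "b = ginv G v" "v \<in> U" "rng G a = rng G b"
  then have "src G u = src G v" using assms(1) rng_ginv by (metis subsetD)
  then show "a = b" using * assms(2) by (simp add: inj_on_eq_iff)
qed

text \<open>The multiplication of the inverse semigroup of bisections, extended to arbitrary sets of
  arrows. The inverse of a bisection is its image under \<open>ginv\<close>.\<close>

definition gprod where
  "gprod A B = {gmul G a b | a b. a \<in> A \<and> b \<in> B \<and> src G a = rng G b}"

lemma gprodI: "a \<in> A \<Longrightarrow> b \<in> B \<Longrightarrow> src G a = rng G b \<Longrightarrow> gmul G a b \<in> gprod A B"
  by (auto simp: gprod_def)

end

section \<open>Topology of an ample groupoid: units, ranges and sources\<close>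

context ample_groupoid
begin

lemma topspace_arrows: "topspace (gtop G) = arrows G"
  by (simp add: arrows_def)

lemma open_arrows: "openin (gtop G) U \<Longrightarrow> U \<subseteq> arrows G"
  using openin_subset topspace_arrows by metis

lemma units_subset: "units G \<subseteq> arrows G"
  using unit_arrow by auto

lemma topspace_unit_space: "topspace (unit_space G) = units G"
  using units_subset by (auto simp: unit_space_def topspace_arrows)

lemma open_vimage_rng: "openin (gtop G) V \<Longrightarrow> openin (gtop G) {g \<in> arrows G. rng G g \<in> V}"
  using openin_continuous_map_preimage[of "gtop G" "gtop G" "rng G" V] continuous_rng
  by (simp add: unit_space_def continuous_map_in_subtopology topspace_arrows)

lemma open_vimage_src: "openin (gtop G) V \<Longrightarrow> openin (gtop G) {g \<in> arrows G. src G g \<in> V}"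
  using openin_continuous_map_preimage[of "gtop G" "gtop G" "src G" V] continuous_src
  by (simp add: unit_space_def continuous_map_in_subtopology topspace_arrows)

lemma open_vimage_inv: "openin (gtop G) V \<Longrightarrow> openin (gtop G) {g \<in> arrows G. ginv G g \<in> V}"
  using openin_continuous_map_preimage[of "gtop G" "gtop G" "ginv G" V] continuous_ginv
  by (simp add: topspace_arrows)

text \<open>Let \<open>rng\<close> be injective on an open neighbourhood \<open>U\<close> of a unit.
  An arrow \<open>g\<close> of \<open>U\<close> whose range is again in \<open>U\<close> has the
  same range as \<open>rng G g\<close>, so it equals \<open>rng G g\<close> and is a unit.\<close>

lemma open_units: "openin (gtop G) (units G)"
proof (subst openin_subopen, intro ballI)
  fix x assume x: "x \<in> units G"
  then obtain U where U: "openin (gtop G) U" "x \<in> U"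
      "homeomorphic_map (subtopology (gtop G) U) (subtopology (unit_space G) (rng G ` U)) (rng G)"
    using etale unit_arrow unfolding local_homeomorphism_def topspace_arrows by metis
  then have inj: "inj_on (rng G) U"
    by (metis homeomorphic_imp_injective_map inf.absorb_iff2 openin_subset topspace_subtopology)
  let ?W = "U \<inter> {g \<in> arrows G. rng G g \<in> U}"
  have "openin (gtop G) ?W" using U open_vimage_rng by auto
  moreover have "?W \<subseteq> units G"
    using inj rng_rng by (auto simp: units_iff inj_on_def)
  moreover have "x \<in> ?W" using x U units_iff by auto
  ultimately show "\<exists>T. openin (gtop G) T \<and> x \<in> T \<and> T \<subseteq> units G" by blast
qed

lemma open_unit_space: "openin (unit_space G) V \<longleftrightarrow> openin (gtop G) V \<and> V \<subseteq> units G"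
  unfolding unit_space_def by (simp add: open_units openin_open_subtopology)

lemma open_rng_image:
  assumes U: "openin (gtop G) U"
  shows "openin (gtop G) (rng G ` U)"
proof (subst openin_subopen, intro ballI)
  fix y assume "y \<in> rng G ` U"
  then obtain g where g: "g \<in> U" "y = rng G g" by auto
  then have "g \<in> topspace (gtop G)" using U openin_subset by blast
  then obtain V where V: "openin (gtop G) V" "g \<in> V" "openin (unit_space G) (rng G ` V)"
      "homeomorphic_map (subtopology (gtop G) V) (subtopology (unit_space G) (rng G ` V)) (rng G)"
    using etale unfolding local_homeomorphism_def by metis
  have "openin (subtopology (gtop G) V) (U \<inter> V)"
    using U by (simp add: openin_subtopology_Int)
  then have "openin (subtopology (unit_space G) (rng G ` V)) (rng G ` (U \<inter> V))"
    using V(4) homeomorphic_imp_open_map unfolding open_map_def by blast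
  then have "openin (unit_space G) (rng G ` (U \<inter> V))"
    using V(3) openin_trans_full by blast
  then show "\<exists>T. openin (gtop G) T \<and> y \<in> T \<and> T \<subseteq> rng G ` U"
    using g V(2) open_unit_space by (intro exI[of _ "rng G ` (U \<inter> V)"]) auto
qed

lemma inv_image_eq: "U \<subseteq> arrows G \<Longrightarrow> ginv G ` U = {g \<in> arrows G. ginv G g \<in> U}"
  using inv_inv ginv_closed by (auto simp: subset_iff image_iff) metis

lemma open_inv_image: "openin (gtop G) U \<Longrightarrow> openin (gtop G) (ginv G ` U)"
  using inv_image_eq open_vimage_inv open_arrows by simp

lemma src_image_eq: "U \<subseteq> arrows G \<Longrightarrow> src G ` U = rng G ` ginv G ` U"
  using rng_ginv by (force simp: subset_iff)

lemma open_src_image: "openin (gtop G) U \<Longrightarrow> openin (gtop G) (src G ` U)"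
  using src_image_eq open_rng_image open_inv_image open_arrows by simp

text \<open>The range map is an open continuous retraction onto the units, so it carries compact
  neighbourhoods in \<open>G\<close> to compact neighbourhoods in the unit space.\<close>

lemma locally_compact_units: "locally_compact_space (unit_space G)"
  unfolding locally_compact_space_def topspace_unit_space
proof
  fix x assume x: "x \<in> units G"
  then obtain U K where U: "openin (gtop G) U" "compactin (gtop G) K" "x \<in> U" "U \<subseteq> K"
    using locally_compact units_subset unfolding locally_compact_space_def topspace_arrows by blast
  have "compactin (unit_space G) (rng G ` K)"
    using U(2) continuous_rng image_compactin by blast
  moreover have "openin (unit_space G) (rng G ` U)"
    using U(1) open_rng_image open_unit_space rng_in_units open_arrows by blast
  moreover have "x \<in> rng G ` U" using U(3) x rng_unit by force
  ultimately show "\<exists>U K. openin (unit_space G) U \<and> compactin (unit_space G) K \<and> x \<in> U \<and> U \<subseteq> K"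
    using U(4) by blast
qed

lemma compactin_unit_space: "compactin (unit_space G) V \<longleftrightarrow> compactin (gtop G) V \<and> V \<subseteq> units G"
  by (simp add: unit_space_def compactin_subtopology)

lemma compact_open_unit_nbhd:
  assumes "openin (gtop G) O'" "x \<in> O'" "x \<in> units G"
  obtains V where "openin (gtop G) V" "compactin (gtop G) V" "x \<in> V" "V \<subseteq> O'" "V \<subseteq> units G"
proof -
  have op: "openin (unit_space G) (O' \<inter> units G)" "x \<in> O' \<inter> units G"
    using assms open_units open_unit_space by auto
  obtain V where "openin (unit_space G) V" "compactin (unit_space G) V" "x \<in> V" "V \<subseteq> O' \<inter> units G"
    by (rule compact_open_nbhd_if_totally_disconnected[OF Hausdorff_units locally_compact_units ample op])
  then show thesis
    by (intro that[of V]) (auto simp: open_unit_space compactin_unit_space)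
qed

text \<open>Compact sets of units are closed in the Hausdorff unit space, whereas compact sets of
  arrows need not be closed in \<open>G\<close>. This makes it possible to cut a bisection down
  along its sources.\<close>

lemma open_Diff_compact_units:
  assumes "compactin (gtop G) V" "V \<subseteq> units G"
  shows "openin (gtop G) (units G - V)"
proof -
  have "closedin (unit_space G) V"
    using assms Hausdorff_units compactin_imp_closedin compactin_unit_space by blast
  then have "openin (unit_space G) (units G - V)"
    using openin_diff[of "unit_space G" "units G" V] openin_topspace[of "unit_space G"]
    by (simp add: topspace_unit_space)
  then show ?thesis using open_unit_space by blast
qed

text \<open>On an open set where it is injective, \<open>rng\<close> is a homeomorphism onto its
  image. Compactness of bisections can thus be tested in the unit space, where the usual arguments
  with closed subsets are available.\<close>

lemma compact_if_rng_compact: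
  assumes U: "openin (gtop G) U" "inj_on (rng G) U" and c: "compactin (gtop G) (rng G ` U)"
  shows "compactin (gtop G) U"
proof -
  have UA: "U \<subseteq> arrows G" using U open_arrows by auto
  have "homeomorphic_map (subtopology (gtop G) U) (subtopology (gtop G) (rng G ` U)) (rng G)"
  proof (rule bijective_open_imp_homeomorphic_map)
    show "continuous_map (subtopology (gtop G) U) (subtopology (gtop G) (rng G ` U)) (rng G)"
      using continuous_rng UA
      by (auto simp: unit_space_def continuous_map_in_subtopology topspace_arrows
          intro: continuous_map_from_subtopology)
    show "open_map (subtopology (gtop G) U) (subtopology (gtop G) (rng G ` U)) (rng G)"
      using U(1) open_rng_image by (auto simp: open_map_def openin_open_subtopology)
    have "rng G ` U \<subseteq> arrows G" using UA rng_closed by auto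
    then show "rng G ` topspace (subtopology (gtop G) U) = topspace (subtopology (gtop G) (rng G ` U))"
      using UA by (auto simp: topspace_arrows)
    show "inj_on (rng G) (topspace (subtopology (gtop G) U))"
      using U(2) by (auto simp: topspace_arrows intro: inj_on_subset)
  qed
  then show ?thesis
    using homeomorphic_map_compactness[of "subtopology (gtop G) U" "subtopology (gtop G) (rng G ` U)" "rng G" U] c UA
    by (simp add: topspace_arrows)
qed

lemma compact_rng_image: "compactin (gtop G) U \<Longrightarrow> compactin (gtop G) (rng G ` U)"
  using image_compactin continuous_rng compactin_unit_space by blast

lemma compact_src_image: "compactin (gtop G) U \<Longrightarrow> compactin (gtop G) (src G ` U)"
  using image_compactin continuous_src compactin_unit_space by blast

section \<open>Compact open bisections: a base of the topology, closed under products and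
  inverses\<close>

abbreviation "cob \<equiv> compact_open_bisection G"

lemma cob_iff: "cob U \<longleftrightarrow> openin (gtop G) U \<and> inj_on (rng G) U \<and> inj_on (src G) U \<and> compactin (gtop G) U"
  by (auto simp: open_bisection_def compact_open_bisection_def)

lemma cob_arrows: "cob U \<Longrightarrow> U \<subseteq> arrows G"
  using cob_iff open_arrows by blast

lemma cob_units:
  assumes "openin (gtop G) V" "compactin (gtop G) V" "V \<subseteq> units G"
  shows "cob V"
  using assms rng_unit src_unit by (auto simp: cob_iff inj_on_def subset_iff)

lemma open_inj_nbhd:
  assumes "g \<in> arrows G"
  obtains U where "openin (gtop G) U" "g \<in> U" "inj_on (rng G) U"
proof -
  obtain V where V: "openin (gtop G) V" "g \<in> V"
      "homeomorphic_map (subtopology (gtop G) V) (subtopology (unit_space G) (rng G ` V)) (rng G)"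
    using etale assms unfolding local_homeomorphism_def topspace_arrows by metis
  then have "inj_on (rng G) V"
    by (metis homeomorphic_imp_injective_map inf.absorb_iff2 openin_subset topspace_subtopology)
  then show thesis using V by (intro that)
qed

text \<open>Injectivity of \<open>src\<close> near \<open>g\<close> is injectivity of
  \<open>rng\<close> near the inverse of \<open>g\<close>, so inverting a neighbourhood
  \<open>U2\<close> of the latter supplies it. Compactness comes from keeping only the arrows with
  range in a compact open set of units.\<close>

lemma cob_nbhd:
  assumes O': "openin (gtop G) O'" "g \<in> O'"
  obtains U where "cob U" "g \<in> U" "U \<subseteq> O'"
proof -
  have g: "g \<in> arrows G" using assms open_arrows by auto
  obtain U1 where U1: "openin (gtop G) U1" "g \<in> U1" "inj_on (rng G) U1"
    using open_inj_nbhd g by blast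
  obtain U2 where U2: "openin (gtop G) U2" "ginv G g \<in> U2" "inj_on (rng G) U2"
    using open_inj_nbhd ginv_closed[OF g] by blast
  define U where "U = U1 \<inter> ginv G ` U2 \<inter> O'"
  have oU: "openin (gtop G) U" using U1 U2 O' open_inv_image by (auto simp: U_def)
  have gU: "g \<in> U" using U1 U2 O' inv_inv g by (force simp: U_def)
  have iU: "inj_on (rng G) U" using U1(3) by (auto simp: U_def inj_on_def)
  have "inj_on (src G) (ginv G ` U2)"
    using inj_on_src_inv_image[OF open_arrows] U2 by blast
  then have sU: "inj_on (src G) U" by (auto simp: U_def inj_on_def)
  obtain V where V: "openin (gtop G) V" "compactin (gtop G) V" "rng G g \<in> V" "V \<subseteq> rng G ` U" "V \<subseteq> units G"
    using compact_open_unit_nbhd[OF open_rng_image[OF oU], of "rng G g"] gU rng_in_units[OF g] by auto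
  define B where "B = U \<inter> {g \<in> arrows G. rng G g \<in> V}"
  have "openin (gtop G) B" using oU V open_vimage_rng by (auto simp: B_def)
  moreover have "rng G ` B = V" using V(4) open_arrows[OF oU] by (auto simp: B_def)
  moreover have "inj_on (rng G) B" "inj_on (src G) B" using iU sU by (auto simp: B_def inj_on_def)
  ultimately have "cob B" using compact_if_rng_compact V by (auto simp: cob_iff)
  then show thesis using gU V g by (intro that[of B]) (auto simp: B_def U_def)
qed

text \<open>An arrow \<open>g\<close> close to \<open>k\<close>, the product of \<open>a\<close> and
  \<open>b\<close>, has the same range as some \<open>u\<close> in \<open>U\<close> close to
  \<open>a\<close>. By continuity of multiplication at the pair of the inverse of \<open>a\<close>
  and \<open>k\<close>, the quotient of \<open>g\<close> by \<open>u\<close> is close to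
  \<open>b\<close>, hence in \<open>O'\<close>.\<close>

lemma open_gprod:
  assumes U: "openin (gtop G) U" and O': "openin (gtop G) O'"
  shows "openin (gtop G) (gprod U O')"
proof (subst openin_subopen, intro ballI)
  fix k assume "k \<in> gprod U O'"
  then obtain a b where ab: "a \<in> U" "b \<in> O'" "src G a = rng G b" "k = gmul G a b"
    by (auto simp: gprod_def)
  have aA: "a \<in> arrows G" "b \<in> arrows G" using ab U O' open_arrows by auto
  let ?X = "subtopology (prod_topology (gtop G) (gtop G)) (composable G)"
  have topX: "topspace ?X = composable G"
    by (auto simp: composable_def topspace_arrows)
  have kA: "k \<in> arrows G" "rng G k = rng G a" using ab aA groupoid_simps by auto
  have b: "gmul G (ginv G a) k = b" using inv_mul_cancel ab aA by auto
  have P: "openin ?X {z \<in> topspace ?X. (\<lambda>(g, h). gmul G g h) z \<in> O'}"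
    by (rule openin_continuous_map_preimage[OF continuous_gmul O'])
  then obtain T where T: "openin (prod_topology (gtop G) (gtop G)) T"
      "{z \<in> composable G. (\<lambda>(g, h). gmul G g h) z \<in> O'} = T \<inter> composable G"
    unfolding topX openin_subtopology by auto
  have T_iff: "gmul G g h \<in> O' \<longleftrightarrow> (g, h) \<in> T" if "(g, h) \<in> composable G" for g h
  proof -
    have "(g, h) \<in> {z \<in> composable G. (\<lambda>(g, h). gmul G g h) z \<in> O'} \<longleftrightarrow> (g, h) \<in> T \<inter> composable G"
      by (simp only: T(2))
    then show ?thesis using that by simp
  qed
  have c: "(ginv G a, k) \<in> composable G" using aA kA groupoid_simps by (auto simp: composable_def)
  have "(ginv G a, k) \<in> T" using T_iff[OF c] b ab by simp
  then obtain N1 N2 where N: "openin (gtop G) N1" "openin (gtop G) N2" "ginv G a \<in> N1" "k \<in> N2" "N1 \<times> N2 \<subseteq> T"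
    using T(1) by (metis openin_prod_topology_alt)
  define M where "M = U \<inter> {g \<in> arrows G. ginv G g \<in> N1}"
  have oM: "openin (gtop G) M" using U N open_vimage_inv by (auto simp: M_def)
  \<comment> \<open>Restricting the range guarantees a left factor in \<open>U\<close> near
    \<open>a\<close>; this is open because \<open>rng\<close> is an open map.\<close>
  define N where "N = N2 \<inter> {g \<in> arrows G. rng G g \<in> rng G ` M}"
  have "openin (gtop G) N" using oM N(2) open_vimage_rng open_rng_image by (auto simp: N_def)
  moreover have "k \<in> N" using kA N ab aA by (auto simp: N_def M_def)
  moreover have "N \<subseteq> gprod U O'"
  proof
    fix g assume g: "g \<in> N"
    then obtain u where u: "u \<in> U" "u \<in> arrows G" "ginv G u \<in> N1" "rng G g = rng G u"
      and g': "g \<in> N2" "g \<in> arrows G"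
      by (auto simp: N_def M_def)
    have c: "(ginv G u, g) \<in> composable G" using u g' groupoid_simps by (auto simp: composable_def)
    have "(ginv G u, g) \<in> T" using N(5) u(3) g' by auto
    then have "gmul G (ginv G u) g \<in> O'" using T_iff[OF c] by simp
    moreover have "src G u = rng G (gmul G (ginv G u) g)"
      using u g' groupoid_simps by simp
    moreover have "gmul G u (gmul G (ginv G u) g) = g"
      using mul_inv_cancel u g' by simp
    ultimately show "g \<in> gprod U O'" using u gprodI by metis
  qed
  ultimately show "\<exists>T. openin (gtop G) T \<and> k \<in> T \<and> T \<subseteq> gprod U O'" by blast
qed

text \<open>As \<open>V\<close> is clopen in the units, the arrows with source in \<open>V\<close>
  form a clopen set, and a compact set meets a closed set in a compact set even without
  Hausdorffness.\<close>

lemma cob_restrict_src: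
  assumes U: "cob U" and V: "openin (gtop G) V" "V \<subseteq> units G" "compactin (gtop G) V"
  shows "cob {u \<in> U. src G u \<in> V}" (is "cob ?A")
proof -
  let ?B = "{g \<in> arrows G. src G g \<in> V}" and ?C = "{g \<in> arrows G. src G g \<in> units G - V}"
  have "?A = U \<inter> ?B"
    using cob_arrows[OF U] by auto
  then have "openin (gtop G) ?A"
    using U open_vimage_src[OF V(1)] by (simp add: cob_iff openin_Int)
  moreover have "?A = U \<inter> (arrows G - ?C)"
    using cob_arrows[OF U] src_in_units by auto
  moreover have "closedin (gtop G) (arrows G - ?C)"
    using open_vimage_src[OF open_Diff_compact_units[OF V(3,2)]] topspace_arrows
    by (metis closedin_diff closedin_topspace)
  then have "compactin (gtop G) (U \<inter> (arrows G - ?C))"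
    using U by (intro compact_Int_closedin) (simp_all add: cob_iff)
  moreover have "inj_on (rng G) ?A" "inj_on (src G) ?A"
    using U by (auto simp: cob_iff inj_on_def)
  ultimately show ?thesis
    unfolding cob_iff by simp
qed

text \<open>The product has the same ranges as the part of \<open>U\<close> whose sources are ranges
  of \<open>V\<close>. That part is a compact open bisection, so compactness passes to the product
  through the unit space.\<close>

lemma cob_gprod:
  assumes U: "cob U" and V: "cob V"
  shows "cob (gprod U V)"
proof -
  let ?W = "{u \<in> U. src G u \<in> rng G ` V}"
  have UA: "U \<subseteq> arrows G" "V \<subseteq> arrows G" using cob_arrows U V by auto
  have W: "cob ?W"
    using V UA rng_in_units by (intro cob_restrict_src[OF U])
      (auto simp: cob_iff intro!: open_rng_image compact_rng_image)
  have "rng G ` gprod U V = rng G ` ?W"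
  proof (intro equalityI subsetI)
    fix y assume "y \<in> rng G ` gprod U V"
    then obtain u v where uv: "u \<in> U" "v \<in> V" "src G u = rng G v" "y = rng G (gmul G u v)"
      by (auto simp: gprod_def)
    then have "y = rng G u" using rng_mul UA by (metis subsetD)
    then show "y \<in> rng G ` ?W" using uv by auto
  next
    fix y assume "y \<in> rng G ` ?W"
    then obtain u v where uv: "u \<in> U" "v \<in> V" "src G u = rng G v" "y = rng G u" by auto
    then have "y = rng G (gmul G u v)" using rng_mul UA by (metis subsetD)
    then show "y \<in> rng G ` gprod U V" using gprodI uv by blast
  qed
  then have "compactin (gtop G) (rng G ` gprod U V)"
    using W compact_rng_image cob_iff by auto
  moreover have "openin (gtop G) (gprod U V)"
    using U V open_gprod cob_iff by auto
  moreover have "inj_on (rng G) (gprod U V)"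
  proof (rule inj_onI)
    fix k l assume "k \<in> gprod U V" "l \<in> gprod U V" and eq: "rng G k = rng G l"
    then obtain a b c d where *: "a \<in> U" "b \<in> V" "src G a = rng G b" "k = gmul G a b"
      "c \<in> U" "d \<in> V" "src G c = rng G d" "l = gmul G c d" by (auto simp: gprod_def)
    then have "rng G a = rng G c" using rng_mul eq UA by (metis subsetD)
    then have "a = c" using U * by (auto simp: cob_iff inj_on_def)
    moreover then have "b = d" using V * by (auto simp: cob_iff inj_on_def)
    ultimately show "k = l" using * by simp
  qed
  moreover have "inj_on (src G) (gprod U V)"
  proof (rule inj_onI)
    fix k l assume "k \<in> gprod U V" "l \<in> gprod U V" and eq: "src G k = src G l"
    then obtain a b c d where *: "a \<in> U" "b \<in> V" "src G a = rng G b" "k = gmul G a b"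
      "c \<in> U" "d \<in> V" "src G c = rng G d" "l = gmul G c d" by (auto simp: gprod_def)
    then have "src G b = src G d" using src_mul eq UA by (metis subsetD)
    then have "b = d" using V * by (auto simp: cob_iff inj_on_def)
    moreover then have "a = c" using U * by (auto simp: cob_iff inj_on_def)
    ultimately show "k = l" using * by simp
  qed
  ultimately show ?thesis using compact_if_rng_compact cob_iff by auto
qed

lemma cob_inv:
  assumes U: "cob U"
  shows "cob (ginv G ` U)"
proof -
  have "inj_on (rng G) (ginv G ` U)" "inj_on (src G) (ginv G ` U)"
    using U inj_on_src_inv_image inj_on_rng_inv_image cob_arrows[OF U] by (auto simp: cob_iff)
  then show ?thesis
    using U open_inv_image image_compactin[OF _ continuous_ginv] cob_iff by auto
qed

end

section \<open>Convolution in the Steinberg algebra\<close>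

context groupoid
begin

lemma convolution_outside:
  assumes "g \<notin> arrows G"
  shows "convolution G a f g = 0"
proof -
  have none: "gmul G x y \<noteq> g" if "(x, y) \<in> composable G" for x y
    using that gmul_closed assms by metis
  have "{(x, y). (x, y) \<in> composable G \<and> gmul G x y = g \<and> a x * f y \<noteq> 0} = {}"
    using none by auto
  then show ?thesis
    unfolding convolution_def by (simp only: sum.empty)
qed

text \<open>A factorisation of \<open>g\<close> is determined by its left factor. \<open>H\<close>
  may be any finite set in the range fibre that covers the support of \<open>a\<close> there, so one
  index set serves all right factors \<open>f\<close> at once.\<close>

lemma convolution_left:
  fixes a f :: "'g \<Rightarrow> 'k :: field"
  assumes g: "g \<in> arrows G" and H: "finite H" "H \<subseteq> {h \<in> arrows G. rng G h = rng G g}"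
    and supp: "\<And>h. h \<in> arrows G \<Longrightarrow> rng G h = rng G g \<Longrightarrow> a h \<noteq> 0 \<Longrightarrow> h \<in> H"
  shows "convolution G a f g = (\<Sum>h\<in>H. a h * f (gmul G (ginv G h) g))"
proof -
  let ?S = "{(x, y). (x, y) \<in> composable G \<and> gmul G x y = g \<and> a x * f y \<noteq> 0}"
  let ?q = "\<lambda>h. gmul G (ginv G h) g"
  let ?H = "{h \<in> H. a h * f (?q h) \<noteq> 0}"
  have "?S = (\<lambda>h. (h, ?q h)) ` ?H"
  proof (intro equalityI subsetI)
    fix z assume "z \<in> ?S"
    then obtain x y where z: "z = (x, y)" "x \<in> arrows G" "y \<in> arrows G" "src G x = rng G y"
        "gmul G x y = g" "a x * f y \<noteq> 0"
      by (auto simp: composable_def)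
    then have "?q x = y" using inv_mul_cancel by blast
    moreover have "x \<in> H" using z rng_mul supp by auto
    ultimately show "z \<in> (\<lambda>h. (h, ?q h)) ` ?H" using z by auto
  next
    fix z assume "z \<in> (\<lambda>h. (h, ?q h)) ` ?H"
    then obtain h where h: "z = (h, ?q h)" "h \<in> arrows G" "rng G h = rng G g" "a h * f (?q h) \<noteq> 0"
      using H by auto
    then have "?q h \<in> arrows G" "src G h = rng G (?q h)" "gmul G h (?q h) = g"
      using g by (auto simp: groupoid_simps mul_inv_cancel)
    then show "z \<in> ?S" using h by (auto simp: composable_def)
  qed
  then have "convolution G a f g = (\<Sum>(x, y)\<in>(\<lambda>h. (h, ?q h)) ` ?H. a x * f y)"
    unfolding convolution_def by simp
  also have "\<dots> = (\<Sum>h\<in>?H. a h * f (?q h))"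
    by (subst sum.reindex) (auto simp: inj_on_def)
  also have "\<dots> = (\<Sum>h\<in>H. a h * f (?q h))"
    using H by (intro sum.mono_neutral_left) auto
  finally show ?thesis .
qed

lemma convolution_right:
  fixes a f :: "'g \<Rightarrow> 'k :: field"
  assumes g: "g \<in> arrows G" and H: "finite H" "H \<subseteq> {h \<in> arrows G. src G h = src G g}"
    and supp: "\<And>h. h \<in> arrows G \<Longrightarrow> src G h = src G g \<Longrightarrow> f h \<noteq> 0 \<Longrightarrow> h \<in> H"
  shows "convolution G a f g = (\<Sum>h\<in>H. a (gmul G g (ginv G h)) * f h)"
proof -
  let ?S = "{(x, y). (x, y) \<in> composable G \<and> gmul G x y = g \<and> a x * f y \<noteq> 0}"
  let ?q = "\<lambda>h. gmul G g (ginv G h)"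
  let ?H = "{h \<in> H. a (?q h) * f h \<noteq> 0}"
  have "?S = (\<lambda>h. (?q h, h)) ` ?H"
  proof (intro equalityI subsetI)
    fix z assume "z \<in> ?S"
    then obtain x y where z: "z = (x, y)" "x \<in> arrows G" "y \<in> arrows G" "src G x = rng G y"
        "gmul G x y = g" "a x * f y \<noteq> 0"
      by (auto simp: composable_def)
    then have "?q y = x" using mul_cancel_inv by blast
    moreover have "y \<in> H" using z src_mul supp by auto
    ultimately show "z \<in> (\<lambda>h. (?q h, h)) ` ?H" using z by auto
  next
    fix z assume "z \<in> (\<lambda>h. (?q h, h)) ` ?H"
    then obtain h where h: "z = (?q h, h)" "h \<in> arrows G" "src G h = src G g" "a (?q h) * f h \<noteq> 0"
      using H by auto
    then have "?q h \<in> arrows G" "src G (?q h) = rng G h" "gmul G (?q h) h = g"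
      using g by (auto simp: groupoid_simps inv_cancel_mul)
    then show "z \<in> ?S" using h by (auto simp: composable_def)
  qed
  then have "convolution G a f g = (\<Sum>(x, y)\<in>(\<lambda>h. (?q h, h)) ` ?H. a x * f y)"
    unfolding convolution_def by simp
  also have "\<dots> = (\<Sum>h\<in>?H. a (?q h) * f h)"
    by (subst sum.reindex) (auto simp: inj_on_def)
  also have "\<dots> = (\<Sum>h\<in>H. a (?q h) * f h)"
    using H by (intro sum.mono_neutral_left) auto
  finally show ?thesis .
qed

section \<open>Convolution with indicators of bisections\<close>

lemma convolution_char_left:
  assumes U: "U \<subseteq> arrows G" "inj_on (rng G) U" and g: "g \<in> arrows G"
    and u: "u \<in> U" "rng G u = rng G g"
  shows "convolution G (char_fun c U) f g = c * f (gmul G (ginv G u) g)"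
proof -
  have "convolution G (char_fun c U) f g = (\<Sum>h\<in>{u}. char_fun c U h * f (gmul G (ginv G h) g))"
    using assms by (intro convolution_left) (auto simp: char_fun_def inj_on_def split: if_splits)
  then show ?thesis using u by (simp add: char_fun_def)
qed

lemma convolution_char_left_0:
  assumes "rng G g \<notin> rng G ` U"
  shows "convolution G (char_fun c U) f g = 0"
proof (cases "g \<in> arrows G")
  case True
  then have "convolution G (char_fun c U) f g = (\<Sum>h\<in>{}. char_fun c U h * f (gmul G (ginv G h) g))"
    using assms by (intro convolution_left) (auto simp: char_fun_def image_iff split: if_splits)
  then show ?thesis by simp
qed (simp add: convolution_outside)

lemma convolution_char_right:
  assumes U: "U \<subseteq> arrows G" "inj_on (src G) U" and g: "g \<in> arrows G"
    and u: "u \<in> U" "src G u = src G g"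
  shows "convolution G f (char_fun c U) g = f (gmul G g (ginv G u)) * c"
proof -
  have "convolution G f (char_fun c U) g = (\<Sum>h\<in>{u}. f (gmul G g (ginv G h)) * char_fun c U h)"
    using assms by (intro convolution_right) (auto simp: char_fun_def inj_on_def split: if_splits)
  then show ?thesis using u by (simp add: char_fun_def)
qed

lemma convolution_char_right_0:
  assumes "src G g \<notin> src G ` U"
  shows "convolution G f (char_fun c U) g = 0"
proof (cases "g \<in> arrows G")
  case True
  then have "convolution G f (char_fun c U) g = (\<Sum>h\<in>{}. f (gmul G g (ginv G h)) * char_fun c U h)"
    using assms by (intro convolution_right) (auto simp: char_fun_def image_iff split: if_splits)
  then show ?thesis by simp
qed (simp add: convolution_outside)

text \<open>Injectivity of \<open>rng\<close> on \<open>U\<close> leaves an arrow at most one left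
  factor in \<open>U\<close>, so the sum has at most one term and no multiplicities arise.\<close>

lemma convolution_char_char:
  assumes U: "U \<subseteq> arrows G" "inj_on (rng G) U" and V: "V \<subseteq> arrows G"
  shows "convolution G (char_fun c U) (char_fun d V) = char_fun (c * d) (gprod U V)"
proof
  fix g
  have eq: "g \<in> gprod U V \<longleftrightarrow> gmul G (ginv G u) g \<in> V"
    if g: "g \<in> arrows G" and u: "u \<in> U" "rng G u = rng G g" for u
  proof
    assume "g \<in> gprod U V"
    then obtain a b where ab: "a \<in> U" "b \<in> V" "src G a = rng G b" "g = gmul G a b"
      by (auto simp: gprod_def)
    have aA: "a \<in> arrows G" "b \<in> arrows G" using ab U V by auto
    then have "rng G a = rng G u" using ab rng_mul u by simp
    then have "a = u" using ab u U by (auto simp: inj_on_def)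
    then show "gmul G (ginv G u) g \<in> V" using ab aA inv_mul_cancel by simp
  next
    assume "gmul G (ginv G u) g \<in> V"
    moreover have "u \<in> arrows G" using u U by auto
    then have "src G u = rng G (gmul G (ginv G u) g)" "gmul G u (gmul G (ginv G u) g) = g"
      using g u by (auto simp: groupoid_simps mul_inv_cancel)
    ultimately show "g \<in> gprod U V" using u gprodI by metis
  qed
  show "convolution G (char_fun c U) (char_fun d V) g = char_fun (c * d) (gprod U V) g"
  proof (cases "g \<in> arrows G \<and> rng G g \<in> rng G ` U")
    case True
    then obtain u where u: "u \<in> U" "rng G u = rng G g" "g \<in> arrows G" by force
    show ?thesis
      unfolding convolution_char_left[OF U u(3,1,2)] using eq[OF u(3,1,2)] by (simp add: char_fun_def)
  next
    case False
    have "g \<notin> gprod U V"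
    proof
      assume "g \<in> gprod U V"
      then obtain a b where ab: "a \<in> U" "b \<in> V" "src G a = rng G b" "g = gmul G a b"
        by (auto simp: gprod_def)
      have aA: "a \<in> arrows G" "b \<in> arrows G" using ab U V by auto
      then show False using False ab rng_mul gmul_in by auto
    qed
    then have "char_fun (c * d) (gprod U V) g = 0" by (simp add: char_fun_def)
    moreover have "convolution G (char_fun c U) (char_fun d V) g = 0"
      using False convolution_outside convolution_char_left_0 by metis
    ultimately show ?thesis by simp
  qed
qed

end

section \<open>Elements of the Steinberg algebra, their supports, and bilinearity of
  convolution\<close>

context ample_groupoid
begin

lemma char_fun_in_algebra: "cob U \<Longrightarrow> char_fun c U \<in> steinberg_algebra G"
  unfolding steinberg_algebra_def by (rule fun_space.span_base) auto

lemma subspace_algebra: "fun_space.subspace (steinberg_algebra G :: ('a \<Rightarrow> 'k :: field) set)"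
  unfolding steinberg_algebra_def by (rule fun_space.subspace_span)

lemma steinberg_algebra_explicit:
  fixes f :: "'a \<Rightarrow> 'k :: field"
  assumes "f \<in> steinberg_algebra G"
  shows "\<exists>F c. finite F \<and> (\<forall>U\<in>F. cob U) \<and> (\<forall>g. f g = (\<Sum>U\<in>F. if g \<in> U then c U else 0))"
  using assms unfolding steinberg_algebra_def
proof (induction rule: fun_space.span_induct_alt)
  case base
  show ?case by (intro exI[of _ "{}"]) simp
next
  case (step e x y)
  then obtain d V where V: "cob V" "x = char_fun d V" by auto
  from step obtain F c where F: "finite F" "\<forall>U\<in>F. cob U"
    "\<And>g. y g = (\<Sum>U\<in>F. if g \<in> U then c U else 0)" by auto
  \<comment> \<open>\<open>V\<close> may already belong to \<open>F\<close>, so its coefficient is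
    increased rather than overwritten.\<close>
  let ?c = "\<lambda>U. (if U \<in> F then c U else 0) + (if U = V then e * d else 0)"
  have "((\<lambda>g. e * x g) + y) g = (\<Sum>U\<in>insert V F. if g \<in> U then ?c U else 0)" for g
  proof -
    have "(\<Sum>U\<in>insert V F. if g \<in> U then ?c U else 0)
        = (\<Sum>U\<in>insert V F. if U \<in> F then (if g \<in> U then c U else 0) else 0)
        + (\<Sum>U\<in>insert V F. if U = V then (if g \<in> V then e * d else 0) else 0)"
      by (subst sum.distrib[symmetric], rule sum.cong) auto
    also have "(\<Sum>U\<in>insert V F. if U \<in> F then (if g \<in> U then c U else 0) else 0) = y g"
      unfolding F(3) using F(1) by (intro sum.mono_neutral_cong_right) auto
    also have "(\<Sum>U\<in>insert V F. if U = V then (if g \<in> V then e * d else 0) else 0) = e * x g"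
      using F(1) V by (simp add: char_fun_def)
    finally show ?thesis by simp
  qed
  then show ?case using F V by (intro exI[of _ "insert V F"] exI[of _ ?c]) auto
qed

lemma steinberg_supp_cover:
  fixes f :: "'a \<Rightarrow> 'k :: field"
  assumes "f \<in> steinberg_algebra G"
  shows "\<exists>F. finite F \<and> (\<forall>U\<in>F. cob U) \<and> {g. f g \<noteq> 0} \<subseteq> \<Union>F"
proof -
  obtain F c where F: "finite F" "\<forall>U\<in>F. cob U"
    "\<forall>g. f g = (\<Sum>U\<in>F. if g \<in> U then c U else 0)"
    using steinberg_algebra_explicit[OF assms] by blast
  have "f g = 0" if "g \<notin> \<Union>F" for g
    using that F(3) by (auto intro: sum.neutral)
  then show ?thesis using F by blast
qed

lemma steinberg_supp_arrows:
  fixes f :: "'a \<Rightarrow> 'k :: field"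
  assumes "f \<in> steinberg_algebra G" "f g \<noteq> 0"
  shows "g \<in> arrows G"
  using steinberg_supp_cover[OF assms(1)] assms(2) cob_arrows by blast

lemma finite_inj_fibre:
  assumes "inj_on h U"
  shows "finite {g \<in> U. h g = x}"
proof -
  have "{g \<in> U. h g = x} = h -` {x} \<inter> U" by auto
  then show ?thesis using finite_vimage_IntI[OF _ assms, of "{x}"] by simp
qed

text \<open>The support is covered by finitely many bisections, and each of them meets a fibre of
  \<open>src\<close> or of \<open>rng\<close> at most once.\<close>

lemma finite_supp_fibre:
  fixes f :: "'a \<Rightarrow> 'k :: field"
  assumes f: "f \<in> steinberg_algebra G"
  shows "finite {g. src G g = x \<and> f g \<noteq> 0}" "finite {g. rng G g = x \<and> f g \<noteq> 0}"
proof -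
  obtain F where F: "finite F" "\<forall>U\<in>F. cob U" and nz: "{g. f g \<noteq> 0} \<subseteq> \<Union>F"
    using steinberg_supp_cover[OF f] by blast
  have "finite (\<Union>U\<in>F. {g \<in> U. src G g = x})" "finite (\<Union>U\<in>F. {g \<in> U. rng G g = x})"
    using F by (auto simp: cob_iff intro!: finite_inj_fibre)
  moreover have "{g. src G g = x \<and> f g \<noteq> 0} \<subseteq> (\<Union>U\<in>F. {g \<in> U. src G g = x})"
    "{g. rng G g = x \<and> f g \<noteq> 0} \<subseteq> (\<Union>U\<in>F. {g \<in> U. rng G g = x})"
    using nz by auto
  ultimately show "finite {g. src G g = x \<and> f g \<noteq> 0}" "finite {g. rng G g = x \<and> f g \<noteq> 0}"
    using finite_subset by auto
qed

text \<open>The index set in the definition of \<open>convolution\<close> depends on both arguments.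
  It is replaced by the support of \<open>a\<close> in a range fibre, which is finite and the same
  for \<open>f\<close>, \<open>h\<close> and their combination.\<close>

lemma convolution_linear_right:
  fixes a :: "'a \<Rightarrow> 'k :: field"
  assumes a: "a \<in> steinberg_algebra G"
  shows "convolution G a ((\<lambda>g. c * f g) + h) = (\<lambda>g. c * convolution G a f g) + convolution G a h"
proof
  fix g
  show "convolution G a ((\<lambda>g. c * f g) + h) g = ((\<lambda>g. c * convolution G a f g) + convolution G a h) g"
  proof (cases "g \<in> arrows G")
    case True
    let ?H = "{h. rng G h = rng G g \<and> a h \<noteq> 0}"
    have "convolution G a e g = (\<Sum>h\<in>?H. a h * e (gmul G (ginv G h) g))" for e
      using finite_supp_fibre(2)[OF a] True steinberg_supp_arrows[OF a]
      by (intro convolution_left) auto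
    then show ?thesis by (simp add: sum_distrib_left sum.distrib[symmetric] algebra_simps)
  qed (simp add: convolution_outside)
qed

lemma convolution_linear_left:
  fixes f :: "'a \<Rightarrow> 'k :: field"
  assumes f: "f \<in> steinberg_algebra G"
  shows "convolution G ((\<lambda>g. c * a g) + b) f = (\<lambda>g. c * convolution G a f g) + convolution G b f"
proof
  fix g
  show "convolution G ((\<lambda>g. c * a g) + b) f g = ((\<lambda>g. c * convolution G a f g) + convolution G b f) g"
  proof (cases "g \<in> arrows G")
    case True
    let ?H = "{h. src G h = src G g \<and> f h \<noteq> 0}"
    have "convolution G e f g = (\<Sum>h\<in>?H. e (gmul G g (ginv G h)) * f h)" for e
      using finite_supp_fibre(1)[OF f] True steinberg_supp_arrows[OF f]
      by (intro convolution_right) auto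
    then show ?thesis by (simp add: sum_distrib_left sum.distrib[symmetric] algebra_simps)
  qed (simp add: convolution_outside)
qed

lemma convolution_zero_left: "convolution G 0 f = 0"
  and convolution_zero_right: "convolution G f 0 = 0"
  by (simp_all add: convolution_def fun_eq_iff)

lemma char_fun_convolution_in_algebra:
  fixes f :: "'a \<Rightarrow> 'k :: field"
  assumes U: "cob U" and f: "f \<in> steinberg_algebra G"
  shows "convolution G (char_fun c U) f \<in> steinberg_algebra G"
    and "convolution G f (char_fun c U) \<in> steinberg_algebra G"
proof -
  have bis: "U \<subseteq> arrows G" "inj_on (rng G) U" using U cob_arrows by (auto simp: cob_iff)
  show "convolution G (char_fun c U) f \<in> steinberg_algebra G"
    using f unfolding steinberg_algebra_def[where ?'k = 'k]
  proof (induction rule: fun_space.span_induct_alt)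
    case base
    show ?case unfolding convolution_zero_right by (rule fun_space.span_zero)
  next
    case (step e x y)
    then obtain d V where V: "cob V" "x = char_fun d V" by auto
    have "convolution G (char_fun c U) x \<in> steinberg_algebra G"
      unfolding V(2) convolution_char_char[OF bis cob_arrows[OF V(1)]]
      by (intro char_fun_in_algebra cob_gprod U V)
    then show ?case
      unfolding convolution_linear_right[OF char_fun_in_algebra[OF U]]
      using step(2) by (intro fun_space.span_add fun_space.span_scale) (simp_all add: steinberg_algebra_def)
  qed
  show "convolution G f (char_fun c U) \<in> steinberg_algebra G"
    using f unfolding steinberg_algebra_def[where ?'k = 'k]
  proof (induction rule: fun_space.span_induct_alt)
    case base
    show ?case unfolding convolution_zero_left by (rule fun_space.span_zero)
  next
    case (step e x y)
    then obtain d V where V: "cob V" "x = char_fun d V" by auto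
    have bis': "V \<subseteq> arrows G" "inj_on (rng G) V" using V cob_arrows by (auto simp: cob_iff)
    have "convolution G x (char_fun c U) \<in> steinberg_algebra G"
      unfolding V(2) convolution_char_char[OF bis' bis(1)] by (intro char_fun_in_algebra cob_gprod U V)
    then show ?case
      unfolding convolution_linear_left[OF char_fun_in_algebra[OF U]]
      using step(2) by (intro fun_space.span_add fun_space.span_scale) (simp_all add: steinberg_algebra_def)
  qed
qed

text \<open>By linearity of convolution in the algebra factor, closure under multiplication need
  only be checked against scaled indicators, for which a convolution is a translation.\<close>

lemma steinberg_idealI:
  fixes J :: "('a \<Rightarrow> 'k :: field) set"
  assumes J: "J \<subseteq> steinberg_algebra G" "fun_space.subspace J"
    and left: "\<And>U c f. cob U \<Longrightarrow> f \<in> J \<Longrightarrow> convolution G (char_fun c U) f \<in> J"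
    and right: "\<And>U c f. cob U \<Longrightarrow> f \<in> J \<Longrightarrow> convolution G f (char_fun c U) \<in> J"
  shows "steinberg_ideal G J"
  unfolding steinberg_ideal_def
proof (intro conjI ballI J)
  fix a f :: "'a \<Rightarrow> 'k" assume a: "a \<in> steinberg_algebra G" and f: "f \<in> J"
  then have fK: "f \<in> steinberg_algebra G" using J by auto
  note J0 = fun_space.subspace_0[OF J(2)] and JA = fun_space.subspace_add[OF J(2)]
    and JS = fun_space.subspace_scale[OF J(2)]
  show "convolution G a f \<in> J"
    using a unfolding steinberg_algebra_def
  proof (induction rule: fun_space.span_induct_alt)
    case base
    show ?case unfolding convolution_zero_left by (rule J0)
  next
    case (step e x y)
    then obtain d V where V: "cob V" "x = char_fun d V" by auto
    show ?case
      unfolding convolution_linear_left[OF fK] using step left[OF V(1) f] V(2) by (intro JA JS) auto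
  qed
  show "convolution G f a \<in> J"
    using a unfolding steinberg_algebra_def
  proof (induction rule: fun_space.span_induct_alt)
    case base
    show ?case unfolding convolution_zero_right by (rule J0)
  next
    case (step e x y)
    then obtain d V where V: "cob V" "x = char_fun d V" by auto
    show ?case
      unfolding convolution_linear_right[OF fK] using step right[OF V(1) f] V(2) by (intro JA JS) auto
  qed
qed

lemma simple_ideal_trivial:
  fixes J :: "('a \<Rightarrow> 'k :: field) set"
  assumes "steinberg_simple TYPE('k) G" "steinberg_ideal G J"
    and "f \<in> steinberg_algebra G" "f \<notin> J" "h \<in> J"
  shows "h = 0"
  using assms unfolding steinberg_simple_def by auto

end

section \<open>Ideals obstructing simplicity\<close>

context ample_groupoid
begin

lemma compact_open_unit:
  assumes "x \<in> units G"
  obtains W where "openin (gtop G) W" "compactin (gtop G) W" "x \<in> W" "W \<subseteq> units G"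
  using compact_open_unit_nbhd[OF open_units assms assms] by metis

text \<open>Orbits are invariant, so the functions vanishing on all arrows with source in the orbit
  of \<open>x\<close> form an ideal. An orbit that is not dense misses some compact open
  \<open>V\<close>, whose indicator is in the ideal, while the indicator of a neighbourhood
  \<open>W\<close> of \<open>x\<close> is not.\<close>

lemma simple_imp_minimal:
  assumes simple: "steinberg_simple TYPE('k :: field) G"
  shows "minimal G"
proof (rule ccontr)
  assume "\<not> minimal G"
  then obtain x where x: "x \<in> units G" "unit_space G closure_of orbit G x \<noteq> units G"
    unfolding minimal_def by blast
  have "unit_space G closure_of orbit G x \<subseteq> units G"
    using closure_of_subset_topspace topspace_unit_space by metis
  then obtain y where y: "y \<in> units G" "y \<notin> unit_space G closure_of orbit G x"
    using x by blast
  then obtain T where T: "y \<in> T" "openin (unit_space G) T" "\<And>z. z \<in> orbit G x \<Longrightarrow> z \<notin> T"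
    by (auto simp: in_closure_of topspace_unit_space)
  obtain V where V: "openin (gtop G) V" "compactin (gtop G) V" "y \<in> V" "V \<subseteq> T" "V \<subseteq> units G"
    by (rule compact_open_unit_nbhd[OF _ T(1) y(1)]) (use T(2) open_unit_space in auto)
  obtain W where W: "openin (gtop G) W" "compactin (gtop G) W" "x \<in> W" "W \<subseteq> units G"
    by (rule compact_open_unit[OF x(1)])
  have orbit: "rng G u \<in> orbit G x" if u: "u \<in> arrows G" "src G u \<in> orbit G x" for u
  proof -
    obtain h where h: "h \<in> arrows G" "src G h = x" "src G u = rng G h"
      using u by (auto simp: orbit_def)
    then have "gmul G u h \<in> arrows G" "src G (gmul G u h) = x" "rng G (gmul G u h) = rng G u"
      using u groupoid_simps by auto
    then show ?thesis unfolding orbit_def by (intro CollectI exI[of _ "gmul G u h"]) simp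
  qed
  have x_orbit: "x \<in> orbit G x"
    using x(1) unfolding orbit_def
    by (intro CollectI exI[of _ x]) (simp add: rng_unit src_unit unit_arrow)
  define J :: "('a \<Rightarrow> 'k) set" where
    "J = {f \<in> steinberg_algebra G. \<forall>g\<in>arrows G. src G g \<in> orbit G x \<longrightarrow> f g = 0}"
  have "steinberg_ideal G J"
  proof (rule steinberg_idealI)
    show "J \<subseteq> steinberg_algebra G" by (auto simp: J_def)
    show "fun_space.subspace J"
      unfolding fun_space.subspace_def J_def
      using fun_space.subspace_0[OF subspace_algebra] fun_space.subspace_add[OF subspace_algebra]
        fun_space.subspace_scale[OF subspace_algebra] by auto
  next
    fix U :: "'a set" and c :: 'k and f assume U: "cob U" and f: "f \<in> J"
    have UA: "U \<subseteq> arrows G" and inj: "inj_on (rng G) U" "inj_on (src G) U"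
      using U cob_arrows by (auto simp: cob_iff)
    have fK: "f \<in> steinberg_algebra G" using f by (simp add: J_def)
    have f0: "f g = 0" if "g \<in> arrows G" "src G g \<in> orbit G x" for g
      using f that by (simp add: J_def)
    have "convolution G (char_fun c U) f g = 0" if g: "g \<in> arrows G" "src G g \<in> orbit G x" for g
    proof (cases "rng G g \<in> rng G ` U")
      case True
      then obtain u where u: "u \<in> U" "rng G u = rng G g" "u \<in> arrows G" using UA by auto
      then have "gmul G (ginv G u) g \<in> arrows G" "src G (gmul G (ginv G u) g) = src G g"
        using g groupoid_simps by auto
      then show ?thesis unfolding convolution_char_left[OF UA inj(1) g(1) u(1,2)] using f0 g by simp
    qed (rule convolution_char_left_0)
    then show "convolution G (char_fun c U) f \<in> J"
      using char_fun_convolution_in_algebra[OF U fK] by (simp add: J_def)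
    have "convolution G f (char_fun c U) g = 0" if g: "g \<in> arrows G" "src G g \<in> orbit G x" for g
    proof (cases "src G g \<in> src G ` U")
      case True
      then obtain u where u: "u \<in> U" "src G u = src G g" "u \<in> arrows G" using UA by auto
      then have "gmul G g (ginv G u) \<in> arrows G" "src G (gmul G g (ginv G u)) = rng G u"
        using g groupoid_simps by auto
      moreover have "rng G u \<in> orbit G x" using u g orbit by auto
      ultimately show ?thesis
        unfolding convolution_char_right[OF UA inj(2) g(1) u(1,2)] using f0 by simp
    qed (rule convolution_char_right_0)
    then show "convolution G f (char_fun c U) \<in> J"
      using char_fun_convolution_in_algebra[OF U fK] by (simp add: J_def)
  qed
  moreover have "char_fun 1 W \<in> steinberg_algebra G"
    by (intro char_fun_in_algebra cob_units W)
  moreover have "char_fun 1 W \<notin> J"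
    using W(3) x_orbit src_unit[OF x(1)] unit_arrow[OF x(1)]
    by (auto simp: J_def char_fun_def intro!: bexI[of _ x])
  moreover have "char_fun 1 V \<in> J"
  proof -
    have "g \<notin> V" if "src G g \<in> orbit G x" for g
      using that T(3) V(4,5) src_unit by (metis subsetD)
    then show ?thesis
      using char_fun_in_algebra[OF cob_units[OF V(1,2,5)]] by (simp add: J_def char_fun_def)
  qed
  ultimately have "char_fun 1 V = (0 :: 'a \<Rightarrow> 'k)" by (rule simple_ideal_trivial[OF simple])
  then have "char_fun (1 :: 'k) V y = 0" by simp
  then show False using V(3) by (simp add: char_fun_def)
qed

text \<open>The matrix entries of the action of \<open>f\<close> on the free vector space over the unit space, in which
  an arrow sends the basis vector of its source to that of its range.\<close>

definition fibre_sum where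
  "fibre_sum f x y = (\<Sum>g | src G g = x \<and> rng G g = y \<and> f g \<noteq> 0. f g)"

lemma fibre_sum_eq:
  assumes "finite H" "\<And>g. src G g = x \<Longrightarrow> rng G g = y \<Longrightarrow> f g \<noteq> 0 \<Longrightarrow> g \<in> H"
    and "\<And>g. g \<in> H \<Longrightarrow> src G g = x \<and> rng G g = y"
  shows "fibre_sum f x y = sum f H"
  unfolding fibre_sum_def using assms by (intro sum.mono_neutral_left) auto

lemma fibre_sum_linear:
  fixes f h :: "'a \<Rightarrow> 'k :: field"
  assumes "f \<in> steinberg_algebra G" "h \<in> steinberg_algebra G"
  shows "fibre_sum ((\<lambda>g. c * f g) + h) x y = c * fibre_sum f x y + fibre_sum h x y"
proof -
  let ?H = "{g. src G g = x \<and> rng G g = y \<and> (f g \<noteq> 0 \<or> h g \<noteq> 0)}"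
  have fin: "finite ?H"
    using finite_subset[of ?H "{g. src G g = x \<and> f g \<noteq> 0} \<union> {g. src G g = x \<and> h g \<noteq> 0}"]
      finite_supp_fibre(1)[OF assms(1)] finite_supp_fibre(1)[OF assms(2)] by blast
  have eq: "fibre_sum e x y = sum e ?H" if "\<And>g. e g \<noteq> 0 \<Longrightarrow> f g \<noteq> 0 \<or> h g \<noteq> 0" for e
    using fin that by (intro fibre_sum_eq) auto
  have "fibre_sum ((\<lambda>g. c * f g) + h) x y = sum ((\<lambda>g. c * f g) + h) ?H"
    by (rule eq) auto
  moreover have "fibre_sum f x y = sum f ?H" by (rule eq) simp
  moreover have "fibre_sum h x y = sum h ?H" by (rule eq) simp
  ultimately show ?thesis by (simp add: sum.distrib sum_distrib_left)
qed

text \<open>\<open>J\<close> is the kernel of the action on the free vector space over the units. A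
  bisection \<open>B\<close> inside the isotropy acts like the indicator of the set of its sources,
  so the difference of the two indicators lies in \<open>J\<close>; it has value 1 at a chosen arrow
  of \<open>B\<close> that is not a unit. The ideal is proper because indicators of nonempty compact
  open sets of units act nontrivially.\<close>

lemma simple_imp_effective:
  assumes simple: "steinberg_simple TYPE('k :: field) G" and ne: "units G \<noteq> {}"
  shows "effective G"
proof (rule ccontr)
  assume "\<not> effective G"
  then have "gtop G interior_of isotropy G \<noteq> units G" by (simp add: effective_def)
  moreover have "units G \<subseteq> gtop G interior_of isotropy G"
    using open_units unit_arrow rng_unit src_unit by (intro interior_of_maximal) (auto simp: isotropy_def)
  ultimately obtain g where g: "g \<in> gtop G interior_of isotropy G" "g \<notin> units G" by blast
  obtain B where B: "cob B" "g \<in> B" "B \<subseteq> gtop G interior_of isotropy G"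
    by (rule cob_nbhd[OF openin_interior_of g(1)])
  have BA: "B \<subseteq> arrows G" and Biso: "\<And>b. b \<in> B \<Longrightarrow> rng G b = src G b"
    using B interior_of_subset[of "gtop G" "isotropy G"] by (auto simp: isotropy_def)
  obtain x where x: "x \<in> units G" using ne by auto
  then obtain W where W: "openin (gtop G) W" "compactin (gtop G) W" "x \<in> W" "W \<subseteq> units G"
    by (rule compact_open_unit)
  define J :: "('a \<Rightarrow> 'k) set" where
    "J = {f \<in> steinberg_algebra G. \<forall>x y. fibre_sum f x y = 0}"
  have "steinberg_ideal G J"
  proof (rule steinberg_idealI)
    show "J \<subseteq> steinberg_algebra G" by (auto simp: J_def)
    show "fun_space.subspace J"
      unfolding fun_space.subspace_def
    proof (intro conjI ballI allI)
      show zero: "0 \<in> J"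
        using fun_space.subspace_0[OF subspace_algebra] by (auto simp: J_def fibre_sum_def)
      fix f assume f: "f \<in> J"
      show "f + h \<in> J" if "h \<in> J" for h
        using f that fun_space.subspace_add[OF subspace_algebra, of f h] fibre_sum_linear[of f h 1]
        by (auto simp: J_def)
      show "(\<lambda>g. c * f g) \<in> J" for c
        using f zero fun_space.subspace_scale[OF subspace_algebra, of f c] fibre_sum_linear[of f 0 c]
        by (auto simp: J_def)
    qed
  next
    fix U :: "'a set" and c :: 'k and f assume U: "cob U" and f: "f \<in> J"
    have UA: "U \<subseteq> arrows G" and inj: "inj_on (rng G) U" "inj_on (src G) U"
      using U cob_arrows by (auto simp: cob_iff)
    have fK: "f \<in> steinberg_algebra G" using f by (simp add: J_def)
    have f0: "fibre_sum f x y = 0" for x y using f by (simp add: J_def)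
    have fin: "finite {k. src G k = x \<and> rng G k = y \<and> f k \<noteq> 0}" for x y
      by (rule finite_subset[OF _ finite_supp_fibre(1)[OF fK, of x]]) auto
    note conv_arrow = steinberg_supp_arrows[OF char_fun_convolution_in_algebra(1)[OF U fK]]
      steinberg_supp_arrows[OF char_fun_convolution_in_algebra(2)[OF U fK]]
    have "fibre_sum (convolution G (char_fun c U) f) x y = 0" for x y
    proof (cases "y \<in> rng G ` U")
      case True
      then obtain u where u: "u \<in> U" "y = rng G u" "u \<in> arrows G" using UA by auto
      \<comment> \<open>Left translation by \<open>u\<close> carries the arrows from
        \<open>x\<close> to \<open>src G u\<close> bijectively onto those from \<open>x\<close> to
        \<open>y\<close>, so the entry at \<open>x\<close> and \<open>y\<close> is \<open>c\<close>
        times an entry of \<open>f\<close>.\<close>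
      let ?H = "{k. src G k = x \<and> rng G k = src G u \<and> f k \<noteq> 0}"
      have HA: "k \<in> arrows G" if "k \<in> ?H" for k using that steinberg_supp_arrows[OF fK] by auto
      have conv: "convolution G (char_fun c U) f (gmul G u k) = c * f k" if "k \<in> ?H" for k
        using convolution_char_left[OF UA inj(1) _ u(1), of "gmul G u k"] that HA[OF that] u
        by (simp add: groupoid_simps inv_mul_cancel)
      have "fibre_sum (convolution G (char_fun c U) f) x y
          = sum (convolution G (char_fun c U) f) (gmul G u ` ?H)"
      proof (rule fibre_sum_eq)
        show "finite (gmul G u ` ?H)" using fin by simp
        fix g assume g: "src G g = x" "rng G g = y" "convolution G (char_fun c U) f g \<noteq> 0"
        have gA: "g \<in> arrows G" using g(3) conv_arrow by blast
        have "convolution G (char_fun c U) f g = c * f (gmul G (ginv G u) g)"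
          using convolution_char_left[OF UA inj(1) gA u(1)] u g by simp
        then have "gmul G (ginv G u) g \<in> ?H" using u g gA by (auto simp: groupoid_simps)
        moreover have "g = gmul G u (gmul G (ginv G u) g)" using u g gA mul_inv_cancel by simp
        ultimately show "g \<in> gmul G u ` ?H" by blast
      next
        fix g assume "g \<in> gmul G u ` ?H"
        then show "src G g = x \<and> rng G g = y" using u HA groupoid_simps by auto
      qed
      also have "\<dots> = (\<Sum>k\<in>?H. convolution G (char_fun c U) f (gmul G u k))"
      proof (subst sum.reindex)
        show "inj_on (gmul G u) ?H"
          using HA u(3) inv_mul_cancel[OF u(3)] by (intro inj_on_inverseI[of _ "gmul G (ginv G u)"]) auto
      qed simp
      also have "\<dots> = (\<Sum>k\<in>?H. c * f k)" using conv by (rule sum.cong[OF refl])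
      also have "\<dots> = c * fibre_sum f x (src G u)" by (simp add: fibre_sum_def sum_distrib_left)
      finally show ?thesis using f0 by simp
    next
      case False
      then show ?thesis using convolution_char_left_0 unfolding fibre_sum_def
        by (intro sum.neutral) auto
    qed
    then show "convolution G (char_fun c U) f \<in> J"
      using char_fun_convolution_in_algebra[OF U fK] by (simp add: J_def)
    have "fibre_sum (convolution G f (char_fun c U)) x y = 0" for x y
    proof (cases "x \<in> src G ` U")
      case True
      then obtain u where u: "u \<in> U" "x = src G u" "u \<in> arrows G" using UA by auto
      let ?H = "{k. src G k = rng G u \<and> rng G k = y \<and> f k \<noteq> 0}"
      let ?m = "\<lambda>k. gmul G k u"
      have HA: "k \<in> arrows G" if "k \<in> ?H" for k using that steinberg_supp_arrows[OF fK] by auto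
      have conv: "convolution G f (char_fun c U) (gmul G k u) = f k * c" if "k \<in> ?H" for k
        using convolution_char_right[OF UA inj(2) _ u(1), of "gmul G k u"] that HA[OF that] u
        by (simp add: groupoid_simps mul_cancel_inv)
      have "fibre_sum (convolution G f (char_fun c U)) x y
          = sum (convolution G f (char_fun c U)) (?m ` ?H)"
      proof (rule fibre_sum_eq)
        show "finite (?m ` ?H)" using fin by simp
        fix g assume g: "src G g = x" "rng G g = y" "convolution G f (char_fun c U) g \<noteq> 0"
        have gA: "g \<in> arrows G" using g(3) conv_arrow by blast
        have "convolution G f (char_fun c U) g = f (gmul G g (ginv G u)) * c"
          using convolution_char_right[OF UA inj(2) gA u(1)] u g by simp
        then have "gmul G g (ginv G u) \<in> ?H" using u g gA by (auto simp: groupoid_simps)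
        moreover have "g = ?m (gmul G g (ginv G u))" using u g gA inv_cancel_mul by simp
        ultimately show "g \<in> ?m ` ?H" by blast
      next
        fix g assume "g \<in> ?m ` ?H"
        then show "src G g = x \<and> rng G g = y" using u HA groupoid_simps by auto
      qed
      also have "\<dots> = (\<Sum>k\<in>?H. convolution G f (char_fun c U) (gmul G k u))"
      proof (subst sum.reindex)
        show "inj_on ?m ?H"
          using HA u(3) mul_cancel_inv[OF _ u(3)]
          by (intro inj_on_inverseI[of _ "\<lambda>g. gmul G g (ginv G u)"]) auto
      qed simp
      also have "\<dots> = (\<Sum>k\<in>?H. f k * c)" using conv by (rule sum.cong[OF refl])
      also have "\<dots> = fibre_sum f (rng G u) y * c" by (simp add: fibre_sum_def sum_distrib_right)
      finally show ?thesis using f0 by simp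
    next
      case False
      then show ?thesis using convolution_char_right_0 unfolding fibre_sum_def
        by (intro sum.neutral) auto
    qed
    then show "convolution G f (char_fun c U) \<in> J"
      using char_fun_convolution_in_algebra[OF U fK] by (simp add: J_def)
  qed
  moreover have W_alg: "char_fun 1 W \<in> steinberg_algebra G"
    using char_fun_in_algebra[OF cob_units] W by blast
  moreover have "char_fun 1 W \<notin> J"
  proof -
    have "fibre_sum (char_fun (1 :: 'k) W) x x = sum (char_fun 1 W) {x}"
      using W x src_unit rng_unit by (intro fibre_sum_eq) (auto simp: char_fun_def split: if_splits)
    then have "fibre_sum (char_fun (1 :: 'k) W) x x \<noteq> 0"
      using W(3) by (simp add: char_fun_def)
    then show ?thesis unfolding J_def by blast
  qed
  moreover have "(\<lambda>g. (-1) * char_fun 1 (src G ` B) g) + char_fun 1 B \<in> J" (is "?f \<in> J")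
  proof -
    have sB: "cob (src G ` B)"
      using B BA src_in_units open_src_image compact_src_image by (intro cob_units) (auto simp: cob_iff)
    \<comment> \<open>Both matrices are diagonal: over each source of \<open>B\<close> there is one
      loop in either set, namely the unit itself and the arrow of \<open>B\<close>.\<close>
    have "fibre_sum (char_fun (1 :: 'k) (src G ` B)) x y = fibre_sum (char_fun 1 B) x y" for x y
    proof (cases "x \<in> src G ` B \<and> y = x")
      case True
      then obtain b where b: "b \<in> B" "x = src G b" "b \<in> arrows G" "y = x" using BA by auto
      then have xu: "x \<in> units G" using src_in_units by auto
      have "fibre_sum (char_fun (1 :: 'k) (src G ` B)) x y = sum (char_fun 1 (src G ` B)) {x}"
        using b xu src_unit rng_unit BA src_src
        by (intro fibre_sum_eq) (auto simp: char_fun_def split: if_splits)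
      moreover have "fibre_sum (char_fun (1 :: 'k) B) x y = sum (char_fun 1 B) {b}"
        using b Biso B(1) by (intro fibre_sum_eq) (auto simp: char_fun_def cob_iff inj_on_def split: if_splits)
      ultimately show ?thesis using b by (simp add: char_fun_def)
    next
      case False
      have "fibre_sum (char_fun (1 :: 'k) (src G ` B)) x y = sum (char_fun 1 (src G ` B)) {}"
        using False src_src rng_src BA
        by (intro fibre_sum_eq) (auto simp: char_fun_def split: if_splits)
      moreover have "fibre_sum (char_fun (1 :: 'k) B) x y = sum (char_fun 1 B) {}"
        using False Biso by (intro fibre_sum_eq) (auto simp: char_fun_def split: if_splits)
      ultimately show ?thesis by simp
    qed
    moreover have "fibre_sum ?f x y
        = (-1) * fibre_sum (char_fun 1 (src G ` B)) x y + fibre_sum (char_fun 1 B) x y" for x y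
      by (intro fibre_sum_linear char_fun_in_algebra sB B(1))
    ultimately have "fibre_sum ?f x y = 0" for x y by simp
    moreover have "?f \<in> steinberg_algebra G"
      by (intro fun_space.subspace_add[OF subspace_algebra] fun_space.subspace_scale[OF subspace_algebra]
          char_fun_in_algebra sB B)
    ultimately show ?thesis by (simp add: J_def)
  qed
  ultimately have "?f = 0" by (rule simple_ideal_trivial[OF simple])
  then have "?f g = 0" by (simp only: zero_fun_def)
  moreover have "g \<notin> src G ` B" using g(2) BA src_in_units by auto
  ultimately show False using B(2) by (simp add: char_fun_def)
qed

text \<open>Take a point of \<open>O'\<close> contained in as many of the finitely many defining
  bisections as possible. Within \<open>O'\<close>, every point of the intersection of these
  bisections lies in them and, by maximality, in no others, so \<open>f\<close> is constant
  there.\<close>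

lemma locally_constant_somewhere:
  fixes f :: "'a \<Rightarrow> 'k :: field"
  assumes f: "f \<in> steinberg_algebra G" and O': "openin (gtop G) O'" "O' \<noteq> {}"
  obtains P c where "openin (gtop G) P" "P \<noteq> {}" "P \<subseteq> O'" "\<forall>g\<in>P. f g = c"
proof -
  obtain F c where F: "finite F" "\<forall>U\<in>F. cob U" "\<forall>g. f g = (\<Sum>U\<in>F. if g \<in> U then c U else 0)"
    using steinberg_algebra_explicit[OF f] by blast
  let ?I = "\<lambda>g. {U \<in> F. g \<in> U}"
  have bound: "card (?I g) < Suc (card F)" for g
    using card_mono[OF F(1), of "?I g"] by (simp add: less_Suc_eq_le)
  obtain g0 where "g0 \<in> O'" using O' by blast
  then obtain g where g: "g \<in> O'" "\<And>h. h \<in> O' \<Longrightarrow> card (?I h) \<le> card (?I g)"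
    using ex_has_greatest_nat[of "\<lambda>g. g \<in> O'" g0 "\<lambda>g. card (?I g)" "Suc (card F)"] bound by blast
  define P where "P = \<Inter> (insert O' (?I g))"
  have "openin (gtop G) P"
    unfolding P_def using F O' by (intro openin_Inter) (auto simp: cob_iff)
  moreover have "g \<in> P" using g by (auto simp: P_def)
  moreover have "f h = f g" if h: "h \<in> P" for h
  proof -
    have "?I g \<subseteq> ?I h" "h \<in> O'" using h by (auto simp: P_def)
    then have "?I g = ?I h" using g(2)[of h] F(1) by (intro card_seteq) auto
    moreover have "f k = sum c (?I k)" for k
      using F(1,3) by (simp add: sum.inter_filter)
    ultimately show ?thesis by simp
  qed
  moreover have "P \<subseteq> O'" by (auto simp: P_def)
  ultimately show thesis using that[of P "f g"] by blast
qed

text \<open>The support is nowhere dense. For arbitrary functions this is stronger than a support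
  with empty interior and, unlike the latter, stable under sums; on the algebra the two agree by
  \<open>locally_constant_somewhere\<close>.\<close>

definition vanishes_densely :: "('a \<Rightarrow> 'k :: zero) \<Rightarrow> bool" where
  "vanishes_densely f \<longleftrightarrow> (\<forall>Q. openin (gtop G) Q \<longrightarrow> Q \<noteq> {} \<longrightarrow>
     (\<exists>P. openin (gtop G) P \<and> P \<noteq> {} \<and> P \<subseteq> Q \<and> (\<forall>g\<in>P. f g = 0)))"

lemma vanishes_densely_iff:
  fixes f :: "'a \<Rightarrow> 'k :: field"
  assumes f: "f \<in> steinberg_algebra G"
  shows "vanishes_densely f \<longleftrightarrow>
    (\<forall>Q c. openin (gtop G) Q \<longrightarrow> Q \<noteq> {} \<longrightarrow> (\<forall>g\<in>Q. f g = c) \<longrightarrow> c = 0)"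
proof (intro iffI allI impI)
  fix Q c assume "vanishes_densely f" and Q: "openin (gtop G) Q" "Q \<noteq> {}" "\<forall>g\<in>Q. f g = c"
  then obtain P where "P \<noteq> {}" "P \<subseteq> Q" "\<forall>g\<in>P. f g = 0"
    unfolding vanishes_densely_def by meson
  then show "c = 0" using Q(3) by auto
next
  assume *: "\<forall>Q c. openin (gtop G) Q \<longrightarrow> Q \<noteq> {} \<longrightarrow> (\<forall>g\<in>Q. f g = c) \<longrightarrow> c = 0"
  show "vanishes_densely f"
    unfolding vanishes_densely_def
  proof (intro allI impI)
    fix Q assume Q: "openin (gtop G) Q" "Q \<noteq> {}"
    obtain P c where P: "openin (gtop G) P" "P \<noteq> {}" "P \<subseteq> Q" "\<forall>g\<in>P. f g = c"
      by (rule locally_constant_somewhere[OF f Q])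
    then have "c = 0" using * by blast
    then show "\<exists>P. openin (gtop G) P \<and> P \<noteq> {} \<and> P \<subseteq> Q \<and> (\<forall>g\<in>P. f g = 0)"
      using P by blast
  qed
qed

text \<open>Translation by an open bisection preserves openness, so densely vanishing elements form
  an ideal: an open set of zeros of \<open>f\<close> is found in a translate of \<open>Q\<close> and
  moved back into \<open>Q\<close>. The indicator of \<open>W\<close> shows that the ideal is
  proper.\<close>

lemma simple_imp_not_vanishing_densely:
  fixes f :: "'a \<Rightarrow> 'k :: field"
  assumes simple: "steinberg_simple TYPE('k) G" and ne: "units G \<noteq> {}"
    and f: "f \<in> steinberg_algebra G" "vanishes_densely f"
  shows "f = 0"
proof -
  define J :: "('a \<Rightarrow> 'k) set" where "J = {f \<in> steinberg_algebra G. vanishes_densely f}"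
  obtain x where x: "x \<in> units G" using ne by auto
  then obtain W where W: "openin (gtop G) W" "compactin (gtop G) W" "x \<in> W" "W \<subseteq> units G"
    by (rule compact_open_unit)
  have "steinberg_ideal G J"
  proof (rule steinberg_idealI)
    show "J \<subseteq> steinberg_algebra G" by (auto simp: J_def)
    have "vanishes_densely (h + k)" if "vanishes_densely h" "vanishes_densely k" for h k :: "'a \<Rightarrow> 'k"
      unfolding vanishes_densely_def
    proof (intro allI impI)
      fix Q assume "openin (gtop G) Q" "Q \<noteq> {}"
      then obtain P where P: "openin (gtop G) P" "P \<noteq> {}" "P \<subseteq> Q" "\<forall>g\<in>P. h g = 0"
        using \<open>vanishes_densely h\<close> unfolding vanishes_densely_def by meson
      then obtain P' where "openin (gtop G) P'" "P' \<noteq> {}" "P' \<subseteq> P" "\<forall>g\<in>P'. k g = 0"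
        using \<open>vanishes_densely k\<close> unfolding vanishes_densely_def by meson
      then show "\<exists>P. openin (gtop G) P \<and> P \<noteq> {} \<and> P \<subseteq> Q \<and> (\<forall>g\<in>P. (h + k) g = 0)"
        using P by (intro exI[of _ P']) auto
    qed
    moreover have "vanishes_densely (0 :: 'a \<Rightarrow> 'k)"
      unfolding vanishes_densely_def by auto
    moreover have "vanishes_densely (\<lambda>g. c * h g)" if "vanishes_densely h" for h and c :: 'k
      using that unfolding vanishes_densely_def by (metis mult_zero_right)
    ultimately show "fun_space.subspace J"
      unfolding fun_space.subspace_def J_def
      using fun_space.subspace_0[OF subspace_algebra] fun_space.subspace_add[OF subspace_algebra]
        fun_space.subspace_scale[OF subspace_algebra] by auto
  next
    fix U :: "'a set" and c :: 'k and f assume U: "cob U" and f: "f \<in> J"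
    have UA: "U \<subseteq> arrows G" and inj: "inj_on (rng G) U" "inj_on (src G) U" and oU: "openin (gtop G) U"
      using U cob_arrows by (auto simp: cob_iff)
    have fK: "f \<in> steinberg_algebra G" and fv: "vanishes_densely f" using f by (simp_all add: J_def)
    have oI: "openin (gtop G) (ginv G ` U)" using open_inv_image oU by blast
    have "vanishes_densely (convolution G (char_fun c U) f)"
      unfolding vanishes_densely_def
    proof (intro allI impI)
      fix Q assume Q: "openin (gtop G) Q" "Q \<noteq> {}"
      have QA: "Q \<subseteq> arrows G" using Q open_arrows by auto
      show "\<exists>P. openin (gtop G) P \<and> P \<noteq> {} \<and> P \<subseteq> Q \<and> (\<forall>g\<in>P. convolution G (char_fun c U) f g = 0)"
      proof (cases "\<exists>g\<in>Q. rng G g \<in> rng G ` U")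
        case False
        then have "\<forall>g\<in>Q. convolution G (char_fun c U) f g = 0"
          by (intro ballI convolution_char_left_0) blast
        then show ?thesis using Q by blast
      next
        case True
        then obtain g u where gu: "g \<in> Q" "u \<in> U" "rng G g = rng G u" by auto
        let ?Q = "gprod (ginv G ` U) Q"
        have "gmul G (ginv G u) g \<in> ?Q"
          using gu src_ginv UA by (intro gprodI) (auto simp: subset_iff)
        moreover have "openin (gtop G) ?Q" using open_gprod oI Q by auto
        ultimately obtain P where P: "openin (gtop G) P" "P \<noteq> {}" "P \<subseteq> ?Q" "\<forall>g\<in>P. f g = 0"
          using fv unfolding vanishes_densely_def by (metis empty_iff)
        \<comment> \<open>Each \<open>h\<close> in \<open>P\<close> arises from some
          \<open>k\<close> in \<open>Q\<close> by dividing by some \<open>v\<close> in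
          \<open>U\<close>. As \<open>src\<close> is injective on \<open>U\<close>, this
          \<open>v\<close> is the only element of \<open>U\<close> that can be multiplied back onto
          \<open>h\<close>, and the result is \<open>k\<close>.\<close>
        have key: "\<exists>v k. v \<in> U \<and> v \<in> arrows G \<and> k \<in> Q \<and> k \<in> arrows G \<and> rng G v = rng G k \<and>
            h = gmul G (ginv G v) k \<and> h \<in> arrows G \<and> rng G h = src G v \<and> gmul G v h = k"
          if h: "h \<in> P" for h
        proof -
          obtain w k where "w \<in> ginv G ` U" "k \<in> Q" "src G w = rng G k" "h = gmul G w k"
            using subsetD[OF P(3) h] unfolding gprod_def by blast
          then obtain v where v: "v \<in> U" "k \<in> Q" "src G (ginv G v) = rng G k" "h = gmul G (ginv G v) k"
            by auto
          then have A: "v \<in> arrows G" "k \<in> arrows G" using UA QA by auto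
          then have "rng G v = rng G k" using v src_ginv by simp
          then show ?thesis using v A by (intro exI[of _ v] exI[of _ k]) (auto simp: groupoid_simps mul_inv_cancel)
        qed
        have "openin (gtop G) (gprod U P)" using open_gprod oU P by auto
        moreover have "gprod U P \<noteq> {}"
        proof -
          obtain h where h: "h \<in> P" using P by auto
          then obtain v where "v \<in> U" "rng G h = src G v" using key by blast
          then show ?thesis using gprodI[of v U h P] h by auto
        qed
        moreover have "g \<in> Q \<and> convolution G (char_fun c U) f g = 0" if g: "g \<in> gprod U P" for g
        proof -
          obtain u h where u: "u \<in> U" "h \<in> P" "src G u = rng G h" "g = gmul G u h"
            using g by (auto simp: gprod_def)
          obtain v k where v: "v \<in> U" "v \<in> arrows G" "k \<in> Q" "k \<in> arrows G" "rng G v = rng G k"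
            "h = gmul G (ginv G v) k" "h \<in> arrows G" "rng G h = src G v" "gmul G v h = k"
            using key[OF u(2)] by blast
          have "u = v" using u v inj(2) by (auto simp: inj_on_def)
          then have "g = k" using u v by simp
          then have "convolution G (char_fun c U) f g = c * f h"
            using convolution_char_left[OF UA inj(1) v(4,1,5)] v(6) by simp
          then show ?thesis using P(4) u(2) v(3) \<open>g = k\<close> by simp
        qed
        ultimately show ?thesis by (intro exI[of _ "gprod U P"]) auto
      qed
    qed
    then show "convolution G (char_fun c U) f \<in> J"
      using char_fun_convolution_in_algebra[OF U fK] by (simp add: J_def)
    have "vanishes_densely (convolution G f (char_fun c U))"
      unfolding vanishes_densely_def
    proof (intro allI impI)
      fix Q assume Q: "openin (gtop G) Q" "Q \<noteq> {}"
      have QA: "Q \<subseteq> arrows G" using Q open_arrows by auto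
      show "\<exists>P. openin (gtop G) P \<and> P \<noteq> {} \<and> P \<subseteq> Q \<and> (\<forall>g\<in>P. convolution G f (char_fun c U) g = 0)"
      proof (cases "\<exists>g\<in>Q. src G g \<in> src G ` U")
        case False
        then have "\<forall>g\<in>Q. convolution G f (char_fun c U) g = 0"
          by (intro ballI convolution_char_right_0) blast
        then show ?thesis using Q by blast
      next
        case True
        then obtain g u where gu: "g \<in> Q" "u \<in> U" "src G g = src G u" by auto
        let ?Q = "gprod Q (ginv G ` U)"
        have "gmul G g (ginv G u) \<in> ?Q"
          using gu rng_ginv UA by (intro gprodI) (auto simp: subset_iff)
        moreover have "openin (gtop G) ?Q" using open_gprod oI Q by auto
        ultimately obtain P where P: "openin (gtop G) P" "P \<noteq> {}" "P \<subseteq> ?Q" "\<forall>g\<in>P. f g = 0"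
          using fv unfolding vanishes_densely_def by (metis empty_iff)
        have key: "\<exists>v k. v \<in> U \<and> v \<in> arrows G \<and> k \<in> Q \<and> k \<in> arrows G \<and> src G v = src G k \<and>
            h = gmul G k (ginv G v) \<and> h \<in> arrows G \<and> src G h = rng G v \<and> gmul G h v = k"
          if h: "h \<in> P" for h
        proof -
          obtain w k where "w \<in> ginv G ` U" "k \<in> Q" "src G k = rng G w" "h = gmul G k w"
            using subsetD[OF P(3) h] unfolding gprod_def by blast
          then obtain v where v: "v \<in> U" "k \<in> Q" "src G k = rng G (ginv G v)" "h = gmul G k (ginv G v)"
            by auto
          then have A: "v \<in> arrows G" "k \<in> arrows G" using UA QA by auto
          then have "src G v = src G k" using v rng_ginv by simp
          then show ?thesis using v A by (intro exI[of _ v] exI[of _ k]) (auto simp: groupoid_simps inv_cancel_mul)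
        qed
        have "openin (gtop G) (gprod P U)" using open_gprod oU P by auto
        moreover have "gprod P U \<noteq> {}"
        proof -
          obtain h where h: "h \<in> P" using P by auto
          then obtain v where "v \<in> U" "src G h = rng G v" using key by blast
          then show ?thesis using gprodI[of h P v U] h by auto
        qed
        moreover have "g \<in> Q \<and> convolution G f (char_fun c U) g = 0" if g: "g \<in> gprod P U" for g
        proof -
          obtain h u where u: "u \<in> U" "h \<in> P" "src G h = rng G u" "g = gmul G h u"
            using g by (auto simp: gprod_def)
          obtain v k where v: "v \<in> U" "v \<in> arrows G" "k \<in> Q" "k \<in> arrows G" "src G v = src G k"
            "h = gmul G k (ginv G v)" "h \<in> arrows G" "src G h = rng G v" "gmul G h v = k"
            using key[OF u(2)] by blast
          have "u = v" using u v inj(1) by (auto simp: inj_on_def)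
          then have "g = k" using u v by simp
          then have "convolution G f (char_fun c U) g = f h * c"
            using convolution_char_right[OF UA inj(2) v(4,1,5)] v(6) by simp
          then show ?thesis using P(4) u(2) v(3) \<open>g = k\<close> by simp
        qed
        ultimately show ?thesis by (intro exI[of _ "gprod P U"]) auto
      qed
    qed
    then show "convolution G f (char_fun c U) \<in> J"
      using char_fun_convolution_in_algebra[OF U fK] by (simp add: J_def)
  qed
  moreover have W_alg: "char_fun (1 :: 'k) W \<in> steinberg_algebra G"
    using char_fun_in_algebra[OF cob_units] W by blast
  moreover have "char_fun (1 :: 'k) W \<notin> J"
  proof
    assume "char_fun (1 :: 'k) W \<in> J"
    then have "vanishes_densely (char_fun (1 :: 'k) W)" by (simp add: J_def)
    moreover have "W \<noteq> {}" using W by auto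
    moreover have "\<forall>g\<in>W. char_fun (1 :: 'k) W g = 1" by (simp add: char_fun_def)
    ultimately have "(1 :: 'k) = 0" unfolding vanishes_densely_iff[OF W_alg] using W(1) by blast
    then show False by simp
  qed
  moreover have "f \<in> J" using f by (simp add: J_def)
  ultimately show ?thesis by (rule simple_ideal_trivial[OF simple])
qed

end

section \<open>Densely vanishing functions and the singularity condition\<close>

text \<open>Condition (3) of \<open>(S\<^sub>t)\<close> in dual form, over the coefficient field of the algebra: instead of the
  \<open>b\<^sub>I\<close> failing to span, a nonzero functional \<open>a\<close> kills all of them.\<close>

definition dual_condition_S :: "'k :: field itself \<Rightarrow> 'g top_groupoid \<Rightarrow> bool" where
  "dual_condition_S K G \<longleftrightarrow>
     (\<exists>n > 0. \<exists>U :: nat \<Rightarrow> 'g set.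
        (\<forall>i \<in> {1..n}. open_bisection G (U i)) \<and>
        (\<forall>i \<in> {1..n}. \<forall>j \<in> {1..n}. src G ` U i = src G ` U j) \<and>
        (\<forall>i \<in> {1..n}. U i - (\<Union>j\<in>{1..n} - {i}. U j) \<noteq> {} \<and>
           gtop G interior_of (U i - (\<Union>j\<in>{1..n} - {i}. U j)) = {}) \<and>
        (\<exists>a :: nat \<Rightarrow> 'k. (\<exists>i\<in>{1..n}. a i \<noteq> 0) \<and> (\<forall>I\<in>incidence_sets n U. sum a I = 0)))"

context ample_groupoid
begin

text \<open>Over a small enough \<open>W\<close>, any two defining bisections through the same arrow
  over \<open>x\<close> coincide, and those with no arrow over \<open>x\<close> disappear.
  Collecting the terms by arrows over \<open>x\<close> leaves the values of \<open>f\<close> there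
  as coefficients.\<close>

lemma steinberg_local_form:
  fixes f :: "'a \<Rightarrow> 'k :: field"
  assumes f: "f \<in> steinberg_algebra G" and x: "x \<in> units G"
  defines "S \<equiv> {g. src G g = x \<and> f g \<noteq> 0}"
  shows "\<exists>W B. x \<in> W \<and> W \<subseteq> units G \<and>
    (\<forall>g\<in>S. open_bisection G (B g) \<and> g \<in> B g \<and> src G ` B g = W) \<and>
    (\<forall>h\<in>arrows G. src G h \<in> W \<longrightarrow> f h = (\<Sum>g\<in>S. if h \<in> B g then f g else 0))"
proof -
  obtain F c where F: "finite F" "\<forall>U\<in>F. cob U"
    and fF: "\<forall>g. f g = (\<Sum>U\<in>F. if g \<in> U then c U else 0)"
    using steinberg_algebra_explicit[OF f] by blast
  have inj: "inj_on (rng G) U" "inj_on (src G) U" and oU: "openin (gtop G) U" and UA: "U \<subseteq> arrows G"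
    if "U \<in> F" for U
    using F(2) that cob_arrows by (auto simp: cob_iff)
  \<comment> \<open>\<open>D\<close> also contains arrows at which the coefficients cancel; they are
    discarded only after the terms have been collected.\<close>
  define D where "D = {g \<in> \<Union>F. src G g = x}"
  have "D = (\<Union>U\<in>F. {g \<in> U. src G g = x})" by (auto simp: D_def)
  then have finD: "finite D" using F(1) inj by (auto intro!: finite_inj_fibre)
  have SD: "S \<subseteq> D"
  proof
    fix g assume g: "g \<in> S"
    have "\<exists>U\<in>F. g \<in> U"
    proof (rule ccontr)
      assume "\<not> (\<exists>U\<in>F. g \<in> U)"
      then have "f g = 0" using fF by (auto intro: sum.neutral)
      then show False using g by (simp add: S_def)
    qed
    then show "g \<in> D" using g by (auto simp: D_def S_def)
  qed
  define V where "V g = \<Inter>{U \<in> F. g \<in> U}" for g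
  have oV: "openin (gtop G) (V g)" if "g \<in> D" for g
    unfolding V_def using F(1) oU that by (intro openin_Inter) (auto simp: D_def)
  have VU: "V g \<subseteq> U" if "U \<in> F" "g \<in> U" for g U using that by (auto simp: V_def)
  have gV: "g \<in> V g" for g by (auto simp: V_def)
  have injV: "inj_on (rng G) (V g)" "inj_on (src G) (V g)" if g: "g \<in> D" for g
  proof -
    obtain U where U: "U \<in> F" "g \<in> U" using g by (auto simp: D_def)
    show "inj_on (rng G) (V g)" "inj_on (src G) (V g)"
      using inj[OF U(1)] VU[OF U] inj_on_subset by blast+
  qed
  \<comment> \<open>Every \<open>V g\<close> has to reach all of \<open>W\<close>, and members of
    \<open>F\<close> with no arrow over \<open>x\<close> must have no sources in \<open>W\<close>.
    The latter is an open condition because the sources of a compact bisection form a closed set of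
    units.\<close>
  define W where "W = \<Inter> (insert (units G)
    ((\<lambda>g. src G ` V g) ` D \<union> (\<lambda>U. units G - src G ` U) ` {U \<in> F. x \<notin> src G ` U}))"
  have oW: "openin (gtop G) W"
    unfolding W_def
  proof (rule openin_Inter)
    fix T assume "T \<in> insert (units G)
      ((\<lambda>g. src G ` V g) ` D \<union> (\<lambda>U. units G - src G ` U) ` {U \<in> F. x \<notin> src G ` U})"
    then consider "T = units G" | g where "g \<in> D" "T = src G ` V g"
      | U where "U \<in> F" "T = units G - src G ` U" by auto
    then show "openin (gtop G) T"
    proof cases
      case 3
      have "src G ` U \<subseteq> units G" using UA[OF 3(1)] src_in_units by auto
      then show ?thesis
        using 3 F(2) open_Diff_compact_units[OF compact_src_image] by (auto simp: cob_iff)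
    qed (auto intro: open_units open_src_image oV)
  qed (use F(1) finD in auto)
  have xW: "x \<in> W"
    using x gV by (auto simp: W_def D_def image_iff)
  have Wu: "W \<subseteq> units G" by (auto simp: W_def)
  define B where "B g = {u \<in> V g. src G u \<in> W}" for g
  have B: "open_bisection G (B g) \<and> g \<in> B g \<and> src G ` B g = W" if g: "g \<in> D" for g
  proof (intro conjI)
    have "B g = V g \<inter> {u \<in> arrows G. src G u \<in> W}"
      using open_arrows[OF oV[OF g]] by (auto simp: B_def)
    then have "openin (gtop G) (B g)" using oV[OF g] open_vimage_src[OF oW] by auto
    moreover have "inj_on (rng G) (B g)" "inj_on (src G) (B g)"
      using injV[OF g] by (auto simp: B_def inj_on_def)
    ultimately show "open_bisection G (B g)" by (simp add: open_bisection_def)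
    show "g \<in> B g" using g xW gV by (auto simp: B_def D_def)
    have "W \<subseteq> src G ` V g" using g by (auto simp: W_def)
    then show "src G ` B g = W" by (auto simp: B_def)
  qed
  have main: "f h = (\<Sum>g\<in>S. if h \<in> B g then f g else 0)" if h: "h \<in> arrows G" "src G h \<in> W" for h
  proof -
    \<comment> \<open>Over \<open>W\<close>, a member of \<open>F\<close> is empty or coincides with
      \<open>B g0\<close> for its unique arrow \<open>g0\<close> over \<open>x\<close>: one is
      contained in the other and both are sections over \<open>W\<close>.\<close>
    have expand: "(if h \<in> U then c U else 0) = (\<Sum>g\<in>D. if h \<in> B g \<and> g \<in> U then c U else 0)"
      if U: "U \<in> F" for U
    proof (cases "h \<in> U")
      case True
      have "x \<in> src G ` U"
      proof (rule ccontr)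
        assume "x \<notin> src G ` U"
        then have "W \<subseteq> units G - src G ` U" using U by (auto simp: W_def)
        then show False using True h by auto
      qed
      then obtain g0 where g0: "g0 \<in> U" "src G g0 = x" by auto
      then have g0D: "g0 \<in> D" using U by (auto simp: D_def)
      then have "src G h \<in> src G ` V g0" using h by (auto simp: W_def)
      then obtain h' where h': "h' \<in> V g0" "src G h' = src G h" by auto
      then have "h' \<in> U" using VU[OF U g0(1)] by auto
      then have "h' = h" using inj(2)[OF U] True h' by (auto simp: inj_on_def)
      then have "h \<in> B g0" using h' h by (auto simp: B_def)
      moreover have "g = g0" if "g \<in> D" "g \<in> U" for g
        using that g0 inj(2)[OF U] by (auto simp: D_def inj_on_def)
      ultimately have "(h \<in> B g \<and> g \<in> U) \<longleftrightarrow> g = g0" if "g \<in> D" for g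
        using that g0 by auto
      then have "(\<Sum>g\<in>D. if h \<in> B g \<and> g \<in> U then c U else 0) = (\<Sum>g\<in>D. if g = g0 then c U else 0)"
        by (intro sum.cong) auto
      then show ?thesis using True finD g0D by simp
    next
      case False
      then have "\<not> (h \<in> B g \<and> g \<in> U)" for g using VU[OF U] by (auto simp: B_def)
      then have "(\<Sum>g\<in>D. if h \<in> B g \<and> g \<in> U then c U else 0) = 0"
        by (intro sum.neutral) auto
      then show ?thesis using False by simp
    qed
    have "f h = (\<Sum>U\<in>F. \<Sum>g\<in>D. if h \<in> B g \<and> g \<in> U then c U else 0)"
      using fF expand by (simp cong: sum.cong)
    also have "\<dots> = (\<Sum>g\<in>D. \<Sum>U\<in>F. if h \<in> B g \<and> g \<in> U then c U else 0)"
      by (rule sum.swap)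
    \<comment> \<open>For fixed \<open>g\<close>, the coefficients of the members of
      \<open>F\<close> containing \<open>g\<close> add up to \<open>f g\<close>.\<close>
    also have "\<dots> = (\<Sum>g\<in>D. if h \<in> B g then f g else 0)"
    proof (rule sum.cong[OF refl])
      fix g
      show "(\<Sum>U\<in>F. if h \<in> B g \<and> g \<in> U then c U else 0) = (if h \<in> B g then f g else 0)"
        using spec[OF fF, of g] by (cases "h \<in> B g") simp_all
    qed
    also have "\<dots> = (\<Sum>g\<in>S. if h \<in> B g then f g else 0)"
      using finD SD by (intro sum.mono_neutral_right) (auto simp: D_def S_def)
    finally show ?thesis .
  qed
  show ?thesis
    using xW Wu B SD main by (intro exI[of _ W] exI[of _ B]) blast
qed

text \<open>The base point is chosen to minimise the number of points of the support in its fibre: near it,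
  points lying in several of the bisections lie over a smaller fibre, hence outside the support.\<close>

lemma vanishing_densely_imp_dual_condition_S:
  fixes f :: "'a \<Rightarrow> 'k :: field"
  assumes f: "f \<in> steinberg_algebra G" and v: "vanishes_densely f" and nz: "f \<noteq> 0"
  shows "dual_condition_S TYPE('k) G"
proof -
  define S where "S x = {g. src G g = x \<and> f g \<noteq> 0}" for x
  have finS: "finite (S x)" for x using finite_supp_fibre(1)[OF f] by (simp add: S_def)
  obtain g0 where "f g0 \<noteq> 0" using nz by (auto simp: fun_eq_iff)
  then have "S (src G g0) \<noteq> {}" by (auto simp: S_def)
  then obtain x where x: "S x \<noteq> {}" "\<And>y. S y \<noteq> {} \<Longrightarrow> card (S x) \<le> card (S y)"
    using ex_has_least_nat[of "\<lambda>x. S x \<noteq> {}" _ "\<lambda>x. card (S x)"] by blast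
  have SA: "g \<in> arrows G" if "g \<in> S y" for g y
    using that steinberg_supp_arrows[OF f] by (auto simp: S_def)
  have xu: "x \<in> units G" using x(1) SA src_in_units by (auto simp: S_def)
  obtain W B where W: "x \<in> W" "W \<subseteq> units G"
    and bisB: "\<forall>g\<in>S x. open_bisection G (B g) \<and> g \<in> B g \<and> src G ` B g = W"
    and fB: "\<forall>h\<in>arrows G. src G h \<in> W \<longrightarrow> f h = (\<Sum>g\<in>S x. if h \<in> B g then f g else 0)"
    using steinberg_local_form[OF f xu] unfolding S_def[symmetric] by blast
  have B: "open_bisection G (B g)" "g \<in> B g" "src G ` B g = W" if "g \<in> S x" for g
    using bisB that by blast+
  define n where "n = card (S x)"
  obtain e where e: "bij_betw e {1..n} (S x)"
    using ex_bij_betw_nat_finite_1[OF finS[of x]] unfolding n_def by blast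
  have eS: "e i \<in> S x" if "i \<in> {1..n}" for i using e that by (auto simp: bij_betw_def)
  have e_inj: "i = j" if "i \<in> {1..n}" "j \<in> {1..n}" "e i = e j" for i j
    using inj_onD[OF bij_betw_imp_inj_on[OF e]] that by blast
  define U where "U i = B (e i)" for i
  define a where "a i = f (e i)" for i
  have n: "n > 0" using x(1) finS by (simp add: n_def card_gt_0_iff)
  have bis: "open_bisection G (U i)" if "i \<in> {1..n}" for i using B(1) eS that by (simp add: U_def)
  have eU: "e i \<in> U i" if "i \<in> {1..n}" for i using B(2) eS that by (simp add: U_def)
  have sU: "src G ` U i = W" if "i \<in> {1..n}" for i using B(3) eS that by (simp add: U_def)
  have UA: "U i \<subseteq> arrows G" if "i \<in> {1..n}" for i
    using bis[OF that] open_arrows by (auto simp: open_bisection_def)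
  have injU: "g = h" if "i \<in> {1..n}" "g \<in> U i" "h \<in> U i" "src G g = src G h" for i g h
    using bis[OF that(1)] inj_onD[of "src G" "U i" g h] that by (simp add: open_bisection_def)
  have fU: "f h = (\<Sum>i\<in>{1..n}. if h \<in> U i then a i else 0)" if "h \<in> arrows G" "src G h \<in> W" for h
    unfolding fB[rule_format, OF that] U_def a_def by (rule sum.reindex_bij_betw[OF e, symmetric])
  have fI: "f h = sum a {i \<in> {1..n}. h \<in> U i}" if "h \<in> arrows G" "src G h \<in> W" for h
    unfolding fU[OF that] by (rule sum.inter_filter[symmetric]) simp
  have a_nz: "a i \<noteq> 0" if "i \<in> {1..n}" for i using eS[OF that] by (simp add: a_def S_def)
  have e_only: "e i \<notin> U j" if "i \<in> {1..n}" "j \<in> {1..n}" "i \<noteq> j" for i j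
  proof
    assume "e i \<in> U j"
    moreover have "src G (e i) = src G (e j)" using eS that by (auto simp: S_def)
    ultimately have "e i = e j" using injU[OF that(2)] eU[OF that(2)] by blast
    then show False using e_inj that by blast
  qed
  let ?A = "\<lambda>i. U i - (\<Union>j\<in>{1..n} - {i}. U j)"
  have A_ne: "?A i \<noteq> {}" if i: "i \<in> {1..n}" for i
  proof -
    have "e i \<in> ?A i" using eU[OF i] e_only[OF i] by auto
    then show ?thesis by blast
  qed
  have A_int: "gtop G interior_of ?A i = {}" if i: "i \<in> {1..n}" for i
  proof (rule ccontr)
    assume ne: "gtop G interior_of ?A i \<noteq> {}"
    \<comment> \<open>An arrow lying in \<open>U i\<close> alone has the nonzero value
      \<open>a i\<close>, and a densely vanishing function cannot take a constant nonzero value on a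
      nonempty open set.\<close>
    have "f h = a i" if "h \<in> gtop G interior_of ?A i" for h
    proof -
      have h: "h \<in> ?A i" by (rule subsetD[OF interior_of_subset that])
      then have hA: "h \<in> arrows G" "src G h \<in> W" using UA[OF i] sU[OF i] by blast+
      have "{j \<in> {1..n}. h \<in> U j} = {i}" using h i by blast
      then show ?thesis unfolding fI[OF hA] by (simp only: sum.insert finite.emptyI empty_iff sum.empty add_0_right not_False_eq_True)
    qed
    then have "\<forall>h\<in>gtop G interior_of ?A i. f h = a i" by blast
    then have "a i = 0"
      using v[unfolded vanishes_densely_iff[OF f], rule_format, OF openin_interior_of ne] by blast
    then show False using a_nz i by blast
  qed
  have ker: "sum a I = 0" if I: "I \<in> incidence_sets n U" for I
  proof (rule ccontr)
    assume nz: "sum a I \<noteq> 0"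
    have I': "I \<subseteq> {1..n}" "card I > 1" "(\<Inter>i\<in>I. U i) - (\<Union>j\<in>{1..n} - I. U j) \<noteq> {}"
      using I by (auto simp: incidence_sets_def)
    then obtain h where hI: "h \<in> (\<Inter>i\<in>I. U i) - (\<Union>j\<in>{1..n} - I. U j)" by blast
    have h: "h \<in> U i" if "i \<in> I" for i using hI that by blast
    have h': "h \<notin> U j" if "j \<in> {1..n}" "j \<notin> I" for j using hI that by blast
    have "\<exists>i\<in>I. \<exists>j\<in>I. i \<noteq> j"
    proof (rule ccontr)
      assume "\<not> (\<exists>i\<in>I. \<exists>j\<in>I. i \<noteq> j)"
      then have "card I \<le> 1" by (auto simp: card_le_Suc0_iff_eq[OF finite_subset[OF I'(1)]])
      then show False using I' by simp
    qed
    then obtain i j where ij: "i \<in> I" "j \<in> I" "i \<noteq> j" by blast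
    then have ijn: "i \<in> {1..n}" "j \<in> {1..n}" using I' by auto
    have hA: "h \<in> arrows G" "src G h \<in> W" using h[OF ij(1)] UA[OF ijn(1)] sU[OF ijn(1)] by blast+
    have "{i \<in> {1..n}. h \<in> U i} = I" using h h' I'(1) by blast
    then have "f h \<noteq> 0" unfolding fI[OF hA] using nz by (simp only: not_False_eq_True)
    define y where "y = src G h"
    have "S y \<noteq> {}" using \<open>f h \<noteq> 0\<close> by (auto simp: S_def y_def)
    then have le: "n \<le> card (S y)" using x(2) by (simp add: n_def)
    \<comment> \<open>All \<open>U k\<close> have source \<open>W\<close>, so each contains exactly
      one arrow over \<open>y\<close>, and the support over \<open>y\<close> is among these
      arrows.\<close>
    define \<phi> where "\<phi> k = (SOME u. u \<in> U k \<and> src G u = y)" for k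
    have \<phi>: "\<phi> k \<in> U k \<and> src G (\<phi> k) = y" if "k \<in> {1..n}" for k
    proof -
      have "y \<in> src G ` U k" using sU[OF that] hA by (simp add: y_def)
      then have "\<exists>u. u \<in> U k \<and> src G u = y" by auto
      then show ?thesis unfolding \<phi>_def by (rule someI_ex)
    qed
    have \<phi>_eq: "\<phi> k = u" if "k \<in> {1..n}" "u \<in> U k" "src G u = y" for k u
      using injU[OF that(1)] \<phi>[OF that(1)] that by metis
    have "S y \<subseteq> \<phi> ` ({1..n} - {j})"
    proof
      fix k assume k: "k \<in> S y"
      then have kA: "k \<in> arrows G" "src G k = y" using SA by (auto simp: S_def)
      have "f k = sum a {i \<in> {1..n}. k \<in> U i}" using fI kA hA by (simp add: y_def)
      moreover have "f k \<noteq> 0" using k by (simp add: S_def)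
      ultimately have "{i \<in> {1..n}. k \<in> U i} \<noteq> {}" by (metis sum.empty)
      then obtain m where m: "m \<in> {1..n}" "k \<in> U m" by blast
      then have mk: "\<phi> m = k" using \<phi>_eq kA by blast
      show "k \<in> \<phi> ` ({1..n} - {j})"
      proof (cases "m = j")
        case True
        then have "\<phi> i = k" using \<phi>_eq[OF ijn(1) h[OF ij(1)]] \<phi>_eq[OF ijn(2) h[OF ij(2)]] mk
          by (simp add: y_def)
        then show ?thesis using ij(3) ijn by blast
      next
        case False
        then show ?thesis using m mk by blast
      qed
    qed
    then have "card (S y) \<le> card ({1..n} - {j})" by (rule surj_card_le[rotated]) simp
    then have "card (S y) \<le> n - 1" using ijn by simp
    then show False using le n by linarith
  qed
  show ?thesis
    unfolding dual_condition_S_def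
  proof (intro exI[of _ n] exI[of _ U] exI[of _ a] conjI ballI n)
    show "\<exists>i\<in>{1..n}. a i \<noteq> 0" using n a_nz[of 1] by (intro bexI[of _ 1]) auto
  qed (use bis sU A_ne A_int ker in auto)
qed

text \<open>\<open>U\<close> need not be compact here, so compactness is drawn from
  \<open>V\<close>: inversion exchanges \<open>src\<close> and \<open>rng\<close>, and the
  restricted bisection is homeomorphic to \<open>V\<close>.\<close>

lemma cob_restrict_bisection:
  assumes U: "open_bisection G U" and V: "openin (gtop G) V" "compactin (gtop G) V" "V \<subseteq> src G ` U"
  shows "cob {u \<in> U. src G u \<in> V}"
proof -
  let ?B = "{u \<in> U. src G u \<in> V}"
  have U': "openin (gtop G) U" "inj_on (rng G) U" "inj_on (src G) U"
    using U by (auto simp: open_bisection_def)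
  have UA: "U \<subseteq> arrows G" using U' open_arrows by auto
  have "?B = U \<inter> {u \<in> arrows G. src G u \<in> V}" using UA by auto
  then have oB: "openin (gtop G) ?B" using U' open_vimage_src[OF V(1)] by auto
  have inj: "inj_on (rng G) ?B" "inj_on (src G) ?B" using U' by (auto simp: inj_on_def)
  have BA: "?B \<subseteq> arrows G" using UA by auto
  have "src G ` ?B = V" using V(3) by auto
  then have "rng G ` ginv G ` ?B = V" using src_image_eq[OF BA] by simp
  then have "compactin (gtop G) (ginv G ` ?B)"
    using V(2) compact_if_rng_compact[OF open_inv_image[OF oB] inj_on_rng_inv_image[OF BA inj(2)]] by simp
  then have "compactin (gtop G) (ginv G ` ginv G ` ?B)"
    by (rule image_compactin[OF _ continuous_ginv])
  moreover have "ginv G ` ginv G ` ?B = ?B"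
    using BA inv_inv by (force simp: image_image)
  ultimately show ?thesis using oB inj by (simp add: cob_iff)
qed

lemma sum_fun_apply: "(sum F A) g = (\<Sum>i\<in>A. F i g)" for F :: "'i \<Rightarrow> 'b \<Rightarrow> 'c :: comm_monoid_add"
  by (induction A rule: infinite_finite_induct) auto

text \<open>The value of the weighted sum of indicators at \<open>h\<close> is
  \<open>sum a I\<close> for the set \<open>I\<close> of indices with \<open>h\<close> in
  \<open>U i\<close>. It vanishes when \<open>I\<close> has several elements, by the choice of
  \<open>a\<close>; where \<open>I\<close> is a single index, \<open>h\<close> lies in a set with
  empty interior.\<close>

lemma dual_condition_S_imp_vanishing_densely:
  assumes "dual_condition_S TYPE('k :: field) G"
  shows "\<exists>f \<in> steinberg_algebra G. f \<noteq> (0 :: 'a \<Rightarrow> 'k) \<and> vanishes_densely f"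
proof -
  obtain n U and a :: "nat \<Rightarrow> 'k" where U: "\<forall>i\<in>{1..n}. open_bisection G (U i)"
      "\<forall>i\<in>{1..n}. \<forall>j\<in>{1..n}. src G ` U i = src G ` U j"
      "\<forall>i\<in>{1..n}. U i - (\<Union>j\<in>{1..n} - {i}. U j) \<noteq> {} \<and>
        gtop G interior_of (U i - (\<Union>j\<in>{1..n} - {i}. U j)) = {}"
    and a: "\<exists>i\<in>{1..n}. a i \<noteq> 0" and ker: "\<forall>I\<in>incidence_sets n U. sum a I = 0"
    using assms unfolding dual_condition_S_def by (elim exE conjE) (rule that)
  have bis: "open_bisection G (U i)" if "i \<in> {1..n}" for i using U(1) that by blast
  have s: "src G ` U i = src G ` U j" if "i \<in> {1..n}" "j \<in> {1..n}" for i j using U(2) that by blast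
  have A: "U i - (\<Union>j\<in>{1..n} - {i}. U j) \<noteq> {}"
    and A_int: "gtop G interior_of (U i - (\<Union>j\<in>{1..n} - {i}. U j)) = {}" if "i \<in> {1..n}" for i
    using bspec[OF U(3) that] by blast+
  obtain i0 where i0: "i0 \<in> {1..n}" "a i0 \<noteq> 0" using a by blast
  obtain g0 where "g0 \<in> U i0 - (\<Union>j\<in>{1..n} - {i0}. U j)"
    using A[OF i0(1)] by blast
  then have g0: "g0 \<in> U i0" "\<forall>j\<in>{1..n}. g0 \<in> U j \<longrightarrow> j = i0" by blast+
  have oU: "openin (gtop G) (U i)" and UA: "U i \<subseteq> arrows G" if "i \<in> {1..n}" for i
    using bis[OF that] open_arrows by (auto simp: open_bisection_def)
  have src0: "src G g0 \<in> src G ` U i0" "src G g0 \<in> units G"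
    using g0(1) UA[OF i0(1)] src_in_units by auto
  \<comment> \<open>The bisections of the condition are merely open. They are cut down over one
    compact open set of common sources, chosen around the source of \<open>g0\<close> so that the
    value \<open>a i0\<close> at \<open>g0\<close> survives.\<close>
  obtain V where V: "openin (gtop G) V" "compactin (gtop G) V" "src G g0 \<in> V" "V \<subseteq> src G ` U i0"
    "V \<subseteq> units G"
    by (rule compact_open_unit_nbhd[OF open_src_image[OF oU[OF i0(1)]] src0])
  define B where "B i = {u \<in> U i. src G u \<in> V}" for i
  have B: "cob (B i)" if "i \<in> {1..n}" for i
    unfolding B_def using V(4) s[OF that i0(1)] by (intro cob_restrict_bisection bis that V) simp
  define f :: "'a \<Rightarrow> 'k" where "f = (\<Sum>i\<in>{1..n}. char_fun (a i) (B i))"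
  have fK: "f \<in> steinberg_algebra G"
    unfolding f_def by (intro fun_space.subspace_sum[OF subspace_algebra] char_fun_in_algebra B)
  let ?I = "\<lambda>h. {i \<in> {1..n}. h \<in> U i}"
  have f_eq: "f h = (if src G h \<in> V then sum a (?I h) else 0)" for h
  proof -
    have "f h = (\<Sum>i\<in>{1..n}. if h \<in> B i then a i else 0)"
      by (simp add: f_def sum_fun_apply char_fun_def)
    also have "\<dots> = sum a {i \<in> {1..n}. h \<in> B i}" by (rule sum.inter_filter[symmetric]) simp
    also have "{i \<in> {1..n}. h \<in> B i} = (if src G h \<in> V then ?I h else {})" by (auto simp: B_def)
    finally show ?thesis by simp
  qed
  have Ig0: "?I g0 = {i0}" using g0 i0(1) by blast
  have "f g0 = a i0" unfolding f_eq Ig0 using V(3) by simp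
  then have "f g0 \<noteq> 0" using i0(2) by simp
  then have "f \<noteq> 0" by (metis zero_fun_def)
  moreover have "vanishes_densely f"
    unfolding vanishes_densely_iff[OF fK]
  proof (intro allI impI, rule ccontr)
    fix Q c assume Q: "openin (gtop G) Q" "Q \<noteq> {}" "\<forall>g\<in>Q. f g = c" "c \<noteq> 0"
    have single: "\<exists>i. ?I h = {i}" if h: "h \<in> Q" for h
    proof -
      have "f h \<noteq> 0" using Q(3,4) h by simp
      then have nz: "sum a (?I h) \<noteq> 0" unfolding f_eq by presburger
      then have ne: "?I h \<noteq> {}" by (metis sum.empty)
      have "\<not> card (?I h) > 1"
      proof
        assume "card (?I h) > 1"
        moreover have "h \<in> (\<Inter>i\<in>?I h. U i) - (\<Union>j\<in>{1..n} - ?I h. U j)" by blast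
        ultimately have "?I h \<in> incidence_sets n U" unfolding incidence_sets_def by blast
        then show False using ker nz by blast
      qed
      moreover have "card (?I h) > 0" using ne by (simp add: card_gt_0_iff)
      ultimately have "card (?I h) = 1" by linarith
      then show ?thesis by (rule card_1_singletonE) blast
    qed
    obtain h where h: "h \<in> Q" using Q by auto
    then obtain i where i: "?I h = {i}" using single by blast
    then have "i \<in> ?I h" by blast
    then have iU: "i \<in> {1..n}" "h \<in> U i" by blast+
    \<comment> \<open>Every point of \<open>Q\<close> lies in exactly one bisection, so near
      \<open>h\<close> the open set \<open>Q\<close> stays in the part belonging to
      \<open>U i\<close> alone, which has empty interior.\<close>
    have "Q \<inter> U i \<subseteq> U i - (\<Union>j\<in>{1..n} - {i}. U j)"
    proof
      fix k assume k: "k \<in> Q \<inter> U i"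
      then obtain j where j: "?I k = {j}" using single by blast
      have "i \<in> ?I k" using k iU by blast
      then have "i = j" unfolding j by (rule singletonD)
      then have "?I k = {i}" using j by (simp only:)
      then have "\<And>l. l \<in> {1..n} \<Longrightarrow> k \<in> U l \<Longrightarrow> l = i" by blast
      then show "k \<in> U i - (\<Union>j\<in>{1..n} - {i}. U j)" using k by blast
    qed
    moreover have "openin (gtop G) (Q \<inter> U i)" using Q(1) oU[OF iU(1)] by auto
    ultimately have "Q \<inter> U i \<subseteq> gtop G interior_of (U i - (\<Union>j\<in>{1..n} - {i}. U j))"
      by (rule interior_of_maximal)
    then show False using A_int[OF iU(1)] h iU by blast
  qed
  ultimately show ?thesis using fK by blast
qed

section \<open>Sufficiency\<close>

text \<open>One bisection is treated at a time. The arrows of \<open>U\<close> with both ends in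
  \<open>V\<close> form an open set. If they are all isotropy, effectiveness makes them units;
  otherwise one of them has distinct ends, and \<open>V\<close> is shrunk until no arrow of
  \<open>U\<close> has both ends in it.\<close>

lemma effective_shrink:
  assumes eff: "effective G" and F: "finite F" "\<forall>U\<in>F. cob U"
    and R: "openin (gtop G) R" "R \<noteq> {}" "R \<subseteq> units G"
  shows "\<exists>V. openin (gtop G) V \<and> V \<noteq> {} \<and> V \<subseteq> R \<and>
    (\<forall>U\<in>F. \<forall>g\<in>U. rng G g \<in> V \<longrightarrow> src G g \<in> V \<longrightarrow> g \<in> units G)"
  using F
proof (induction F)
  case empty
  then show ?case using R by auto
next
  case (insert U F)
  then obtain V where V: "openin (gtop G) V" "V \<noteq> {}" "V \<subseteq> R"
    "\<forall>U\<in>F. \<forall>g\<in>U. rng G g \<in> V \<longrightarrow> src G g \<in> V \<longrightarrow> g \<in> units G" by auto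
  have U: "openin (gtop G) U" "inj_on (src G) U" "U \<subseteq> arrows G"
    using insert cob_arrows by (auto simp: cob_iff)
  define B where "B = U \<inter> {g \<in> arrows G. rng G g \<in> V} \<inter> {g \<in> arrows G. src G g \<in> V}"
  have oB: "openin (gtop G) B"
    unfolding B_def by (intro openin_Int U open_vimage_rng open_vimage_src V)
  show ?case
  proof (cases "\<exists>g\<in>B. rng G g \<noteq> src G g")
    case False
    moreover have "B \<subseteq> arrows G" by (auto simp: B_def)
    ultimately have "B \<subseteq> isotropy G" by (auto simp: isotropy_def)
    then have "B \<subseteq> gtop G interior_of isotropy G" using oB by (rule interior_of_maximal)
    then have "B \<subseteq> units G" using eff by (simp add: effective_def)
    then have "\<forall>g\<in>U. rng G g \<in> V \<longrightarrow> src G g \<in> V \<longrightarrow> g \<in> units G"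
      using U(3) unfolding B_def by blast
    then show ?thesis using V by (intro exI[of _ V]) auto
  next
    case True
    then obtain g where g: "g \<in> B" "rng G g \<noteq> src G g" by blast
    then have "g \<in> arrows G" by (simp add: B_def)
    then have "rng G g \<in> topspace (unit_space G)" "src G g \<in> topspace (unit_space G)"
      using rng_in_units src_in_units topspace_unit_space by auto
    then obtain V1 V2 where V12: "openin (unit_space G) V1" "openin (unit_space G) V2"
      "rng G g \<in> V1" "src G g \<in> V2" "disjnt V1 V2"
      using Hausdorff_units g(2) unfolding Hausdorff_space_def by meson
    define C where "C = B \<inter> {g \<in> arrows G. rng G g \<in> V1} \<inter> {g \<in> arrows G. src G g \<in> V2}"
    have oC: "openin (gtop G) C"
      unfolding C_def using V12 open_unit_space by (intro openin_Int oB open_vimage_rng open_vimage_src) auto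
    have gC: "g \<in> C" using g V12 \<open>g \<in> arrows G\<close> by (auto simp: C_def)
    have "openin (gtop G) (src G ` C)" using oC open_src_image by blast
    moreover have "src G ` C \<noteq> {}" using gC by auto
    moreover have sub: "src G ` C \<subseteq> V \<inter> V2" by (auto simp: C_def B_def)
    \<comment> \<open>An arrow of \<open>U\<close> whose source is a source of \<open>C\<close>
      belongs to \<open>C\<close>, because \<open>src\<close> is injective on \<open>U\<close>. Its
      range is therefore in \<open>V1\<close>, which is disjoint from the set \<open>V2\<close>
      containing all sources of \<open>C\<close>.\<close>
    moreover have "\<not> (rng G b \<in> src G ` C \<and> src G b \<in> src G ` C)" if b: "b \<in> U" for b
    proof
      assume *: "rng G b \<in> src G ` C \<and> src G b \<in> src G ` C"
      then obtain b' where b': "b' \<in> C" "src G b = src G b'" by auto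
      then have "b' \<in> U" "rng G b' \<in> V1" by (auto simp: C_def B_def)
      then have "rng G b \<in> V1" using U(2) b b' by (auto simp: inj_on_def)
      moreover have "rng G b \<in> V2" using * sub by auto
      ultimately show False using V12(5) by (auto simp: disjnt_def)
    qed
    ultimately show ?thesis using V(3,4) sub by (intro exI[of _ "src G ` C"]) blast
  qed
qed

section \<open>Products with sets of units, and ideals containing the indicator of one\<close>

lemma gprod_unit_left:
  assumes "W \<subseteq> units G" "U \<subseteq> arrows G"
  shows "gprod W U = {u \<in> U. rng G u \<in> W}"
proof (intro equalityI subsetI)
  fix k assume "k \<in> gprod W U"
  then obtain w u where *: "w \<in> W" "u \<in> U" "src G w = rng G u" "k = gmul G w u"
    by (auto simp: gprod_def)
  then have "w = rng G u" "u \<in> arrows G" using assms src_unit by auto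
  then show "k \<in> {u \<in> U. rng G u \<in> W}" using * rng_gmul_left by simp
next
  fix k assume k: "k \<in> {u \<in> U. rng G u \<in> W}"
  then have kA: "k \<in> arrows G" using assms by auto
  then have "k = gmul G (rng G k) k" using rng_gmul_left by simp
  then show "k \<in> gprod W U" using k kA src_rng gprodI by (metis (no_types, lifting) mem_Collect_eq)
qed

lemma gprod_unit_right:
  assumes "W \<subseteq> units G" "U \<subseteq> arrows G"
  shows "gprod U W = {u \<in> U. src G u \<in> W}"
proof (intro equalityI subsetI)
  fix k assume "k \<in> gprod U W"
  then obtain u w where *: "w \<in> W" "u \<in> U" "src G u = rng G w" "k = gmul G u w"
    by (auto simp: gprod_def)
  then have w: "src G u = w" "u \<in> arrows G" using assms rng_unit by auto
  then have "k = u" using *(4) gmul_src_right[of u] by simp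
  then show "k \<in> {u \<in> U. src G u \<in> W}" using * w by simp
next
  fix k assume k: "k \<in> {u \<in> U. src G u \<in> W}"
  then have kA: "k \<in> arrows G" using assms by auto
  then have "k = gmul G k (src G k)" using gmul_src_right by simp
  then show "k \<in> gprod U W" using k kA rng_src gprodI by (metis (no_types, lifting) mem_Collect_eq)
qed

lemma gprod_inv_self:
  assumes U: "U \<subseteq> arrows G" "inj_on (rng G) U"
  shows "gprod (ginv G ` U) U = src G ` U"
proof (intro equalityI subsetI)
  fix k assume "k \<in> gprod (ginv G ` U) U"
  then obtain u v where *: "u \<in> U" "v \<in> U" "src G (ginv G u) = rng G v" "k = gmul G (ginv G u) v"
    by (auto simp: gprod_def)
  then have A: "u \<in> arrows G" "v \<in> arrows G" using U by auto
  then have "u = v" using * U src_ginv by (auto simp: inj_on_def)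
  then show "k \<in> src G ` U" using * A gmul_ginv_left by auto
next
  fix k assume "k \<in> src G ` U"
  then obtain u where u: "u \<in> U" "k = src G u" by auto
  then have "u \<in> arrows G" using U by auto
  then have "k = gmul G (ginv G u) u" "src G (ginv G u) = rng G u"
    using u gmul_ginv_left src_ginv by auto
  then show "k \<in> gprod (ginv G ` U) U"
    using u(1) gprodI[of "ginv G u" "ginv G ` U" u U] by simp
qed

text \<open>Minimality gives every unit an arrow into \<open>V\<close>. A bisection \<open>B\<close>
  through that arrow conjugates the indicator of \<open>V\<close> to one of a neighbourhood of the
  unit. By compactness the ideal then contains local units for all generators.\<close>

lemma ideal_eq_algebra:
  fixes J :: "('a \<Rightarrow> 'k :: field) set"
  assumes min: "minimal G" and J: "steinberg_ideal G J"
    and V: "openin (gtop G) V" "compactin (gtop G) V" "V \<subseteq> units G" "V \<noteq> {}" "char_fun 1 V \<in> J"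
  shows "J = steinberg_algebra G"
proof -
  have JK: "J \<subseteq> steinberg_algebra G" and sub: "fun_space.subspace J"
    and conv: "\<And>a f. a \<in> steinberg_algebra G \<Longrightarrow> f \<in> J \<Longrightarrow> convolution G a f \<in> J"
      "\<And>a f. a \<in> steinberg_algebra G \<Longrightarrow> f \<in> J \<Longrightarrow> convolution G f a \<in> J"
    using J unfolding steinberg_ideal_def by blast+
  have cV: "cob V" using V cob_units by blast
  have units_nbhd: "\<exists>N. openin (gtop G) N \<and> x \<in> N \<and> N \<subseteq> units G \<and> char_fun (1 :: 'k) N \<in> J"
    if x: "x \<in> units G" for x
  proof -
    obtain y where y: "y \<in> V" using V by blast
    have "y \<in> unit_space G closure_of orbit G x" using min x y V(3) unfolding minimal_def by blast
    moreover have "openin (unit_space G) V" using V open_unit_space by blast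
    ultimately obtain z where "z \<in> orbit G x" "z \<in> V"
      using y unfolding in_closure_of by blast
    then obtain g where g: "g \<in> arrows G" "src G g = x" "rng G g \<in> V"
      by (auto simp: orbit_def)
    then have "g \<in> {g \<in> arrows G. rng G g \<in> V}" by simp
    then obtain B where B: "cob B" "g \<in> B" "B \<subseteq> {g \<in> arrows G. rng G g \<in> V}"
      by (rule cob_nbhd[OF open_vimage_rng[OF V(1)]])
    have BA: "B \<subseteq> arrows G" and Binj: "inj_on (rng G) B" and oB: "openin (gtop G) B"
      using B cob_arrows by (auto simp: cob_iff)
    have iB: "cob (ginv G ` B)" using cob_inv B by blast
    have VA: "V \<subseteq> arrows G" "inj_on (rng G) V" and iBA: "ginv G ` B \<subseteq> arrows G" "inj_on (rng G) (ginv G ` B)"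
      using cV iB cob_arrows by (auto simp: cob_iff)
    have "gprod V B = B" using gprod_unit_left[OF V(3) BA] B by auto
    then have "convolution G (char_fun 1 V) (char_fun 1 B) = (char_fun 1 B :: 'a \<Rightarrow> 'k)"
      using convolution_char_char[OF VA BA, of "1 :: 'k" 1] by simp
    then have "char_fun (1 :: 'k) B \<in> J" using conv(2)[OF char_fun_in_algebra[OF B(1)] V(5)] by metis
    moreover have "convolution G (char_fun 1 (ginv G ` B)) (char_fun 1 B) = (char_fun 1 (src G ` B) :: 'a \<Rightarrow> 'k)"
      using convolution_char_char[OF iBA BA, of "1 :: 'k" 1] gprod_inv_self[OF BA Binj] by simp
    ultimately have "char_fun (1 :: 'k) (src G ` B) \<in> J"
      using conv(1)[OF char_fun_in_algebra[OF iB]] by metis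
    then show ?thesis
      using g B BA src_in_units open_src_image[OF oB] by (intro exI[of _ "src G ` B"]) auto
  qed
  \<comment> \<open>For sets of units, convolution of indicators is intersection, so
    inclusion-exclusion keeps the indicator of a union in \<open>J\<close>.\<close>
  have union: "\<exists>N. \<Union>F \<subseteq> N \<and> N \<subseteq> units G \<and> char_fun (1 :: 'k) N \<in> J"
    if "finite F" "\<forall>N\<in>F. N \<subseteq> units G \<and> char_fun (1 :: 'k) N \<in> J" for F
    using that
  proof (induction F)
    case empty
    have "char_fun 1 {} = (0 :: 'a \<Rightarrow> 'k)" by (auto simp: char_fun_def)
    then have "char_fun (1 :: 'k) {} \<in> J" using fun_space.subspace_0[OF sub] by simp
    then show ?case by (intro exI[of _ "{}"]) simp
  next
    case (insert M F)
    then obtain N where N: "\<Union>F \<subseteq> N" "N \<subseteq> units G" "char_fun (1 :: 'k) N \<in> J" by auto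
    have M: "M \<subseteq> units G" "char_fun (1 :: 'k) M \<in> J" using insert by auto
    have MA: "M \<subseteq> arrows G" "N \<subseteq> arrows G" "inj_on (rng G) M"
      using M N units_subset rng_unit by (auto simp: inj_on_def subset_iff)
    have "gprod M N = M \<inter> N"
      using gprod_unit_left[OF M(1) MA(2)] N rng_unit by auto
    then have "convolution G (char_fun 1 M) (char_fun 1 N) = (char_fun 1 (M \<inter> N) :: 'a \<Rightarrow> 'k)"
      using convolution_char_char[OF MA(1,3,2), of "1 :: 'k" 1] by simp
    then have "char_fun (1 :: 'k) (M \<inter> N) \<in> J"
      using conv(1)[OF subsetD[OF JK M(2)] N(3)] by simp
    then have "char_fun (1 :: 'k) M + (char_fun 1 N + (\<lambda>g. (-1) * char_fun 1 (M \<inter> N) g)) \<in> J"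
      using M N by (intro fun_space.subspace_add[OF sub] fun_space.subspace_scale[OF sub])
    moreover have "char_fun (1 :: 'k) M + (char_fun 1 N + (\<lambda>g. (-1) * char_fun 1 (M \<inter> N) g))
        = char_fun 1 (M \<union> N)"
      by (auto simp: char_fun_def fun_eq_iff)
    ultimately show ?case using M N by (intro exI[of _ "M \<union> N"]) auto
  qed
  \<comment> \<open>The indicator of a set of units containing all sources of \<open>U\<close> is a
    right identity for \<open>char_fun c U\<close>.\<close>
  have gen: "char_fun c U \<in> J" if U: "cob U" for c U
  proof -
    have UA: "U \<subseteq> arrows G" "inj_on (rng G) U" "compactin (gtop G) U"
      using U cob_arrows by (auto simp: cob_iff)
    let ?N = "{N. openin (gtop G) N \<and> N \<subseteq> units G \<and> char_fun (1 :: 'k) N \<in> J}"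
    have "src G ` U \<subseteq> \<Union>?N"
    proof
      fix x assume "x \<in> src G ` U"
      then have "x \<in> units G" using UA src_in_units by auto
      then show "x \<in> \<Union>?N" using units_nbhd by blast
    qed
    then have "\<exists>F. finite F \<and> F \<subseteq> ?N \<and> src G ` U \<subseteq> \<Union>F"
      using UA by (intro compactinD[OF compact_src_image]) auto
    then obtain F where F: "finite F" "F \<subseteq> ?N" "src G ` U \<subseteq> \<Union>F" by blast
    have "\<forall>N\<in>F. N \<subseteq> units G \<and> char_fun (1 :: 'k) N \<in> J" using F(2) by blast
    from union[OF F(1) this]
    obtain N where N: "\<Union>F \<subseteq> N" "N \<subseteq> units G" "char_fun (1 :: 'k) N \<in> J"
      by (elim exE conjE)
    have "N \<subseteq> arrows G" using N units_subset by auto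
    moreover have "src G ` U \<subseteq> N" using N(1) F(3) by (rule order_trans[rotated])
    then have "gprod U N = U" using gprod_unit_right[OF N(2) UA(1)] by auto
    ultimately have "convolution G (char_fun c U) (char_fun 1 N) = char_fun c U"
      using convolution_char_char[OF UA(1,2), of N c 1] by simp
    then show ?thesis using conv(1)[OF char_fun_in_algebra[OF U] N(3)] by metis
  qed
  have "steinberg_algebra G \<subseteq> J"
    unfolding steinberg_algebra_def using gen sub by (intro fun_space.span_minimal) auto
  then show ?thesis using JK by blast
qed

text \<open>A nonzero ideal contains an \<open>f\<close> with constant nonzero value on a nonempty
  open set. Translation and compression turn \<open>f\<close> into the indicator of a nonempty
  compact open set of units, to which \<open>ideal_eq_algebra\<close> applies.\<close>

lemma simple_if:
  assumes min: "minimal G" and eff: "effective G" and ne: "units G \<noteq> {}"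
    and nv: "\<And>f :: 'a \<Rightarrow> 'k :: field. f \<in> steinberg_algebra G \<Longrightarrow> vanishes_densely f \<Longrightarrow> f = 0"
  shows "steinberg_simple TYPE('k) G"
  unfolding steinberg_simple_def
proof (intro conjI allI impI)
  obtain x where "x \<in> units G" using ne by auto
  then obtain W where W: "openin (gtop G) W" "compactin (gtop G) W" "x \<in> W" "W \<subseteq> units G"
    by (rule compact_open_unit)
  have cW: "cob W" using W cob_units by blast
  have WA: "W \<subseteq> arrows G" "inj_on (rng G) W" using cW cob_arrows by (auto simp: cob_iff)
  have "gprod W W = W" using gprod_unit_left[OF W(4) WA(1)] W rng_unit by auto
  then have "convolution G (char_fun 1 W) (char_fun 1 W) = (char_fun 1 W :: 'a \<Rightarrow> 'k)"
    using convolution_char_char[OF WA WA(1), of "1 :: 'k" 1] by simp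
  moreover have "char_fun (1 :: 'k) W x \<noteq> 0" using W by (simp add: char_fun_def)
  then have "char_fun (1 :: 'k) W \<noteq> 0" by auto
  ultimately show "\<exists>f\<in>steinberg_algebra G. \<exists>h\<in>steinberg_algebra G. convolution G f h \<noteq> (0 :: 'a \<Rightarrow> 'k)"
    using char_fun_in_algebra[OF cW] by metis
next
  fix J :: "('a \<Rightarrow> 'k) set" assume J: "steinberg_ideal G J"
  have JK: "J \<subseteq> steinberg_algebra G" and sub: "fun_space.subspace J"
    and conv: "\<And>a f. a \<in> steinberg_algebra G \<Longrightarrow> f \<in> J \<Longrightarrow> convolution G a f \<in> J"
      "\<And>a f. a \<in> steinberg_algebra G \<Longrightarrow> f \<in> J \<Longrightarrow> convolution G f a \<in> J"
    using J unfolding steinberg_ideal_def by blast+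
  show "J = {0} \<or> J = steinberg_algebra G"
  proof (cases "J \<subseteq> {0}")
    case True
    then show ?thesis using fun_space.subspace_0[OF sub] by blast
  next
    case False
    then obtain f where f: "f \<in> J" "f \<noteq> 0" by blast
    then have fK: "f \<in> steinberg_algebra G" using JK by blast
    then have "\<not> vanishes_densely f" using nv f(2) by blast
    then obtain Q c where Q: "openin (gtop G) Q" "Q \<noteq> {}" "\<forall>g\<in>Q. f g = c" "c \<noteq> 0"
      unfolding vanishes_densely_iff[OF fK] by blast
    obtain q where q: "q \<in> Q" using Q by blast
    obtain B where B: "cob B" "q \<in> B" "B \<subseteq> Q"
      by (rule cob_nbhd[OF Q(1) q])
    have BA: "B \<subseteq> arrows G" "inj_on (rng G) B" "openin (gtop G) B"
      using B cob_arrows by (auto simp: cob_iff)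
    have iB: "cob (ginv G ` B)" using cob_inv B by blast
    have iBA: "ginv G ` B \<subseteq> arrows G" "inj_on (src G) (ginv G ` B)"
      using iB cob_arrows by (auto simp: cob_iff)
    \<comment> \<open>Right translation by the inverse of \<open>B\<close> moves the constant value
      \<open>c\<close> from \<open>B\<close> to the units that are ranges of
      \<open>B\<close>.\<close>
    define f1 where "f1 = convolution G f (char_fun 1 (ginv G ` B))"
    have f1J: "f1 \<in> J" unfolding f1_def using conv(2)[OF char_fun_in_algebra[OF iB] f(1)] .
    then have f1K: "f1 \<in> steinberg_algebra G" using JK by blast
    have f1: "f1 w = c" if w: "w \<in> rng G ` B" for w
    proof -
      obtain b where b: "b \<in> B" "w = rng G b" "b \<in> arrows G" using w BA by auto
      have "f1 w = f (gmul G w (ginv G (ginv G b))) * 1"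
        unfolding f1_def using b
        by (intro convolution_char_right[OF iBA]) (auto simp: groupoid_simps)
      also have "gmul G w (ginv G (ginv G b)) = b" using b inv_inv rng_gmul_left by simp
      finally show ?thesis using Q(3) B(3) b by auto
    qed
    have R: "openin (gtop G) (rng G ` B)" "rng G ` B \<noteq> {}" "rng G ` B \<subseteq> units G"
      using open_rng_image BA B rng_in_units by auto
    obtain F where F: "finite F" "\<forall>U\<in>F. cob U" "{g. f1 g \<noteq> 0} \<subseteq> \<Union>F"
      using steinberg_supp_cover[OF f1K] by blast
    obtain V0 where V0: "openin (gtop G) V0" "V0 \<noteq> {}" "V0 \<subseteq> rng G ` B"
      "\<forall>U\<in>F. \<forall>g\<in>U. rng G g \<in> V0 \<longrightarrow> src G g \<in> V0 \<longrightarrow> g \<in> units G"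
      using effective_shrink[OF eff F(1,2) R] by blast
    obtain v where v: "v \<in> V0" using V0 by blast
    then have vu: "v \<in> units G" using V0 R by blast
    obtain V where V: "openin (gtop G) V" "compactin (gtop G) V" "v \<in> V" "V \<subseteq> V0" "V \<subseteq> units G"
      by (rule compact_open_unit_nbhd[OF V0(1) v vu])
    have cV: "cob V" using V cob_units by blast
    have VA: "V \<subseteq> arrows G" "inj_on (rng G) V" "inj_on (src G) V"
      using cV cob_arrows by (auto simp: cob_iff)
    \<comment> \<open>Compression by \<open>V\<close> keeps only the arrows with both ends in
      \<open>V\<close>. By the choice of \<open>V0\<close>, those in the support of
      \<open>f1\<close> are units, where \<open>f1\<close> has the value \<open>c\<close>.\<close>
    define f2 where "f2 = convolution G (char_fun (inverse c) V) (convolution G f1 (char_fun 1 V))"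
    have "f2 \<in> J"
      unfolding f2_def by (intro conv char_fun_in_algebra cV f1J)
    moreover have "f2 = char_fun 1 V"
    proof
      fix g
      consider "g \<notin> arrows G" | "g \<in> arrows G" "rng G g \<notin> V" | "g \<in> arrows G" "rng G g \<in> V" "src G g \<notin> V"
        | "g \<in> arrows G" "rng G g \<in> V" "src G g \<in> V" by blast
      then show "f2 g = char_fun 1 V g"
      proof cases
        case 1
        then show ?thesis using VA(1) unfolding f2_def convolution_outside[OF 1] by (auto simp: char_fun_def)
      next
        case 2
        have "rng G g \<notin> rng G ` V" using 2 V(5) rng_unit by auto
        moreover have "g \<notin> V" using 2 V(5) rng_unit by auto
        ultimately show ?thesis
          unfolding f2_def by (simp add: convolution_char_left_0) (simp add: char_fun_def)
      next
        case 3
        have left: "f2 g = inverse c * convolution G f1 (char_fun 1 V) g"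
          using convolution_char_left[OF VA(1,2) 3(1) 3(2), of "inverse c" "convolution G f1 (char_fun 1 V)"]
            3 rng_rng mul_inv_cancel[of "rng G g" g] rng_gmul_left[of g] V(5) rng_closed
            inv_mul_cancel[of "rng G g" g] src_rng
          by (simp add: f2_def)
        have "src G g \<notin> src G ` V" using 3 V(5) src_unit by auto
        moreover have "g \<notin> V" using 3 V(5) src_unit by auto
        ultimately show ?thesis
          unfolding left by (simp add: convolution_char_right_0) (simp add: char_fun_def)
      next
        case 4
        have left: "f2 g = inverse c * convolution G f1 (char_fun 1 V) g"
          using convolution_char_left[OF VA(1,2) 4(1) 4(2), of "inverse c" "convolution G f1 (char_fun 1 V)"]
            4 rng_rng rng_gmul_left[of g] rng_closed inv_mul_cancel[of "rng G g" g] src_rng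
          by (simp add: f2_def)
        have right: "convolution G f1 (char_fun 1 V) g = f1 g"
          using convolution_char_right[OF VA(1,3) 4(1) 4(3), of f1 1]
            4 src_src gmul_src_right[of g] src_closed mul_cancel_inv[of g "src G g"] rng_src
          by simp
        show ?thesis
        proof (cases "g \<in> units G")
          case True
          then have "g \<in> V" using 4 rng_unit by simp
          then show ?thesis using left right f1[of g] V(4) V0(3) Q(4) by (auto simp: char_fun_def)
        next
          case False
          then have "f1 g = 0" using V0(4) F(3) 4 V(4) by blast
          moreover have "g \<notin> V" using False V(5) by auto
          ultimately show ?thesis using left right by (simp add: char_fun_def)
        qed
      qed
    qed
    ultimately have "char_fun 1 V \<in> J" by simp
    then show ?thesis using ideal_eq_algebra[OF min J V(1,2,5)] V(3) by blast
  qed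
qed

lemma simple_iff:
  assumes ne: "units G \<noteq> {}"
  shows "steinberg_simple TYPE('k :: field) G \<longleftrightarrow>
    minimal G \<and> effective G \<and> \<not> dual_condition_S TYPE('k) G"
proof
  assume simple: "steinberg_simple TYPE('k) G"
  show "minimal G \<and> effective G \<and> \<not> dual_condition_S TYPE('k) G"
    using simple_imp_minimal[OF simple] simple_imp_effective[OF simple ne]
      simple_imp_not_vanishing_densely[OF simple ne] dual_condition_S_imp_vanishing_densely[where ?'k = 'k]
    by blast
next
  assume "minimal G \<and> effective G \<and> \<not> dual_condition_S TYPE('k) G"
  then show "steinberg_simple TYPE('k) G"
    using simple_if[OF _ _ ne, where ?'k = 'k] vanishing_densely_imp_dual_condition_S[where ?'k = 'k] by blast
qed

end

section \<open>Spans and annihilators over the prime field\<close>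

text \<open>\<open>P\<close> plays the role of a subfield and \<open>W\<close> that of a \<open>P\<close>-subspace of the vectors with
  entries in \<open>P\<close> that are supported on \<open>N\<close>.\<close>

lemma lincomb_closed:
  fixes W :: "('i \<Rightarrow> 'k :: field) set"
  assumes W: "0 \<in> W" "\<And>c v w. c \<in> P \<Longrightarrow> v \<in> W \<Longrightarrow> w \<in> W \<Longrightarrow> (\<lambda>i. c * v i + w i) \<in> W"
    and A: "finite A" "\<And>x. x \<in> A \<Longrightarrow> c x \<in> P" "\<And>x. x \<in> A \<Longrightarrow> v x \<in> W"
  shows "(\<lambda>i. \<Sum>x\<in>A. c x * v x i) \<in> W"
  using A
proof (induction A)
  case empty
  then show ?case using W(1) by (simp add: zero_fun_def)
next
  case (insert x A)
  then show ?case using W(2)[of "c x" "v x" "\<lambda>i. \<Sum>x\<in>A. c x * v x i"] by simp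
qed

text \<open>Elimination of one coordinate \<open>m\<close>. If its unit vector is in
  \<open>W\<close>, the vectors of \<open>W\<close> with entry 0 at \<open>m\<close> carry all the
  information; otherwise the induction hypothesis is applied to the projection forgetting
  \<open>m\<close>.\<close>

lemma units_or_annihilator:
  fixes W :: "('i \<Rightarrow> 'k :: field) set"
  assumes P: "1 \<in> P" "\<And>c. c \<in> P \<Longrightarrow> - c \<in> P" "\<And>c. c \<in> P \<Longrightarrow> inverse c \<in> P"
    and N: "finite N"
    and W: "0 \<in> W" "\<And>c v w. c \<in> P \<Longrightarrow> v \<in> W \<Longrightarrow> w \<in> W \<Longrightarrow> (\<lambda>i. c * v i + w i) \<in> W"
      "\<And>w i. w \<in> W \<Longrightarrow> w i \<in> P" "\<And>w i. w \<in> W \<Longrightarrow> i \<notin> N \<Longrightarrow> w i = 0"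
  shows "(\<forall>i\<in>N. (\<lambda>j. if j = i then 1 else 0) \<in> W) \<or>
    (\<exists>a. (\<exists>i\<in>N. a i \<noteq> 0) \<and> (\<forall>w\<in>W. (\<Sum>i\<in>N. a i * w i) = 0))"
  using N W
proof (induction N arbitrary: W)
  case empty
  then show ?case by simp
next
  case (insert m N)
  note W0 = insert.prems(1) and Wc = insert.prems(2) and WP = insert.prems(3) and Ws = insert.prems(4)
  have P0: "0 \<in> P" using WP[OF W0, of m] by simp
  let ?u = "\<lambda>i j. if j = i then 1 else (0 :: 'k)"
  show ?case
  proof (cases "?u m \<in> W")
    case um: True
    let ?W = "{w \<in> W. w m = 0}"
    have "(\<forall>i\<in>N. ?u i \<in> ?W) \<or> (\<exists>a. (\<exists>i\<in>N. a i \<noteq> 0) \<and> (\<forall>w\<in>?W. (\<Sum>i\<in>N. a i * w i) = 0))"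
    proof (rule insert.IH)
      show "w i = 0" if "w \<in> ?W" "i \<notin> N" for w i
        using that Ws[of w i] by (cases "i = m") auto
    qed (use W0 Wc WP in auto)
    then show ?thesis
    proof
      assume "\<forall>i\<in>N. ?u i \<in> ?W"
      then show ?thesis using um by auto
    next
      assume "\<exists>a. (\<exists>i\<in>N. a i \<noteq> 0) \<and> (\<forall>w\<in>?W. (\<Sum>i\<in>N. a i * w i) = 0)"
      then obtain a where a: "\<exists>i\<in>N. a i \<noteq> 0" "\<And>w. w \<in> ?W \<Longrightarrow> (\<Sum>i\<in>N. a i * w i) = 0" by blast
      have "(\<Sum>i\<in>insert m N. (a(m := 0)) i * w i) = 0" if w: "w \<in> W" for w
      proof -
        \<comment> \<open>The unit vector at \<open>m\<close> is used to clear the entry at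
          \<open>m\<close> without leaving \<open>W\<close>.\<close>
        have "(\<lambda>i. - w m * ?u m i + w i) \<in> ?W" using Wc[OF P(2)[OF WP[OF w, of m]] um w] by simp
        then have "(\<Sum>i\<in>N. a i * (- w m * ?u m i + w i)) = 0" by (rule a(2))
        also have "(\<Sum>i\<in>N. a i * (- w m * ?u m i + w i)) = (\<Sum>i\<in>N. a i * w i)"
          using insert.hyps by (intro sum.cong) auto
        also have "\<dots> = (\<Sum>i\<in>N. (a(m := 0)) i * w i)"
          using insert.hyps by (intro sum.cong) auto
        finally show ?thesis using insert.hyps by simp
      qed
      moreover have "\<exists>i\<in>insert m N. (a(m := 0)) i \<noteq> 0" using a(1) insert.hyps by auto
      ultimately show ?thesis by blast
    qed
  next
    case um: False
    let ?pr = "\<lambda>w. w(m := (0 :: 'k))"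
    let ?W = "?pr ` W"
    have "(\<forall>i\<in>N. ?u i \<in> ?W) \<or> (\<exists>a. (\<exists>i\<in>N. a i \<noteq> 0) \<and> (\<forall>w\<in>?W. (\<Sum>i\<in>N. a i * w i) = 0))"
    proof (rule insert.IH)
      show "0 \<in> ?W" by (rule rev_image_eqI[OF W0]) (auto simp: fun_eq_iff)
      show "(\<lambda>i. c * v i + w i) \<in> ?W" if cvw: "c \<in> P" "v \<in> ?W" "w \<in> ?W" for c v w
      proof -
        obtain v' w' where *: "v' \<in> W" "w' \<in> W" "v = ?pr v'" "w = ?pr w'" using cvw by blast
        show ?thesis
          by (rule rev_image_eqI[OF Wc[OF cvw(1) *(1,2)]]) (auto simp: * fun_eq_iff)
      qed
      show "w i \<in> P" if "w \<in> ?W" for w i using that WP P0 by auto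
      show "w i = 0" if w: "w \<in> ?W" "i \<notin> N" for w i
      proof -
        obtain v where "v \<in> W" "w = ?pr v" using w by blast
        then show ?thesis using w(2) Ws[of v i] by (cases "i = m") auto
      qed
    qed
    then show ?thesis
    proof
      assume "\<exists>a. (\<exists>i\<in>N. a i \<noteq> 0) \<and> (\<forall>w\<in>?W. (\<Sum>i\<in>N. a i * w i) = 0)"
      then obtain a where a: "\<exists>i\<in>N. a i \<noteq> 0" "\<And>w. w \<in> W \<Longrightarrow> (\<Sum>i\<in>N. a i * ?pr w i) = 0" by blast
      have "(\<Sum>i\<in>insert m N. (a(m := 0)) i * w i) = 0" if w: "w \<in> W" for w
      proof -
        have "(\<Sum>i\<in>N. (a(m := 0)) i * w i) = (\<Sum>i\<in>N. a i * ?pr w i)"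
          using insert.hyps by (intro sum.cong) auto
        then show ?thesis using insert.hyps a(2)[OF w] by simp
      qed
      moreover have "\<exists>i\<in>insert m N. (a(m := 0)) i \<noteq> 0" using a(1) insert.hyps by auto
      ultimately show ?thesis by blast
    next
      assume "\<forall>i\<in>N. ?u i \<in> ?W"
      then have "\<forall>i\<in>N. \<exists>v. v \<in> W \<and> ?u i = ?pr v" by blast
      then obtain v where v: "\<And>i. i \<in> N \<Longrightarrow> v i \<in> W" "\<And>i. i \<in> N \<Longrightarrow> ?u i = ?pr (v i)" by metis
      have v_eq: "v i j = ?u i j" if "i \<in> N" "j \<noteq> m" for i j
        using fun_cong[OF v(2)[OF that(1)], of j] that by simp
      \<comment> \<open>\<open>W\<close> projects onto all coordinates in \<open>N\<close> but lacks
        the unit vector at \<open>m\<close>, so it is the graph of the functional sending the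
        \<open>i\<close>-th unit vector to \<open>v i m\<close>; \<open>a\<close> is the equation of
        this graph.\<close>
      define a where "a i = (if i = m then -1 else v i m)" for i
      have "(\<Sum>i\<in>insert m N. a i * w i) = 0" if w: "w \<in> W" for w
      proof -
        define x where "x = (\<lambda>j. \<Sum>i\<in>N. - w i * v i j)"
        have "x \<in> W"
          unfolding x_def by (rule lincomb_closed[of W P, OF W0 Wc insert.hyps(1)]) (simp_all add: v(1) WP[OF w] P(2))
        then have y: "(\<lambda>j. 1 * x j + w j) \<in> W" using Wc[OF P(1) _ w] by blast
        let ?y = "x m + w m"
        have x_eq: "x j + w j = 0" if "j \<noteq> m" for j
        proof (cases "j \<in> N")
          case True
          have "x j = (\<Sum>i\<in>N. if i = j then - w i else 0)"
            unfolding x_def using v_eq that by (intro sum.cong) auto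
          then show ?thesis using True insert.hyps by simp
        next
          case False
          then have "x j = 0" unfolding x_def using v_eq that by (intro sum.neutral) auto
          then show ?thesis using Ws[OF w, of j] False that by simp
        qed
        \<comment> \<open>Subtracting from \<open>w\<close> its expansion in the \<open>v i\<close>
          leaves a vector supported at \<open>m\<close>. A nonzero entry could be rescaled to the
          unit vector at \<open>m\<close>, which is not in \<open>W\<close>.\<close>
        have y0: "?y = 0"
        proof (rule ccontr)
          assume nz: "?y \<noteq> 0"
          have "?y \<in> P" using WP[OF y, of m] by simp
          then have "(\<lambda>j. inverse ?y * (1 * x j + w j) + 0 j) \<in> W"
            by (intro Wc P y W0)
          moreover have "(\<lambda>j. inverse ?y * (1 * x j + w j) + 0 j) = ?u m"
            using nz x_eq by (auto simp: fun_eq_iff)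
          ultimately show False using um by simp
        qed
        have "(\<Sum>i\<in>N. a i * w i) = - x m"
          unfolding x_def sum_negf[symmetric] using insert.hyps by (intro sum.cong) (auto simp: a_def)
        then have "(\<Sum>i\<in>insert m N. a i * w i) = a m * w m - x m" using insert.hyps by simp
        also have "\<dots> = - ?y" by (simp add: a_def)
        finally show ?thesis unfolding y0 by simp
      qed
      moreover have "\<exists>i\<in>insert m N. a i \<noteq> 0" by (intro bexI[of _ m]) (auto simp: a_def)
      ultimately show ?thesis by blast
    qed
  qed
qed

text \<open>A common setting for both coefficient rings: \<open>R\<close> is given by a carrier, as
  in \<open>condition_S_over\<close>, while the coefficients of the algebra form a type. The map
  into the latter is automatically injective, since \<open>R\<close> is a field.\<close>

locale field_embedding = field R for R :: "'r ring" (structure) +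
  fixes \<phi> :: "'r \<Rightarrow> 'k :: Fields.field"
  assumes hom_add: "a \<in> carrier R \<Longrightarrow> b \<in> carrier R \<Longrightarrow> \<phi> (a \<oplus> b) = \<phi> a + \<phi> b"
    and hom_mult: "a \<in> carrier R \<Longrightarrow> b \<in> carrier R \<Longrightarrow> \<phi> (a \<otimes> b) = \<phi> a * \<phi> b"
    and hom_one: "\<phi> \<one> = 1"
begin

lemma hom_zero: "\<phi> \<zero> = 0"
proof -
  have "\<phi> \<zero> + \<phi> \<zero> = \<phi> \<zero> + 0" using hom_add[of \<zero> \<zero>] by simp
  then show ?thesis by (simp only: add_left_cancel)
qed

lemma hom_minus: "a \<in> carrier R \<Longrightarrow> \<phi> (\<ominus> a) = - \<phi> a"
  using hom_add[of a "\<ominus> a"] by (simp add: r_neg hom_zero eq_neg_iff_add_eq_0 add.commute)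

lemma hom_inv: "a \<in> carrier R \<Longrightarrow> a \<noteq> \<zero> \<Longrightarrow> \<phi> (inv a) = inverse (\<phi> a)"
proof -
  assume a: "a \<in> carrier R" "a \<noteq> \<zero>"
  then have "a \<in> Units R" using field_Units by auto
  then have "\<phi> (inv a) * \<phi> a = 1" using a hom_mult[of "inv a" a] hom_one by simp
  then show ?thesis by (metis inverse_unique mult.commute)
qed

lemma hom_inj: "inj_on \<phi> (carrier R)"
proof (rule inj_onI)
  fix a b assume ab: "a \<in> carrier R" "b \<in> carrier R" "\<phi> a = \<phi> b"
  show "a = b"
  proof (rule ccontr)
    assume "a \<noteq> b"
    then have d: "a \<ominus> b \<in> carrier R" "a \<ominus> b \<noteq> \<zero>" using ab r_right_minus_eq by auto
    then have "a \<ominus> b \<in> Units R" using field_Units by auto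
    then have "\<phi> (inv (a \<ominus> b)) * \<phi> (a \<ominus> b) = 1"
      using d hom_mult[of "inv (a \<ominus> b)" "a \<ominus> b"] hom_one by simp
    moreover have "\<phi> (a \<ominus> b) = 0"
      using ab by (simp add: minus_eq hom_add hom_minus)
    ultimately show False by simp
  qed
qed

lemma image_subfield:
  shows "0 \<in> \<phi> ` carrier R" "1 \<in> \<phi> ` carrier R"
    and "c \<in> \<phi> ` carrier R \<Longrightarrow> - c \<in> \<phi> ` carrier R"
    and "c \<in> \<phi> ` carrier R \<Longrightarrow> inverse c \<in> \<phi> ` carrier R"
    and "c \<in> \<phi> ` carrier R \<Longrightarrow> d \<in> \<phi> ` carrier R \<Longrightarrow> c + d \<in> \<phi> ` carrier R"
    and "c \<in> \<phi> ` carrier R \<Longrightarrow> d \<in> \<phi> ` carrier R \<Longrightarrow> c * d \<in> \<phi> ` carrier R"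
proof -
  show zero: "0 \<in> \<phi> ` carrier R" using hom_zero by (metis image_eqI zero_closed)
  show "1 \<in> \<phi> ` carrier R" using hom_one by (metis image_eqI one_closed)
  show "- c \<in> \<phi> ` carrier R" if "c \<in> \<phi> ` carrier R"
    using that by (auto simp: hom_minus[symmetric] intro!: imageI)
  show "c + d \<in> \<phi> ` carrier R" if "c \<in> \<phi> ` carrier R" "d \<in> \<phi> ` carrier R"
    using that by (auto simp: hom_add[symmetric] intro!: imageI)
  show "c * d \<in> \<phi> ` carrier R" if "c \<in> \<phi> ` carrier R" "d \<in> \<phi> ` carrier R"
    using that by (auto simp: hom_mult[symmetric] intro!: imageI)
  show "inverse c \<in> \<phi> ` carrier R" if c: "c \<in> \<phi> ` carrier R"
  proof -
    obtain a where a: "a \<in> carrier R" "c = \<phi> a" using c by blast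
    show ?thesis
    proof (cases "a = \<zero>")
      case True
      then show ?thesis using a hom_zero zero by simp
    next
      case False
      then have "inv a \<in> carrier R" using a field_Units by auto
      then show ?thesis using hom_inv[OF a(1) False] a by (metis image_eqI)
    qed
  qed
qed

lemma finsum_coordinate:
  assumes "finite A" "F \<in> A \<rightarrow> carrier (free_module R n)" and j: "j \<in> {1..n}"
  shows "\<phi> (finsum (free_module R n) F A j) = (\<Sum>x\<in>A. \<phi> (F x j))"
  using assms(1,2)
proof (induction A)
  case empty
  interpret M: Module.module R "free_module R n" by (rule free_module_module) (rule is_cring)
  have "finsum (free_module R n) F {} = \<zero>\<^bsub>free_module R n\<^esub>" by simp
  then show ?case using j by (simp add: free_module_def hom_zero)
next
  case (insert x A)
  interpret M: Module.module R "free_module R n" by (rule free_module_module) (rule is_cring)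
  have F: "F x \<in> carrier (free_module R n)" "F \<in> A \<rightarrow> carrier (free_module R n)"
    using insert by auto
  have fin: "finsum (free_module R n) F A \<in> carrier (free_module R n)"
    using F by (rule_tac M.finsum_closed) auto
  have "finsum (free_module R n) F (insert x A) = F x \<oplus>\<^bsub>free_module R n\<^esub> finsum (free_module R n) F A"
    using insert F by (intro M.finsum_insert) auto
  then have "finsum (free_module R n) F (insert x A) j = F x j \<oplus> finsum (free_module R n) F A j"
    using j by (simp add: free_module_def)
  moreover have "F x j \<in> carrier R" "finsum (free_module R n) F A j \<in> carrier R"
    using F fin j by (auto simp: free_module_def)
  ultimately show ?case using insert F by (simp add: hom_add)
qed

text \<open>The span is taken over \<open>R\<close>, the annihilator over the larger field. An
  annihilator of the generators kills the image of their span, so the unit vector at an index with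
  \<open>a i\<close> nonzero is missing. Conversely, without an annihilator,
  \<open>units_or_annihilator\<close> puts every unit vector into the image of the span, and
  injectivity of \<phi> brings this back to \<open>R\<close>.\<close>

lemma span_iff_no_annihilator:
  fixes S :: "nat set set"
  assumes S: "S \<subseteq> Pow {1..n}"
  shows "module_span R (free_module R n) (basis_sum R n ` S) \<noteq> carrier (free_module R n) \<longleftrightarrow>
    (\<exists>a :: nat \<Rightarrow> 'k. (\<exists>i\<in>{1..n}. a i \<noteq> 0) \<and> (\<forall>I\<in>S. sum a I = 0))"
    (is "?span \<noteq> ?car \<longleftrightarrow> ?ann")
proof
  interpret M: Module.module R "free_module R n" by (rule free_module_module) (rule is_cring)
  have finS: "finite S" using S finite_subset by auto
  have bs: "basis_sum R n I = (\<lambda>j\<in>{1..n}. if j \<in> I then \<one> else \<zero>)" if "I \<in> S" for I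
    using basis_sum_eq[OF is_cring] S that by auto
  have bs_car: "basis_sum R n I \<in> ?car" if "I \<in> S" for I
    unfolding bs[OF that] by (auto simp: free_module_def)
  have smult: "(c \<odot>\<^bsub>free_module R n\<^esub> v) j = c \<otimes> v j" if "j \<in> {1..n}" for c v j
    using that by (simp add: free_module_def)
  {
    assume "?ann"
    then obtain a :: "nat \<Rightarrow> 'k" and i where a: "i \<in> {1..n}" "a i \<noteq> 0" "\<And>I. I \<in> S \<Longrightarrow> sum a I = 0"
      by blast
    have std: "std_basis R n i \<in> ?car" by (auto simp: std_basis_def free_module_def)
    show "?span \<noteq> ?car"
    proof
      assume "?span = ?car"
      then have "std_basis R n i \<in> ?span" using std by simp
      then obtain A c where A: "finite A" "A \<subseteq> basis_sum R n ` S" "c \<in> A \<rightarrow> carrier R"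
        "std_basis R n i = finsum (free_module R n) (\<lambda>v. c v \<odot>\<^bsub>free_module R n\<^esub> v) A"
        unfolding module_span_def mem_Collect_eq by (elim exE conjE) (rule that)
      have A_car: "v \<in> ?car" if "v \<in> A" for v using that A(2) bs_car by auto
      have vj: "v j \<in> carrier R" if "v \<in> A" "j \<in> {1..n}" for v j
        using A_car[OF that(1)] that(2) by (auto simp: free_module_def)
      have coord: "\<phi> (std_basis R n i j) = (\<Sum>v\<in>A. \<phi> (c v) * \<phi> (v j))" if j: "j \<in> {1..n}" for j
      proof -
        have "\<phi> (std_basis R n i j) = (\<Sum>v\<in>A. \<phi> ((c v \<odot>\<^bsub>free_module R n\<^esub> v) j))"
          unfolding A(4) using A(1,3) A_car j by (intro finsum_coordinate) auto
        also have "\<dots> = (\<Sum>v\<in>A. \<phi> (c v) * \<phi> (v j))"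
        proof (rule sum.cong[OF refl])
          fix v assume v: "v \<in> A"
          then have "c v \<in> carrier R" using A(3) by auto
          then show "\<phi> ((c v \<odot>\<^bsub>free_module R n\<^esub> v) j) = \<phi> (c v) * \<phi> (v j)"
            unfolding smult[OF j] using vj[OF v j] by (rule hom_mult)
        qed
        finally show ?thesis .
      qed
      have ann: "(\<Sum>j\<in>{1..n}. a j * \<phi> (v j)) = 0" if v: "v \<in> A" for v
      proof -
        obtain I where I: "I \<in> S" "v = basis_sum R n I" using v A(2) by blast
        then have "(\<Sum>j\<in>{1..n}. a j * \<phi> (v j)) = (\<Sum>j\<in>{1..n}. if j \<in> I then a j else 0)"
          by (intro sum.cong) (auto simp: bs hom_one hom_zero)
        also have "\<dots> = sum a I" using I(1) S by (intro sum.mono_neutral_cong_right) auto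
        finally show ?thesis using a(3) I(1) by simp
      qed
      \<comment> \<open>Pairing the supposed expansion of the unit vector with \<open>a\<close>
        gives \<open>a i\<close> on one side and a combination of the vanishing sums
        \<open>sum a I\<close> on the other.\<close>
      have "a i = (\<Sum>j\<in>{1..n}. if j = i then a j else 0)" using a(1) by simp
      also have "\<dots> = (\<Sum>j\<in>{1..n}. a j * \<phi> (std_basis R n i j))"
        by (intro sum.cong) (auto simp: std_basis_def hom_one hom_zero)
      also have "\<dots> = (\<Sum>j\<in>{1..n}. \<Sum>v\<in>A. \<phi> (c v) * (a j * \<phi> (v j)))"
        using coord by (intro sum.cong) (auto simp: sum_distrib_left algebra_simps)
      also have "\<dots> = (\<Sum>v\<in>A. \<Sum>j\<in>{1..n}. \<phi> (c v) * (a j * \<phi> (v j)))"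
        by (rule sum.swap)
      also have "\<dots> = 0"
        unfolding sum_distrib_left[symmetric] using ann by (intro sum.neutral) auto
      finally show False using a(2) by simp
    qed
  next
    assume ne: "?span \<noteq> ?car"
    show ?ann
    proof (rule ccontr)
      assume no_ann: "\<not> ?ann"
      let ?P = "\<phi> ` carrier R"
      let ?v = "\<lambda>c j. \<Sum>I\<in>S. c I * (if j \<in> I then 1 else (0 :: 'k))"
      \<comment> \<open>The image of the \<open>R\<close>-span under \<phi>, with entries extended
        by 0 outside \<open>{1..n}\<close>.\<close>
      define W where "W = {?v c | c. \<forall>I\<in>S. c I \<in> ?P}"
      have W0: "0 \<in> W"
        unfolding W_def using image_subfield(1)
        by (intro CollectI exI[of _ "\<lambda>_. 0"]) (auto simp: fun_eq_iff)
      have Wc: "(\<lambda>i. d * v i + w i) \<in> W" if dvw: "d \<in> ?P" "v \<in> W" "w \<in> W" for d v w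
      proof -
        obtain x y where xy: "v = ?v x" "w = ?v y" "\<forall>I\<in>S. x I \<in> ?P" "\<forall>I\<in>S. y I \<in> ?P"
          using dvw(2,3) unfolding W_def by blast
        have "(\<lambda>i. d * v i + w i) = ?v (\<lambda>I. d * x I + y I)"
          unfolding xy by (auto simp: fun_eq_iff sum_distrib_left sum.distrib[symmetric] algebra_simps
              intro!: sum.cong)
        moreover have "\<forall>I\<in>S. d * x I + y I \<in> ?P"
          by (intro ballI image_subfield(5,6) dvw(1) bspec[OF xy(3)] bspec[OF xy(4)])
        ultimately show ?thesis
          unfolding W_def by (intro CollectI exI[of _ "\<lambda>I. d * x I + y I"] conjI)
      qed
      have Wsum: "(\<Sum>x\<in>T. f x) \<in> ?P" if "\<And>x. x \<in> T \<Longrightarrow> f x \<in> ?P" for T :: "nat set set" and f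
        using that image_subfield(1,5) by (induction T rule: infinite_finite_induct) auto
      have WP: "w i \<in> ?P" if "w \<in> W" for w i
        using that image_subfield unfolding W_def by (auto intro!: Wsum)
      have Ws: "w i = 0" if "w \<in> W" "i \<notin> {1..n}" for w i
      proof -
        have "i \<notin> I" if "I \<in> S" for I using that S \<open>i \<notin> {1..n}\<close> by blast
        then show ?thesis using \<open>w \<in> W\<close> unfolding W_def by (auto intro!: sum.neutral)
      qed
      have eval: "(\<Sum>i\<in>{1..n}. a i * ?v (\<lambda>J. if J = I then 1 else 0) i) = sum a I"
        if I: "I \<in> S" for a :: "nat \<Rightarrow> 'k" and I
      proof -
        have "?v (\<lambda>J. if J = I then 1 else 0) i = (if i \<in> I then 1 else 0)" for i
        proof -
          have "?v (\<lambda>J. if J = I then 1 else 0) i = (\<Sum>J\<in>S. if J = I then (if i \<in> I then 1 else 0) else 0)"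
            by (intro sum.cong) auto
          then show ?thesis using I finS by simp
        qed
        then have "(\<Sum>i\<in>{1..n}. a i * ?v (\<lambda>J. if J = I then 1 else 0) i)
            = (\<Sum>i\<in>{1..n}. if i \<in> I then a i else 0)"
          by (intro sum.cong) auto
        also have "\<dots> = sum a I" using I S by (intro sum.mono_neutral_cong_right) auto
        finally show ?thesis .
      qed
      have single: "?v (\<lambda>J. if J = I then 1 else 0) \<in> W" for I
        unfolding W_def using image_subfield(1,2)
        by (intro CollectI exI[of _ "\<lambda>J. if J = I then 1 else 0"]) simp
      have "(\<forall>i\<in>{1..n}. (\<lambda>j. if j = i then 1 else 0) \<in> W) \<or>
          (\<exists>a. (\<exists>i\<in>{1..n}. a i \<noteq> 0) \<and> (\<forall>w\<in>W. (\<Sum>i\<in>{1..n}. a i * w i) = 0))"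
        by (rule units_or_annihilator[where P = ?P and N = "{1..n}" and W = W])
          (assumption | rule image_subfield finite_atLeastAtMost W0 Wc WP Ws)+
      moreover have "\<not> (\<exists>a. (\<exists>i\<in>{1..n}. a i \<noteq> 0) \<and> (\<forall>w\<in>W. (\<Sum>i\<in>{1..n}. a i * w i) = 0))"
      proof
        assume "\<exists>a. (\<exists>i\<in>{1..n}. a i \<noteq> 0) \<and> (\<forall>w\<in>W. (\<Sum>i\<in>{1..n}. a i * w i) = 0)"
        then obtain a where a: "\<exists>i\<in>{1..n}. a i \<noteq> 0" "\<forall>w\<in>W. (\<Sum>i\<in>{1..n}. a i * w i) = 0"
          by (elim exE conjE) (rule that)
        have "sum a I = 0" if "I \<in> S" for I
          by (rule trans[OF eval[OF that, symmetric] bspec[OF a(2) single[of I]]])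
        then show False using no_ann a(1) by blast
      qed
      ultimately have units: "(\<lambda>j. if j = i then 1 else 0) \<in> W" if "i \<in> {1..n}" for i
        using that by blast
      \<comment> \<open>\<open>module_span\<close> attaches coefficients to vectors,
        \<open>W\<close> to index sets; distinct index sets must give distinct vectors for the two
        to match.\<close>
      have inj_bs: "inj_on (basis_sum R n) S"
      proof (rule inj_onI)
        fix I J assume IJ: "I \<in> S" "J \<in> S" "basis_sum R n I = basis_sum R n J"
        have "j \<in> I \<longleftrightarrow> j \<in> J" if "j \<in> {1..n}" for j
          using fun_cong[OF IJ(3), of j] that IJ(1,2) by (auto simp: bs split: if_splits)
        then show "I = J" using IJ(1,2) S by blast
      qed
      have "?car \<subseteq> ?span"
      proof
        fix v assume v: "v \<in> ?car"
        have vR: "v j \<in> carrier R" if "j \<in> {1..n}" for j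
          using v that by (auto simp: free_module_def)
        have "(\<lambda>j. \<Sum>i\<in>{1..n}. \<phi> (v i) * (if j = i then 1 else 0)) \<in> W"
          using units vR by (intro lincomb_closed[of W ?P, OF W0 Wc]) auto
        then obtain c where c: "\<forall>I\<in>S. c I \<in> ?P"
          "(\<lambda>j. \<Sum>i\<in>{1..n}. \<phi> (v i) * (if j = i then 1 else 0)) = ?v c"
          unfolding W_def by blast
        have vc: "\<phi> (v j) = ?v c j" if "j \<in> {1..n}" for j
        proof -
          have "(\<Sum>i\<in>{1..n}. \<phi> (v i) * (if j = i then 1 else 0)) = (\<Sum>i\<in>{1..n}. if i = j then \<phi> (v i) else 0)"
            by (intro sum.cong) auto
          also have "\<dots> = \<phi> (v j)" using that by simp
          finally show ?thesis using fun_cong[OF c(2), of j] by simp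
        qed
        have "\<forall>I\<in>S. \<exists>r\<in>carrier R. c I = \<phi> r" using c(1) by blast
        then obtain r where r: "\<And>I. I \<in> S \<Longrightarrow> r I \<in> carrier R" "\<And>I. I \<in> S \<Longrightarrow> c I = \<phi> (r I)"
          by metis
        define a where "a w = r (inv_into S (basis_sum R n) w)" for w
        have a_eq: "a (basis_sum R n I) = r I" if "I \<in> S" for I
          using inj_bs that by (simp add: a_def inv_into_f_f)
        let ?A = "basis_sum R n ` S" and ?F = "\<lambda>w. a w \<odot>\<^bsub>free_module R n\<^esub> w"
        have a_car: "a \<in> ?A \<rightarrow> carrier R" using a_eq r(1) by auto
        then have F: "?F \<in> ?A \<rightarrow> ?car" using bs_car by auto
        have fin_car: "finsum (free_module R n) ?F ?A \<in> ?car" by (rule M.finsum_closed[OF F])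
        have "v = finsum (free_module R n) ?F ?A"
        proof
          fix j
          show "v j = finsum (free_module R n) ?F ?A j"
          proof (cases "j \<in> {1..n}")
            case True
            have "\<phi> (finsum (free_module R n) ?F ?A j) = (\<Sum>w\<in>?A. \<phi> (?F w j))"
              using finS F True by (intro finsum_coordinate) auto
            also have "\<dots> = (\<Sum>I\<in>S. \<phi> (?F (basis_sum R n I) j))"
              using inj_bs by (simp add: sum.reindex)
            also have "\<dots> = ?v c j"
            proof (rule sum.cong[OF refl])
              fix I assume I: "I \<in> S"
              have "\<phi> (?F (basis_sum R n I) j) = \<phi> (r I \<otimes> basis_sum R n I j)"
                unfolding smult[OF True] a_eq[OF I] ..
              also have "\<dots> = c I * (if j \<in> I then 1 else 0)"
                using True r[OF I] by (simp add: bs[OF I] hom_mult hom_one hom_zero)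
              finally show "\<phi> (?F (basis_sum R n I) j) = c I * (if j \<in> I then 1 else 0)" .
            qed
            also have "\<dots> = \<phi> (v j)" using vc[OF True] by simp
            finally have eq: "\<phi> (finsum (free_module R n) ?F ?A j) = \<phi> (v j)" .
            have "finsum (free_module R n) ?F ?A j \<in> carrier R"
              using fin_car True by (auto simp: free_module_def)
            then show ?thesis by (rule inj_onD[OF hom_inj eq _ vR[OF True], symmetric])
          next
            case False
            then show ?thesis using v fin_car by (auto simp: free_module_def PiE_def extensional_def)
          qed
        qed
        then show "v \<in> ?span" using finS a_car unfolding module_span_def by blast
      qed
      moreover have "?span \<subseteq> ?car"
      proof
        fix v assume "v \<in> ?span"
        then obtain A c where A: "A \<subseteq> basis_sum R n ` S" "c \<in> A \<rightarrow> carrier R"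
          "v = finsum (free_module R n) (\<lambda>v. c v \<odot>\<^bsub>free_module R n\<^esub> v) A"
          unfolding module_span_def mem_Collect_eq by (elim exE conjE) (rule that)
        have "(\<lambda>v. c v \<odot>\<^bsub>free_module R n\<^esub> v) \<in> A \<rightarrow> ?car"
        proof
          fix w assume w: "w \<in> A"
          then have "w \<in> ?car" using A(1) bs_car by auto
          then show "c w \<odot>\<^bsub>free_module R n\<^esub> w \<in> ?car" using A(2) w by (intro M.smult_closed) auto
        qed
        then show "v \<in> ?car" unfolding A(3) by (rule M.finsum_closed)
      qed
      ultimately show False using ne by blast
    qed
  }
qed

lemma condition_S_over_iff_dual:
  fixes G :: "'g top_groupoid"
  shows "condition_S_over R G \<longleftrightarrow> dual_condition_S TYPE('k) G"
proof -
  have sub: "incidence_sets n U \<subseteq> Pow {1..n}" for n and U :: "nat \<Rightarrow> 'g set"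
    by (auto simp: incidence_sets_def)
  show ?thesis
    unfolding condition_S_over_def dual_condition_S_def span_iff_no_annihilator[OF sub] ..
qed

end

text \<open>The embedding of the rationals in a field of characteristic \<open>0\<close>; \<open>of_rat\<close> is not available,
  since the characteristic is a hypothesis rather than a type class.\<close>

definition rat_embed :: "rat \<Rightarrow> 'k :: field" where
  "rat_embed q = of_int (fst (quotient_of q)) / of_int (snd (quotient_of q))"

text \<open>The value may be computed from any fraction: two representations are compared by
  cross-multiplying in the integers, and in characteristic 0 nonzero denominators stay
  nonzero.\<close>

lemma rat_embed_eq:
  assumes char: "CHAR('k :: field) = 0" and b: "b \<noteq> 0" and q: "q = of_int a / of_int b"
  shows "rat_embed q = (of_int a / of_int b :: 'k)"
proof -
  obtain m d where md: "quotient_of q = (m, d)" by fastforce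
  then have d: "d > 0" "q = of_int m / of_int d"
    using quotient_of_denom_pos quotient_of_div by blast+
  then have "(of_int (m * b) :: rat) = of_int (a * d)"
    using q b by (simp add: field_simps)
  then have "m * b = a * d" by (simp only: of_int_eq_iff)
  then have "(of_int (m * b) :: 'k) = of_int (a * d)" by (simp only:)
  moreover have "(of_int d :: 'k) \<noteq> 0" "(of_int b :: 'k) \<noteq> 0"
    using d b char by (simp_all add: of_int_eq_0_iff_char_dvd)
  ultimately show ?thesis
    using md by (simp add: rat_embed_def field_simps)
qed

lemma field_embedding_rat:
  assumes char: "CHAR('k :: field) = 0"
  shows "field_embedding ring_of_type_algebra (rat_embed :: rat \<Rightarrow> 'k)"
proof -
  interpret field "ring_of_type_algebra :: rat ring" by (rule field_from_type_algebra)
  have frac: "\<exists>a b. b \<noteq> 0 \<and> q = of_int a / of_int b \<and> (of_int b :: 'k) \<noteq> 0 \<and>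
      rat_embed q = (of_int a / of_int b :: 'k)" for q
  proof -
    obtain m d where md: "quotient_of q = (m, d)" by fastforce
    then have d: "d > 0" "q = of_int m / of_int d"
      using quotient_of_denom_pos quotient_of_div by blast+
    then show ?thesis
      using rat_embed_eq[OF char _ d(2)] char
      by (intro exI[of _ m] exI[of _ d]) (simp add: of_int_eq_0_iff_char_dvd)
  qed
  have add: "rat_embed (x + y) = (rat_embed x + rat_embed y :: 'k)"
    and mult: "rat_embed (x * y) = (rat_embed x * rat_embed y :: 'k)" for x y
  proof -
    obtain a b where x: "b \<noteq> 0" "x = of_int a / of_int b" "(of_int b :: 'k) \<noteq> 0"
      "rat_embed x = (of_int a / of_int b :: 'k)" using frac by blast
    obtain c d where y: "d \<noteq> 0" "y = of_int c / of_int d" "(of_int d :: 'k) \<noteq> 0"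
      "rat_embed y = (of_int c / of_int d :: 'k)" using frac by blast
    have "of_int a / of_int b + of_int c / of_int d = (of_int (a * d + c * b) / of_int (b * d) :: rat)"
      using x(1) y(1) by (simp add: add_frac_eq)
    then have "x + y = of_int (a * d + c * b) / of_int (b * d)" by (simp only: x(2) y(2))
    then have "rat_embed (x + y) = (of_int (a * d + c * b) / of_int (b * d) :: 'k)"
      using x(1) y(1) by (intro rat_embed_eq[OF char]) auto
    then show "rat_embed (x + y) = (rat_embed x + rat_embed y :: 'k)"
      unfolding x(4) y(4) using x(3) y(3) by (simp add: field_simps)
    have "x * y = of_int (a * c) / of_int (b * d)" by (simp add: x(2) y(2))
    then have "rat_embed (x * y) = (of_int (a * c) / of_int (b * d) :: 'k)"
      using x(1) y(1) by (intro rat_embed_eq[OF char]) auto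
    then show "rat_embed (x * y) = (rat_embed x * rat_embed y :: 'k)"
      unfolding x(4) y(4) by simp
  qed
  have "rat_embed 1 = (1 :: 'k)" using rat_embed_eq[OF char, of 1 1 1] by simp
  then show ?thesis
    by unfold_locales (auto simp: ring_of_type_algebra_def add mult)
qed

text \<open>Operations of the residue ring are integer operations followed by reduction modulo
  \<open>p\<close>, and that reduction changes the integer by a multiple of the characteristic,
  which \<open>of_int\<close> does not see.\<close>

lemma field_embedding_residue_ring:
  assumes p: "Factorial_Ring.prime p" and char: "CHAR('k :: field) = p"
  shows "field_embedding (residue_ring (int p)) (of_int :: int \<Rightarrow> 'k)"
proof -
  interpret residues_prime p "residue_ring (int p)" using p by unfold_locales
  have of_int_mod: "(of_int (a mod int p) :: 'k) = of_int a" for a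
  proof -
    have "int p dvd a mod int p - a" by (simp add: mod_eq_dvd_iff[symmetric])
    then have "(of_int (a mod int p - a) :: 'k) = 0" using char by (simp only: of_int_eq_0_iff_char_dvd)
    then show ?thesis by simp
  qed
  show ?thesis
  proof unfold_locales
    fix a b
    show "(of_int (a \<oplus>\<^bsub>residue_ring (int p)\<^esub> b) :: 'k) = of_int a + of_int b"
      by (simp add: residue_ring_def of_int_mod)
    show "(of_int (a \<otimes>\<^bsub>residue_ring (int p)\<^esub> b) :: 'k) = of_int a * of_int b"
      by (simp add: residue_ring_def of_int_mod)
  qed (simp add: residue_ring_def)
qed

text \<open>The characteristic of a field is 0 or prime, so the coefficient ring of the condition is
  the prime field and embeds in the coefficients of the algebra.\<close>

lemma condition_S_iff_dual:
  assumes char: "CHAR('k :: field) = p"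
  shows "condition_S p G \<longleftrightarrow> dual_condition_S TYPE('k) G"
proof (cases "p = 0")
  case True
  then interpret field_embedding ring_of_type_algebra "rat_embed :: rat \<Rightarrow> 'k"
    using char by (intro field_embedding_rat) simp
  show ?thesis using True condition_S_over_iff_dual by (simp add: condition_S_def)
next
  case False
  then have "Factorial_Ring.prime p" using char prime_CHAR_semidom[where ?'a = 'k] by simp
  then interpret field_embedding "residue_ring (int p)" "of_int :: int \<Rightarrow> 'k"
    using char by (rule field_embedding_residue_ring)
  show ?thesis using False condition_S_over_iff_dual by (simp add: condition_S_def)
qed

theorem corollary2:
  fixes G :: "'g top_groupoid" and p :: nat
  assumes "ample_groupoid G"
    and "\<not> Hausdorff_space (gtop G)"
    and "CHAR('k :: field) = p"
  shows "steinberg_simple TYPE('k) G \<longleftrightarrow> minimal G \<and> effective G \<and> \<not> condition_S p G"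
proof -
  interpret ample_groupoid G by fact
  \<comment> \<open>The empty space is Hausdorff, so \<open>G\<close> has an arrow and hence a
    unit.\<close>
  have "arrows G \<noteq> {}"
    using assms(2) by (auto simp: arrows_def Hausdorff_space_def)
  then have "units G \<noteq> {}" by (simp add: units_def)
  then show ?thesis
    using simple_iff[where ?'k = 'k] condition_S_iff_dual[OF assms(3)] by blast
qed

end
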